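(* Let $q\ge 3$ be an integer. There is an algorithm that, given an $n$-vertex graph $G$ with a tree decomposition of width $\mathrm{tw}(G)$ and a point $(a,b)$ with $(a-1)(b-1)=q$, computes $T(G;a,b)$ in time $q^{\mathrm{tw}(G)}n^{O(1)}$.
   Context: For $G=(V,E)$ (parallel edges allowed) and $A\subseteq E$, $k(A)$ is the number of components of $(V,A)$; $T(G;x,y)=\sum_{A\subseteq E}(x-1)^{k(A)-k(E)}(y-1)^{k(A)+|A|-|V|}$. Arithmetic operations on numbers are assumed to take constant time (word RAM).
   Formalization: The time bound has an added term polynomial in the number of edges (with multiplicity) and of decomposition nodes, since parallel edges and decomposition size are not bounded by n; when both are n^{O(1)} it is q^{tw(G)} n^{O(1)}. *)

theory Defs
  imports Complex_Main
begin

section \<open>Multigraphs and the Tutte polynomial\<close>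

text \<open>The vertices are \<open>0, ..., nverts - 1\<close>.  An edge is a position in the list \<open>edges\<close>, so
  repeated entries are parallel edges; \<open>(u, v)\<close> and \<open>(v, u)\<close> both describe an undirected edge
  between \<open>u\<close> and \<open>v\<close>.  Loops are not excluded.\<close>

record graph =
  nverts :: nat
  edges :: "(nat \<times> nat) list"

definition verts :: "graph \<Rightarrow> nat set" where
  "verts G = {..<nverts G}"

definition edge_ids :: "graph \<Rightarrow> nat set" where
  "edge_ids G = {..<length (edges G)}"

definition wf_graph :: "graph \<Rightarrow> bool" where
  "wf_graph G \<longleftrightarrow> (\<forall>(u, v) \<in> set (edges G). u \<in> verts G \<and> v \<in> verts G)"

definition joins :: "graph \<Rightarrow> nat \<Rightarrow> nat \<Rightarrow> nat \<Rightarrow> bool" where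
  "joins G e u v \<longleftrightarrow> edges G ! e = (u, v) \<or> edges G ! e = (v, u)"

definition connection :: "graph \<Rightarrow> nat set \<Rightarrow> (nat \<times> nat) set" where
  "connection G A = {(u, v). \<exists>e\<in>A. joins G e u v}\<^sup>*"

definition num_components :: "graph \<Rightarrow> nat set \<Rightarrow> nat" where
  "num_components G A = card (verts G // connection G A)"

text \<open>The subtractions in the exponents never truncate: for \<open>A \<subseteq> E\<close> one has \<open>k(E) \<le> k(A)\<close> and
  \<open>|V| \<le> k(A) + |A|\<close>.\<close>

definition tutte :: "graph \<Rightarrow> 'a::comm_ring_1 \<Rightarrow> 'a \<Rightarrow> 'a" where
  "tutte G x y =
     (\<Sum>A\<in>Pow (edge_ids G).
        (x - 1) ^ (num_components G A - num_components G (edge_ids G)) *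
        (y - 1) ^ (num_components G A + card A - card (verts G)))"


section \<open>Tree decompositions and treewidth\<close>

text \<open>A cycle of length one is a loop, a cycle of length two is a pair of parallel edges.\<close>

definition is_cycle :: "graph \<Rightarrow> nat list \<Rightarrow> nat list \<Rightarrow> bool" where
  "is_cycle G vs es \<longleftrightarrow>
     vs \<noteq> [] \<and> length es = length vs \<and> distinct vs \<and> distinct es \<and>
     set vs \<subseteq> verts G \<and> set es \<subseteq> edge_ids G \<and>
     (\<forall>j<length vs. joins G (es ! j) (vs ! j) (vs ! (Suc j mod length vs)))"

definition is_tree :: "graph \<Rightarrow> bool" where
  "is_tree T \<longleftrightarrow> wf_graph T \<and> num_components T (edge_ids T) = 1 \<and> (\<nexists>vs es. is_cycle T vs es)"

text \<open>The third condition says that the nodes whose bags contain \<open>v\<close> induce a connected subgraph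
  of \<open>T\<close>: any two of them are linked along tree edges both of whose ends contain \<open>v\<close>.\<close>

definition tree_decomposition :: "graph \<Rightarrow> graph \<Rightarrow> (nat \<Rightarrow> nat set) \<Rightarrow> bool" where
  "tree_decomposition G T bag \<longleftrightarrow>
     is_tree T \<and>
     (\<Union>i\<in>verts T. bag i) = verts G \<and>
     (\<forall>(u, v) \<in> set (edges G). \<exists>i\<in>verts T. u \<in> bag i \<and> v \<in> bag i) \<and>
     (\<forall>v\<in>verts G. \<forall>i\<in>verts T. \<forall>j\<in>verts T. v \<in> bag i \<and> v \<in> bag j \<longrightarrow>
        (i, j) \<in> connection T
          {e \<in> edge_ids T. v \<in> bag (fst (edges T ! e)) \<and> v \<in> bag (snd (edges T ! e))})"

text \<open>The subtraction truncates only for the graph without vertices, which gets width \<open>0\<close>.\<close>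

definition width :: "graph \<Rightarrow> (nat \<Rightarrow> nat set) \<Rightarrow> nat" where
  "width T bag = Max ((\<lambda>i. card (bag i)) ` verts T) - 1"

definition treewidth :: "graph \<Rightarrow> nat" where
  "treewidth G = (LEAST k. \<exists>T bag. tree_decomposition G T bag \<and> width T bag = k)"


section \<open>A word RAM with unit-cost arithmetic on numbers\<close>

text \<open>
  Memory consists of word arrays and number arrays.  Word cells hold natural numbers of at most
  \<open>w\<close> bits and serve as data, loop counters and addresses; number cells hold elements of a field
  \<open>'a\<close>.  A program refers to arrays by constant names, hence uses finitely many of them (they can
  be interleaved in a single memory); cell \<open>0\<close> of an array can play the role of a register.
  There is no conversion from numbers to words, so unit-cost arithmetic on numbers of unbounded
  size cannot be used to manipulate long bit strings.
\<close>

datatype wop = WAdd | WSub | WMul | WDiv | WMod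
datatype nop = NAdd | NSub | NMul | NDiv

datatype wexp =
    WConst nat
  | WGet nat wexp  \<comment> \<open>array name, index\<close>
  | WOp wop wexp wexp

datatype nexp =
    NConst int
  | NGet nat wexp
  | NOp nop nexp nexp

datatype bexp =
    WLess wexp wexp
  | NZero nexp
  | BNot bexp
  | BAnd bexp bexp

datatype com =
    Skip
  | WSet nat wexp wexp  \<comment> \<open>array name, index, new value\<close>
  | NSet nat wexp nexp
  | Seq com com
  | Cond bexp com com
  | While bexp com

record 'a state =
  words :: "nat \<Rightarrow> nat \<Rightarrow> nat"
  nums :: "nat \<Rightarrow> nat \<Rightarrow> 'a"

fun wop_val :: "wop \<Rightarrow> nat \<Rightarrow> nat \<Rightarrow> nat" where
  "wop_val WAdd x y = x + y"
| "wop_val WSub x y = x - y"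
| "wop_val WMul x y = x * y"
| "wop_val WDiv x y = x div y"
| "wop_val WMod x y = x mod y"

fun nop_val :: "nop \<Rightarrow> 'a::field \<Rightarrow> 'a \<Rightarrow> 'a" where
  "nop_val NAdd x y = x + y"
| "nop_val NSub x y = x - y"
| "nop_val NMul x y = x * y"
| "nop_val NDiv x y = x / y"

fun wval :: "wexp \<Rightarrow> 'a state \<Rightarrow> nat" where
  "wval (WConst k) s = k"
| "wval (WGet r i) s = words s r (wval i s)"
| "wval (WOp f x y) s = wop_val f (wval x s) (wval y s)"

fun nval :: "nexp \<Rightarrow> 'a::field state \<Rightarrow> 'a" where
  "nval (NConst k) s = of_int k"
| "nval (NGet r i) s = nums s r (wval i s)"
| "nval (NOp f x y) s = nop_val f (nval x s) (nval y s)"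

fun bval :: "bexp \<Rightarrow> 'a::field state \<Rightarrow> bool" where
  "bval (WLess x y) s \<longleftrightarrow> wval x s < wval y s"
| "bval (NZero x) s \<longleftrightarrow> nval x s = 0"
| "bval (BNot c) s \<longleftrightarrow> \<not> bval c s"
| "bval (BAnd c d) s \<longleftrightarrow> bval c s \<and> bval d s"

text \<open>Every word that occurs during an evaluation, addresses and intermediate results included,
  has to fit into \<open>w\<close> bits; otherwise the machine gets stuck.\<close>

fun wfits :: "nat \<Rightarrow> wexp \<Rightarrow> 'a state \<Rightarrow> bool" where
  "wfits w (WConst k) s \<longleftrightarrow> k < 2 ^ w"
| "wfits w (WGet r i) s \<longleftrightarrow> wfits w i s \<and> words s r (wval i s) < 2 ^ w"
| "wfits w (WOp f x y) s \<longleftrightarrow>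
     wfits w x s \<and> wfits w y s \<and> wop_val f (wval x s) (wval y s) < 2 ^ w"

fun nfits :: "nat \<Rightarrow> nexp \<Rightarrow> 'a state \<Rightarrow> bool" where
  "nfits w (NConst k) s \<longleftrightarrow> True"
| "nfits w (NGet r i) s \<longleftrightarrow> wfits w i s"
| "nfits w (NOp f x y) s \<longleftrightarrow> nfits w x s \<and> nfits w y s"

fun bfits :: "nat \<Rightarrow> bexp \<Rightarrow> 'a state \<Rightarrow> bool" where
  "bfits w (WLess x y) s \<longleftrightarrow> wfits w x s \<and> wfits w y s"
| "bfits w (NZero x) s \<longleftrightarrow> nfits w x s"
| "bfits w (BNot c) s \<longleftrightarrow> bfits w c s"
| "bfits w (BAnd c d) s \<longleftrightarrow> bfits w c s \<and> bfits w d s"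

text \<open>Each constant, memory access, operation, test and assignment takes one time step.\<close>

fun wcost :: "wexp \<Rightarrow> nat" where
  "wcost (WConst k) = 1"
| "wcost (WGet r i) = wcost i + 1"
| "wcost (WOp f x y) = wcost x + wcost y + 1"

fun ncost :: "nexp \<Rightarrow> nat" where
  "ncost (NConst k) = 1"
| "ncost (NGet r i) = wcost i + 1"
| "ncost (NOp f x y) = ncost x + ncost y + 1"

fun bcost :: "bexp \<Rightarrow> nat" where
  "bcost (WLess x y) = wcost x + wcost y + 1"
| "bcost (NZero x) = ncost x + 1"
| "bcost (BNot c) = bcost c + 1"
| "bcost (BAnd c d) = bcost c + bcost d + 1"

definition set_word :: "nat \<Rightarrow> nat \<Rightarrow> nat \<Rightarrow> 'a state \<Rightarrow> 'a state" where
  "set_word r i x s = s\<lparr>words := (words s)(r := (words s r)(i := x))\<rparr>"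

definition set_num :: "nat \<Rightarrow> nat \<Rightarrow> 'a \<Rightarrow> 'a state \<Rightarrow> 'a state" where
  "set_num r i x s = s\<lparr>nums := (nums s)(r := (nums s r)(i := x))\<rparr>"

text \<open>\<open>run w P s t s'\<close>: on the machine with \<open>w\<close>-bit words, program \<open>P\<close> started in state \<open>s\<close>
  halts in state \<open>s'\<close> after \<open>t\<close> time steps.\<close>

inductive run :: "nat \<Rightarrow> com \<Rightarrow> 'a::field state \<Rightarrow> nat \<Rightarrow> 'a state \<Rightarrow> bool" for w :: nat where
  run_Skip: "run w Skip s 1 s"
| run_WSet: "wfits w i s \<Longrightarrow> wfits w x s \<Longrightarrow>
    run w (WSet r i x) s (wcost i + wcost x + 1) (set_word r (wval i s) (wval x s) s)"
| run_NSet: "wfits w i s \<Longrightarrow> nfits w x s \<Longrightarrow>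
    run w (NSet r i x) s (wcost i + ncost x + 1) (set_num r (wval i s) (nval x s) s)"
| run_Seq: "run w c s t s' \<Longrightarrow> run w d s' u s'' \<Longrightarrow> run w (Seq c d) s (t + u) s''"
| run_CondTrue: "bfits w b s \<Longrightarrow> bval b s \<Longrightarrow> run w c s t s' \<Longrightarrow>
    run w (Cond b c d) s (bcost b + 1 + t) s'"
| run_CondFalse: "bfits w b s \<Longrightarrow> \<not> bval b s \<Longrightarrow> run w d s t s' \<Longrightarrow>
    run w (Cond b c d) s (bcost b + 1 + t) s'"
| run_WhileFalse: "bfits w b s \<Longrightarrow> \<not> bval b s \<Longrightarrow> run w (While b c) s (bcost b + 1) s"
| run_WhileTrue: "bfits w b s \<Longrightarrow> bval b s \<Longrightarrow> run w c s t s' \<Longrightarrow> run w (While b c) s' u s'' \<Longrightarrow>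
    run w (While b c) s (bcost b + 1 + t + u) s''"

inductive_cases run_SkipE: "run w Skip s t s'"
inductive_cases run_WSetE: "run w (WSet r i x) s t s'"
inductive_cases run_NSetE: "run w (NSet r i x) s t s'"
inductive_cases run_SeqE: "run w (Seq c d) s t s'"
inductive_cases run_CondE: "run w (Cond b c d) s t s'"
inductive_cases run_WhileE: "run w (While b c) s t s'"

lemma run_deterministic:
  "run w c s t s' \<Longrightarrow> run w c s u s'' \<Longrightarrow> u = t \<and> s'' = s'"
proof (induction arbitrary: u s'' rule: run.induct)
  case run_Skip
  from run_Skip.prems show ?case by (rule run_SkipE) simp
next
  case run_WSet
  from run_WSet.prems show ?case by (rule run_WSetE) simp
next
  case run_NSet
  from run_NSet.prems show ?case by (rule run_NSetE) simp
next
  case run_Seq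
  from run_Seq.prems show ?case by (rule run_SeqE) (metis run_Seq.IH)
next
  case run_CondTrue
  from run_CondTrue.prems show ?case
    by (rule run_CondE) (simp_all add: run_CondTrue.hyps, (drule run_CondTrue.IH)+, simp)
next
  case run_CondFalse
  from run_CondFalse.prems show ?case
    by (rule run_CondE) (simp_all add: run_CondFalse.hyps, (drule run_CondFalse.IH)+, simp)
next
  case run_WhileFalse
  from run_WhileFalse.prems show ?case
    by (rule run_WhileE) (simp_all add: run_WhileFalse.hyps)
next
  case run_WhileTrue
  from run_WhileTrue.prems show ?case
    by (rule run_WhileE) (simp_all add: run_WhileTrue.hyps, drule run_WhileTrue.IH(1), simp,
        drule run_WhileTrue.IH(2), simp)
qed


section \<open>Input and output conventions\<close>

definition array_of :: "'b list \<Rightarrow> 'b \<Rightarrow> nat \<Rightarrow> 'b" where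
  "array_of xs z k = (if k < length xs then xs ! k else z)"

text \<open>\<open>G\<close> and \<open>T\<close> are given as edge lists and the bags as a 0/1 incidence matrix in row-major
  order, one row for each node of \<open>T\<close>.  All remaining cells are zero.\<close>

definition bag_matrix :: "graph \<Rightarrow> graph \<Rightarrow> (nat \<Rightarrow> nat set) \<Rightarrow> nat \<Rightarrow> nat" where
  "bag_matrix G T bag k =
     (if k < nverts T * nverts G \<and> k mod nverts G \<in> bag (k div nverts G) then 1 else 0)"

definition input_state ::
  "graph \<Rightarrow> graph \<Rightarrow> (nat \<Rightarrow> nat set) \<Rightarrow> 'a::field \<Rightarrow> 'a \<Rightarrow> 'a state" where
  "input_state G T bag a b =
     \<lparr> words = array_of
         [ array_of [nverts G, length (edges G), nverts T, length (edges T)] 0,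
           array_of (map fst (edges G)) 0,
           array_of (map snd (edges G)) 0,
           array_of (map fst (edges T)) 0,
           array_of (map snd (edges T)) 0,
           bag_matrix G T bag ] (\<lambda>_. 0),
       nums = array_of [array_of [a, b] 0] (\<lambda>_. 0) \<rparr>"

definition result :: "'a state \<Rightarrow> 'a" where
  "result s = nums s 1 0"

end

theory Submission
  imports Defs "HOL-Library.FuncSet"
begin

text \<open>
  Expanding the product over the edges shows that
  \<open>T(G; a, b) = q^(-n) (a - 1)^(n - k(E)) Z\<close>, where \<open>Z\<close> sums \<open>b\<close> to the number of monochromatic
  edges over all \<open>q\<close>-colourings of the vertices.  The sum \<open>Z\<close> is computed by variable elimination.

  Every nonempty set \<open>R\<close> of vertices contains a vertex \<open>v\<close> such that a single bag contains everything
  in \<open>R\<close> that shares a bag with \<open>v\<close>; eliminating such vertices one after the other yields messages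
  that depend on the colours of at most \<open>tw(G)\<close> later vertices.  Assigning to the vertices, in
  reverse order, the least slot unused among those later vertices makes all bags rainbow with
  \<open>tw(G) + 1\<close> slots.  A number below \<open>q^(tw(G) + 1)\<close>, read in base \<open>q\<close>, therefore encodes a colouring of
  any bag (the digit at the slot of \<open>v\<close> is the colour of \<open>v\<close>), so all message tables are indexed in the
  same way.  Since the bags are only used to find the order, the size of \<open>T\<close> and the number of
  parallel edges enter the running time additively and not as factors of \<open>q^tw(G)\<close>.
\<close>

section \<open>Tree decompositions and eliminable vertices\<close>

text \<open>On the curve \<open>(a - 1) * (b - 1) = q\<close> each term of the subset expansion
  becomes, up to a factor independent of \<open>A\<close>, \<open>q ^ k(A) * (b - 1) ^ |A|\<close>,
  and \<open>q ^ k(A)\<close> counts the colourings constant on the components of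
  \<open>(V, A)\<close>. Dividing by \<open>q\<close> is harmless in characteristic 0, and there
  \<open>q > 0\<close> forces \<open>a - 1\<close> and \<open>b - 1\<close> to be nonzero.
  Eliminability is stated through the bags alone, so the program tests it by scanning the incidence
  matrix; that T is a tree guarantees a vertex passing the test. Sharing slots has a price: distant
  vertices may own the same digit, so overwriting the digit of one vertex recolours others. This is
  sound because each step of the recursion sees only positions with pairwise distinct slots. The
  constant of the time bound carries \<open>q ^ 2\<close>: one factor because a table has up to
  \<open>q ^ (tw + 1)\<close> entries, one because each entry sums over \<open>q\<close> colours.
  The machine has no exponentiation, so \<open>q ^ slot\<close> and the prefactor
  \<open>(a - 1) ^ (n - k(E)) / q ^ n\<close> are built by repeated multiplication and
  division.\<close>

lemma joins_sym: "joins G e u v \<Longrightarrow> joins G e v u"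
  by (auto simp: joins_def)

lemma joins_ends: "joins G e u v \<Longrightarrow> joins G e x y \<Longrightarrow> (x = u \<and> y = v) \<or> (x = v \<and> y = u)"
  by (auto simp: joins_def)

lemma joins_verts:
  assumes "wf_graph G" "e \<in> edge_ids G" "joins G e u v"
  shows "u \<in> verts G" "v \<in> verts G"
proof -
  have "edges G ! e \<in> set (edges G)" using assms(2) by (simp add: edge_ids_def)
  with assms show "u \<in> verts G" "v \<in> verts G"
    by (force simp: wf_graph_def joins_def)+
qed

section \<open>Connectivity in multigraphs and bridges of trees\<close>

lemma connection_refl: "(u, u) \<in> connection G A"
  by (simp add: connection_def)

lemma connection_sym: "(u, v) \<in> connection G A \<Longrightarrow> (v, u) \<in> connection G A"
proof -
  have "sym {(u, v). \<exists>e\<in>A. joins G e u v}" by (auto simp: sym_def dest: joins_sym)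
  then have "sym (connection G A)" unfolding connection_def by (rule sym_rtrancl)
  then show "(u, v) \<in> connection G A \<Longrightarrow> (v, u) \<in> connection G A" by (auto dest: symD)
qed

lemma connection_trans:
  "(u, v) \<in> connection G A \<Longrightarrow> (v, x) \<in> connection G A \<Longrightarrow> (u, x) \<in> connection G A"
  unfolding connection_def by (rule rtrancl_trans)

lemma connection_edge: "e \<in> A \<Longrightarrow> joins G e u v \<Longrightarrow> (u, v) \<in> connection G A"
  unfolding connection_def by blast

lemma connection_mono: "A \<subseteq> B \<Longrightarrow> connection G A \<subseteq> connection G B"
  unfolding connection_def by (rule rtrancl_mono) blast

lemma connection_induct [consumes 1, case_names refl step]:
  assumes "(u, v) \<in> connection G A"
    and "P u"
    and "\<And>x y e. (u, x) \<in> connection G A \<Longrightarrow> P x \<Longrightarrow> e \<in> A \<Longrightarrow> joins G e x y \<Longrightarrow> P y"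
  shows "P v"
  using assms(1) unfolding connection_def
  by (induction rule: rtrancl_induct) (auto simp: assms(2) connection_def intro: assms(3))

text \<open>\<open>is_cycle\<close> asks for distinct vertices and edges, while reachability only
  yields a walk. Whenever the walk returns to a vertex already listed, the list is cut back to that
  vertex.\<close>

lemma connection_simple_path:
  assumes "(u, v) \<in> connection G A"
  shows "\<exists>vs es. length vs = Suc (length es) \<and> hd vs = u \<and> last vs = v \<and> distinct vs \<and>
    set es \<subseteq> A \<and> (\<forall>j<length es. joins G (es ! j) (vs ! j) (vs ! Suc j))"
  using assms
proof (induction rule: connection_induct)
  case refl
  show ?case by (rule exI[of _ "[u]"], rule exI[of _ "[]"]) simp
next
  case (step x y e)
  then obtain vs es where p: "length vs = Suc (length es)" "hd vs = u" "last vs = x" "distinct vs"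
    "set es \<subseteq> A" "\<forall>j<length es. joins G (es ! j) (vs ! j) (vs ! Suc j)" by blast
  have ne: "vs \<noteq> []" using p(1) by auto
  show ?case
  proof (cases "y \<in> set vs")
    case True
    then obtain i where i: "i < length vs" "vs ! i = y" by (auto simp: in_set_conv_nth)
    have "last (take (Suc i) vs) = y" using i by (simp add: take_Suc_conv_app_nth)
    moreover have "hd (take (Suc i) vs) = u" using p(2) ne by (simp add: hd_take)
    moreover have "set (take i es) \<subseteq> A" using p(5) set_take_subset by fastforce
    ultimately show ?thesis using i p
      by (intro exI[of _ "take (Suc i) vs"] exI[of _ "take i es"]) auto
  next
    case False
    have "joins G ((es @ [e]) ! j) ((vs @ [y]) ! j) ((vs @ [y]) ! Suc j)"
      if "j < length (es @ [e])" for j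
    proof (cases "j < length es")
      case True
      then show ?thesis using p(1,6) by (simp add: nth_append)
    next
      case f: False
      then have j: "j = length es" using that by simp
      have "vs ! j = x" using p(1,3) ne j by (simp add: last_conv_nth)
      then show ?thesis using p(1) j step.hyps by (simp add: nth_append)
    qed
    then show ?thesis using p False ne step.hyps
      by (intro exI[of _ "vs @ [y]"] exI[of _ "es @ [e]"]) auto
  qed
qed

text \<open>A simple path between the ends of \<open>e\<close> that avoids \<open>e\<close> is
  closed by \<open>e\<close> to a cycle. For a loop the path has a single vertex and the cycle has
  length one.\<close>

lemma tree_edge_is_bridge:
  assumes T: "is_tree T" and e: "e \<in> edge_ids T" "joins T e i j"
  shows "(i, j) \<notin> connection T (edge_ids T - {e})"
proof
  assume "(i, j) \<in> connection T (edge_ids T - {e})"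
  from connection_simple_path[OF this] obtain vs es where
    p: "length vs = Suc (length es)" "hd vs = i" "last vs = j" "distinct vs"
    "set es \<subseteq> edge_ids T - {e}" "\<forall>l<length es. joins T (es ! l) (vs ! l) (vs ! Suc l)" by blast
  have ne: "vs \<noteq> []" using p(1) by auto
  have wf: "wf_graph T" using T by (simp add: is_tree_def)
  \<comment> \<open>An edge used at two positions would have the same ends at both, against the
    distinctness of \<open>vs\<close>; hence the edges are distinct as well.\<close>
  have "es ! k \<noteq> es ! l" if kl: "k < l" "l < length es" for k l
  proof
    assume "es ! k = es ! l"
    with p(6) kl have "joins T (es ! l) (vs ! k) (vs ! Suc k)" "joins T (es ! l) (vs ! l) (vs ! Suc l)"
      by (metis less_trans)+
    from joins_ends[OF this] have "vs ! k = vs ! l \<or> vs ! k = vs ! Suc l" by auto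
    then show False using p(1,4) kl by (auto simp: nth_eq_iff_index_eq)
  qed
  then have "distinct es" by (metis distinct_conv_nth linorder_neqE_nat)
  then have "distinct (es @ [e])" using p(5) by auto
  moreover have "set vs \<subseteq> verts T"
  proof
    fix x assume "x \<in> set vs"
    then obtain k where k: "k < length vs" "x = vs ! k" by (auto simp: in_set_conv_nth)
    show "x \<in> verts T"
    proof (cases "k < length es")
      case True
      then have "es ! k \<in> edge_ids T" using p(5) by (meson DiffD1 nth_mem subsetD)
      with p(6) True k joins_verts[OF wf] show ?thesis by blast
    next
      case False
      then have "x = j" using k p(1,3) ne by (metis last_conv_nth Suc_diff_1 diff_Suc_1 less_SucE)
      then show ?thesis using joins_verts[OF wf e] by simp
    qed
  qed
  moreover have "joins T ((es @ [e]) ! l) (vs ! l) (vs ! (Suc l mod length vs))"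
    if "l < length vs" for l
  proof (cases "l < length es")
    case True
    then show ?thesis using p(1,6) by (simp add: nth_append)
  next
    case False
    then have l: "l = length es" using that p(1) by simp
    then have "vs ! l = j" "vs ! 0 = i" using p ne by (simp_all add: last_conv_nth hd_conv_nth)
    then show ?thesis using l p(1) joins_sym[OF e(2)] by (simp add: nth_append)
  qed
  ultimately have "is_cycle T vs (es @ [e])"
    using p ne e unfolding is_cycle_def by auto
  then show False using T unfolding is_tree_def by blast
qed

lemma tree_connected:
  assumes "is_tree T" "i \<in> verts T" "j \<in> verts T"
  shows "(i, j) \<in> connection T (edge_ids T)"
proof -
  let ?R = "connection T (edge_ids T)"
  have "card (verts T // ?R) = 1" using assms(1) by (simp add: is_tree_def num_components_def)
  then obtain X where "verts T // ?R = {X}" by (auto simp: card_1_singleton_iff)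
  moreover have "?R `` {i} \<in> verts T // ?R" "?R `` {j} \<in> verts T // ?R"
    using assms by (auto intro: quotientI)
  ultimately have "?R `` {i} = ?R `` {j}" by auto
  then show ?thesis using connection_refl connection_sym by fastforce
qed

lemma tree_verts: "is_tree T \<Longrightarrow> verts T \<noteq> {}"
  by (auto simp: is_tree_def num_components_def quotient_def)

section \<open>The two sides of a tree edge, and vertices that can be eliminated\<close>

definition branch :: "graph \<Rightarrow> nat \<Rightarrow> nat \<Rightarrow> nat set" where
  "branch T e i = {x. (i, x) \<in> connection T (edge_ids T - {e})}"

lemma branch_subset_verts:
  assumes "wf_graph T" "i \<in> verts T"
  shows "branch T e i \<subseteq> verts T"
proof
  fix x assume "x \<in> branch T e i"
  then have "(i, x) \<in> connection T (edge_ids T - {e})" by (simp add: branch_def)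
  then show "x \<in> verts T"
    by (induction rule: connection_induct) (use assms joins_verts in blast)+
qed

text \<open>A walk from \<open>i'\<close> avoiding \<open>f\<close> that used \<open>e\<close> would
  touch \<open>i\<close>, and then \<open>f\<close> would not be a bridge. The strict decrease is
  what makes a smallest branch useful in \<open>eligible_exists\<close>.\<close>

lemma branch_psubset:
  assumes T: "is_tree T" and f: "f \<in> edge_ids T" "joins T f i i'" "f \<noteq> e"
    and e: "joins T e i j"
  shows "branch T f i' \<subset> branch T e i"
proof -
  have i: "i \<notin> branch T f i'"
    using tree_edge_is_bridge[OF T f(1) joins_sym[OF f(2)]] by (simp add: branch_def)
  have "(i', x) \<in> connection T (edge_ids T - {e})" if "(i', x) \<in> connection T (edge_ids T - {f})" for x
    using that
  proof (induction rule: connection_induct)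
    case refl
    show ?case by (rule connection_refl)
  next
    case (step x y g)
    have "g \<noteq> e"
    proof
      assume "g = e"
      then have "x = i \<or> y = i" using joins_ends[OF e] step.hyps(3) by blast
      moreover have "(i', y) \<in> connection T (edge_ids T - {f})"
        using step.hyps connection_edge connection_trans by metis
      ultimately show False using i step.hyps by (auto simp: branch_def)
    qed
    then show ?case using step connection_edge connection_trans by (metis Diff_iff insert_iff empty_iff)
  qed
  moreover have "(i, i') \<in> connection T (edge_ids T - {e})"
    using f by (intro connection_edge[of f]) auto
  ultimately have "branch T f i' \<subseteq> branch T e i"
    unfolding branch_def using connection_trans by blast
  moreover have "i \<in> branch T e i" by (simp add: branch_def connection_refl)
  ultimately show ?thesis using i by blast
qed

text \<open>The edge to choose is the one by which a walk to \<open>x\<close> last leaves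
  \<open>i\<close>.\<close>

lemma connection_branch:
  assumes "(i, x) \<in> connection T A" "A \<subseteq> edge_ids T" "x \<noteq> i"
  shows "\<exists>f\<in>A. \<exists>i'. joins T f i i' \<and> x \<in> branch T f i'"
proof -
  have "x = i \<or> (\<exists>f\<in>A. \<exists>i'. joins T f i i' \<and> x \<in> branch T f i')"
    using assms(1)
  proof (induction rule: connection_induct)
    case (step x y g)
    show ?case
    proof (cases "x = i")
      case True
      then show ?thesis using step.hyps by (auto simp: branch_def intro: connection_refl)
    next
      case False
      then obtain f i' where f: "f \<in> A" "joins T f i i'" "x \<in> branch T f i'" using step.IH by blast
      show ?thesis
      proof (cases "g = f")
        case True
        then have "y = i \<or> y = i'" using joins_ends[OF f(2)] step.hyps(3) by blast
        then show ?thesis using f by (auto simp: branch_def intro: connection_refl)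
      next
        case False
        then have "(x, y) \<in> connection T (edge_ids T - {f})"
          using step.hyps assms(2) by (intro connection_edge[of g]) auto
        then show ?thesis using f by (auto simp: branch_def intro: connection_trans)
      qed
    qed
  qed simp
  then show ?thesis using assms(3) by blast
qed

text \<open>\<open>R\<close> is the set of vertices not yet eliminated. If every bag is completed to
  a clique, the neighbours of \<open>v\<close> in \<open>R\<close> all lie in bag \<open>i\<close>,
  so \<open>v\<close> is simplicial in the graph induced on \<open>R\<close>.\<close>

definition eligible :: "graph \<Rightarrow> (nat \<Rightarrow> nat set) \<Rightarrow> nat set \<Rightarrow> nat \<Rightarrow> nat \<Rightarrow> bool" where
  "eligible T bag R v i \<longleftrightarrow> v \<in> R \<and> (\<forall>j\<in>verts T. v \<in> bag j \<longrightarrow> bag j \<inter> R \<subseteq> bag i)"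

text \<open>A side of a tree edge is bad if one of its bags has a vertex of \<open>R\<close> missing
  from the bag at the other end. With no bad side, any single bag contains \<open>R\<close>.
  Otherwise a smallest bad side plays the role of a leaf: restricted to \<open>R\<close>, all its
  bags are absorbed by the bag at its end \<open>i\<close>, and a vertex of \<open>R\<close> in that
  bag that is missing across the edge occurs nowhere else.\<close>

lemma eligible_exists:
  assumes td: "tree_decomposition G T bag" and R: "R \<subseteq> verts G" "R \<noteq> {}"
  shows "\<exists>v\<in>verts G. \<exists>i\<in>verts T. eligible T bag R v i"
proof -
  have T: "is_tree T" and cover: "(\<Union>i\<in>verts T. bag i) = verts G"
    using td by (auto simp: tree_decomposition_def)
  have wf: "wf_graph T" using T by (simp add: is_tree_def)
  define bad where "bad = (\<lambda>(e, i, j). e \<in> edge_ids T \<and> joins T e i j \<and>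
    (\<exists>x\<in>branch T e i. \<not> bag x \<inter> R \<subseteq> bag j))"
  show ?thesis
  proof (cases "\<exists>p. bad p")
    case False
    obtain r where r: "r \<in> verts T" using tree_verts[OF T] by blast
    have "bag x \<inter> R \<subseteq> bag r" if "x \<in> verts T" for x
      using tree_connected[OF T r that]
    proof (induction rule: connection_induct)
      case (step x y e)
      have "y \<in> branch T e y" by (simp add: branch_def connection_refl)
      then have "bag y \<inter> R \<subseteq> bag x" using False step.hyps joins_sym[OF step.hyps(3)] by (auto simp: bad_def)
      then show ?case using step.IH by blast
    qed auto
    then show ?thesis using r R unfolding eligible_def by blast
  next
    case True
    then obtain e i j where b: "bad (e, i, j)" and
      min: "\<And>f k l. bad (f, k, l) \<Longrightarrow> card (branch T e i) \<le> card (branch T f k)"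
      using ex_has_least_nat[of bad _ "\<lambda>(e, i, j). card (branch T e i)"] by fastforce
    have e: "e \<in> edge_ids T" "joins T e i j" using b by (auto simp: bad_def)
    have i: "i \<in> verts T" using joins_verts[OF wf e] by simp
    have sub: "bag x \<inter> R \<subseteq> bag i" if x: "x \<in> branch T e i" for x
    proof (cases "x = i")
      case False
      then obtain f i' where f: "f \<in> edge_ids T" "f \<noteq> e" "joins T f i i'" "x \<in> branch T f i'"
        using connection_branch[of i x T "edge_ids T - {e}"] x by (auto simp: branch_def)
      have "card (branch T f i') < card (branch T e i)"
        using finite_subset[OF branch_subset_verts[OF wf i]] branch_psubset[OF T f(1,3,2) e(2)]
        by (intro psubset_card_mono) (auto simp: verts_def)
      then have "\<not> bad (f, i', i)" using min by (meson not_le)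
      then show ?thesis using f joins_sym by (auto simp: bad_def)
    qed auto
    obtain v where v: "v \<in> bag i" "v \<in> R" "v \<notin> bag j" using b sub by (auto simp: bad_def)
    \<comment> \<open>The nodes containing \<open>v\<close> are linked by tree edges with
      \<open>v\<close> at both ends. Since \<open>v\<close> is missing from bag \<open>j\<close>,
      the edge \<open>e\<close> is not among them, so no such node lies beyond
      \<open>e\<close>.\<close>
    have "y \<in> branch T e i" if y: "y \<in> verts T" "v \<in> bag y" for y
    proof -
      have "(i, y) \<in> connection T
          {f \<in> edge_ids T. v \<in> bag (fst (edges T ! f)) \<and> v \<in> bag (snd (edges T ! f))}"
        using td y i v R by (auto simp: tree_decomposition_def)
      moreover have "{f \<in> edge_ids T. v \<in> bag (fst (edges T ! f)) \<and> v \<in> bag (snd (edges T ! f))}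
          \<subseteq> edge_ids T - {e}" using v e by (auto simp: joins_def)
      ultimately show ?thesis unfolding branch_def using connection_mono by blast
    qed
    then have "eligible T bag R v i" using v sub by (auto simp: eligible_def)
    then show ?thesis using i v R by blast
  qed
qed

section \<open>The Potts partition function\<close>

definition component_labelling :: "graph \<Rightarrow> nat set \<Rightarrow> (nat \<Rightarrow> nat) \<Rightarrow> bool" where
  "component_labelling G A L \<longleftrightarrow>
     (\<forall>u\<in>verts G. \<forall>v\<in>verts G. L u = L v \<longleftrightarrow> (u, v) \<in> connection G A)"

text \<open>One round of the quick-find method; \<open>merge_step\<close> carries out this update on
  array \<open>14\<close>.\<close>

definition merge_labels :: "(nat \<Rightarrow> nat) \<Rightarrow> nat \<Rightarrow> nat \<Rightarrow> nat \<Rightarrow> nat" where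
  "merge_labels L u v = (\<lambda>z. if L z = L u then L v else L z)"

lemma finite_verts [simp]: "finite (verts G)"
  by (simp add: verts_def)

lemma finite_edge_ids [simp]: "finite (edge_ids G)"
  by (simp add: edge_ids_def)

lemma card_image_eq_of_same_kernel:
  assumes "\<And>x y. x \<in> A \<Longrightarrow> y \<in> A \<Longrightarrow> f x = f y \<longleftrightarrow> g x = g y"
  shows "card (f ` A) = card (g ` A)"
proof -
  have i: "inv_into A g (g x) \<in> A" "g (inv_into A g (g x)) = g x" if "x \<in> A" for x
    using that by (auto intro: inv_into_into f_inv_into_f)
  have "bij_betw (\<lambda>y. f (inv_into A g y)) (g ` A) (f ` A)"
    unfolding bij_betw_def
  proof
    show "inj_on (\<lambda>y. f (inv_into A g y)) (g ` A)"
      by (rule inj_onI) (metis assms f_inv_into_f inv_into_into)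
    show "(\<lambda>y. f (inv_into A g y)) ` g ` A = f ` A"
    proof -
      have "f (inv_into A g (g x)) = f x" if "x \<in> A" for x using assms i that by blast
      then show ?thesis by (auto simp: image_image)
    qed
  qed
  then show ?thesis by (rule bij_betw_same_card[symmetric])
qed

lemma equiv_connection: "equiv UNIV (connection G A)"
  by (rule equivI) (auto simp: refl_on_def sym_def trans_def connection_refl
      intro: connection_sym connection_trans)

lemma num_components_eq_card_labels:
  assumes "component_labelling G A L"
  shows "num_components G A = card (L ` verts G)"
proof -
  have "verts G // connection G A = (\<lambda>u. connection G A `` {u}) ` verts G"
    by (auto simp: quotient_def)
  moreover have "connection G A `` {u} = connection G A `` {v} \<longleftrightarrow> (u, v) \<in> connection G A" for u v
    using equiv_class_eq_iff[OF equiv_connection] by simp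
  ultimately show ?thesis
    using assms unfolding num_components_def component_labelling_def
    by (simp add: card_image_eq_of_same_kernel)
qed

lemma component_labelling_empty: "component_labelling G {} (\<lambda>v. v)"
  by (simp add: component_labelling_def connection_def)

lemma component_labelling_insert:
  assumes wf: "wf_graph G" and L: "component_labelling G A L" and A: "A \<subseteq> edge_ids G"
    and e: "e \<in> edge_ids G" "joins G e u v"
  shows "component_labelling G (insert e A) (merge_labels L u v)"
  unfolding component_labelling_def
proof (intro ballI iffI)
  let ?M = "merge_labels L u v"
  have uv: "u \<in> verts G" "v \<in> verts G" using joins_verts[OF wf e] by auto
  have ins: "connection G A \<subseteq> connection G (insert e A)" by (rule connection_mono) auto
  fix x y assume xy: "x \<in> verts G" "y \<in> verts G"
  show "?M x = ?M y" if "(x, y) \<in> connection G (insert e A)"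
    using that
  proof (induction rule: connection_induct)
    case (step y z f)
    have f: "f \<in> edge_ids G" using step.hyps A e by blast
    have yz: "y \<in> verts G" "z \<in> verts G" using joins_verts[OF wf f step.hyps(3)] by auto
    show ?case
    proof (cases "f = e")
      case True
      then show ?thesis using step joins_ends[OF e(2)] by (auto simp: merge_labels_def)
    next
      case False
      then have "(y, z) \<in> connection G A" using step.hyps by (intro connection_edge[of f]) auto
      then have "L y = L z" using L yz by (auto simp: component_labelling_def)
      then show ?thesis using step.IH by (simp add: merge_labels_def)
    qed
  qed simp
  have con: "(p, r) \<in> connection G (insert e A)" if "p \<in> verts G" "r \<in> verts G" "L p = L r" for p r
    using that L ins by (auto simp: component_labelling_def)
  have "(u, v) \<in> connection G (insert e A)" using e by (intro connection_edge[of e]) auto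
  \<comment> \<open>Every vertex reaches some \<open>r\<close> whose old label is its own new label.
    Two vertices with equal new labels are then connected through their representatives.\<close>
  then have rep: "\<exists>r\<in>verts G. L r = ?M z \<and> (z, r) \<in> connection G (insert e A)" if "z \<in> verts G" for z
    using that uv con[OF that uv(1)] connection_trans[of z u G "insert e A" v] connection_refl[of z]
    by (cases "L z = L u") (auto simp: merge_labels_def)
  show "(x, y) \<in> connection G (insert e A)" if "?M x = ?M y"
  proof -
    obtain r where r: "r \<in> verts G" "L r = ?M x" "(x, r) \<in> connection G (insert e A)"
      using rep xy by blast
    obtain t where t: "t \<in> verts G" "L t = ?M y" "(y, t) \<in> connection G (insert e A)"
      using rep xy by blast
    have "(r, t) \<in> connection G (insert e A)" using r t that by (intro con) auto
    with r t show ?thesis using connection_sym connection_trans by metis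
  qed
qed

lemma card_merge_labels:
  assumes "u \<in> V" "v \<in> V" "finite V"
  shows "card (L ` V) = card (merge_labels L u v ` V) + (if L u = L v then 0 else 1)"
proof (cases "L u = L v")
  case True
  then have "merge_labels L u v = L" by (auto simp: merge_labels_def)
  then show ?thesis using True by simp
next
  case False
  then have "merge_labels L u v ` V = L ` V - {L u}"
    using assms by (auto simp: merge_labels_def image_iff)
  moreover have "L u \<in> L ` V" using assms by simp
  ultimately show ?thesis using False assms by (simp add: card_Suc_Diff1 del: card_Diff_insert)
qed

text \<open>The inequality keeps the exponent \<open>k(A) + |A| - |V|\<close> from truncating:
  starting from \<open>|V|\<close> labels, every edge removes at most one.\<close>

lemma component_labelling_exists:
  assumes wf: "wf_graph G" and A: "A \<subseteq> edge_ids G"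
  shows "\<exists>L. component_labelling G A L \<and> card (verts G) \<le> card (L ` verts G) + card A"
proof -
  have "finite A" using A finite_edge_ids finite_subset by blast
  then show ?thesis using A
  proof (induction A)
    case empty
    show ?case using component_labelling_empty by fastforce
  next
    case (insert e A)
    then obtain L where L: "component_labelling G A L"
      "card (verts G) \<le> card (L ` verts G) + card A" by blast
    obtain u v where uv: "joins G e u v" by (metis joins_def surj_pair)
    have e: "e \<in> edge_ids G" "A \<subseteq> edge_ids G" using insert.prems by auto
    have "card (L ` verts G) \<le> card (merge_labels L u v ` verts G) + 1"
      using card_merge_labels[OF joins_verts[OF wf e(1) uv] finite_verts, of L] by (auto split: if_splits)
    then show ?case
      using component_labelling_insert[OF wf L(1) e(2,1) uv] L(2) insert.hyps
      by (intro exI[of _ "merge_labels L u v"]) simp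
  qed
qed

text \<open>Closing under the connection of \<open>B\<close> maps the classes for \<open>A\<close>
  onto the classes for \<open>B\<close>.\<close>

lemma num_components_antimono:
  assumes "A \<subseteq> B"
  shows "num_components G B \<le> num_components G A"
proof -
  let ?c = "\<lambda>A u. connection G A `` {u}"
  have q: "verts G // connection G A = ?c A ` verts G" for A by (auto simp: quotient_def)
  have *: "connection G B `` (?c A u) = ?c B u" for u
  proof
    show "connection G B `` (?c A u) \<subseteq> ?c B u"
      using connection_mono[OF assms, of G] by (auto intro: connection_trans)
    show "?c B u \<subseteq> connection G B `` (?c A u)" using connection_refl by blast
  qed
  have "?c B ` verts G = Image (connection G B) ` (?c A ` verts G)"
    unfolding image_image * ..
  then show ?thesis
    unfolding num_components_def q by (metis card_image_le finite_imageI finite_verts)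
qed

section \<open>The Fortuin-Kasteleyn expansion of the Potts model\<close>

definition edge_mono :: "graph \<Rightarrow> (nat \<Rightarrow> nat) \<Rightarrow> nat \<Rightarrow> bool" where
  "edge_mono G \<sigma> e \<longleftrightarrow> \<sigma> (fst (edges G ! e)) = \<sigma> (snd (edges G ! e))"

definition potts :: "graph \<Rightarrow> nat \<Rightarrow> 'a::comm_ring_1 \<Rightarrow> 'a" where
  "potts G q b = (\<Sum>\<sigma>\<in>verts G \<rightarrow>\<^sub>E {..<q}. \<Prod>e\<in>edge_ids G. if edge_mono G \<sigma> e then b else 1)"

lemma edge_mono_joins: "joins G e u v \<Longrightarrow> edge_mono G \<sigma> e \<longleftrightarrow> \<sigma> u = \<sigma> v"
  by (auto simp: joins_def edge_mono_def)

lemma joins_fst_snd: "joins G e (fst (edges G ! e)) (snd (edges G ! e))"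
  by (simp add: joins_def)

text \<open>Colourings monochromatic on \<open>A\<close> are constant on components, hence factor
  uniquely through a component labelling; \<open>F\<close> is the resulting bijection from
  colourings of the labels.\<close>

lemma card_mono_colourings:
  assumes wf: "wf_graph G" and A: "A \<subseteq> edge_ids G"
  shows "card {\<sigma> \<in> verts G \<rightarrow>\<^sub>E {..<q}. \<forall>e\<in>A. edge_mono G \<sigma> e} = q ^ num_components G A"
proof -
  obtain L where L: "component_labelling G A L" using component_labelling_exists[OF assms] by blast
  let ?V = "verts G" and ?S = "{\<sigma> \<in> verts G \<rightarrow>\<^sub>E {..<q}. \<forall>e\<in>A. edge_mono G \<sigma> e}"
  define F where "F = (\<lambda>\<tau>::nat \<Rightarrow> nat. restrict (\<tau> \<circ> L) ?V)"
  have const: "\<sigma> u = \<sigma> v" if "\<sigma> \<in> ?S" "u \<in> ?V" "v \<in> ?V" "L u = L v" for \<sigma> u v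
  proof -
    have "(u, v) \<in> connection G A" using that L by (auto simp: component_labelling_def)
    then show ?thesis
      by (induction rule: connection_induct) (use that(1) in \<open>auto simp: edge_mono_joins\<close>)
  qed
  have "bij_betw F (L ` ?V \<rightarrow>\<^sub>E {..<q}) ?S"
    unfolding bij_betw_def
  proof
    show "inj_on F (L ` ?V \<rightarrow>\<^sub>E {..<q})"
    proof (rule inj_onI)
      fix \<tau> \<tau>' assume t: "\<tau> \<in> L ` ?V \<rightarrow>\<^sub>E {..<q}" "\<tau>' \<in> L ` ?V \<rightarrow>\<^sub>E {..<q}" "F \<tau> = F \<tau>'"
      have "\<tau> (L v) = \<tau>' (L v)" if "v \<in> ?V" for v
        using fun_cong[OF t(3), of v] that by (simp add: F_def)
      then show "\<tau> = \<tau>'" using t(1,2) by (intro PiE_ext) auto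
    qed
    show "F ` (L ` ?V \<rightarrow>\<^sub>E {..<q}) = ?S"
    proof
      have "edge_mono G (F \<tau>) e" if "e \<in> A" for \<tau> e
      proof -
        let ?u = "fst (edges G ! e)" and ?v = "snd (edges G ! e)"
        have "?u \<in> ?V" "?v \<in> ?V" using joins_verts[OF wf _ joins_fst_snd] A that by blast+
        moreover have "(?u, ?v) \<in> connection G A" using that joins_fst_snd by (rule connection_edge)
        ultimately have "L ?u = L ?v" using L by (metis component_labelling_def)
        then show ?thesis using \<open>?u \<in> ?V\<close> \<open>?v \<in> ?V\<close> by (simp add: edge_mono_def F_def)
      qed
      then show "F ` (L ` ?V \<rightarrow>\<^sub>E {..<q}) \<subseteq> ?S" by (auto simp: F_def PiE_iff)
      show "?S \<subseteq> F ` (L ` ?V \<rightarrow>\<^sub>E {..<q})"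
      proof
        fix \<sigma> assume s: "\<sigma> \<in> ?S"
        let ?t = "restrict (\<lambda>l. \<sigma> (inv_into ?V L l)) (L ` ?V)"
        have i: "inv_into ?V L (L v) \<in> ?V" "L (inv_into ?V L (L v)) = L v" if "v \<in> ?V" for v
          using that by (auto intro: inv_into_into f_inv_into_f)
        have "?t \<in> L ` ?V \<rightarrow>\<^sub>E {..<q}" using s i by (auto simp: PiE_iff)
        moreover have "\<sigma> = F ?t"
        proof
          fix v show "\<sigma> v = F ?t v"
          proof (cases "v \<in> ?V")
            case True
            then show ?thesis using const[OF s i(1)[OF True] True i(2)[OF True]] by (simp add: F_def)
          next
            case False
            then show ?thesis using s PiE_arb[of \<sigma> ?V "\<lambda>_. {..<q}" v] by (simp add: F_def)
          qed
        qed
        ultimately show "\<sigma> \<in> F ` (L ` ?V \<rightarrow>\<^sub>E {..<q})" by blast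
      qed
    qed
  qed
  then have "card ?S = card (L ` ?V \<rightarrow>\<^sub>E {..<q})" by (rule bij_betw_same_card[symmetric])
  then show ?thesis by (simp add: card_funcsetE num_components_eq_card_labels[OF L])
qed

text \<open>The factor of a monochromatic edge is written as \<open>(b - 1) + 1\<close> and the
  product multiplied out; after exchanging the sums, each \<open>A\<close> collects the colourings
  monochromatic on it.\<close>

lemma potts_eq_subset_sum:
  assumes wf: "wf_graph G"
  shows "potts G q b = (\<Sum>A\<in>Pow (edge_ids G). of_nat q ^ num_components G A * (b - 1) ^ card A)"
proof -
  let ?E = "edge_ids G" and ?C = "verts G \<rightarrow>\<^sub>E {..<q}"
  have fin: "finite ?C" by (simp add: finite_PiE)
  have "(\<Prod>e\<in>?E. if edge_mono G \<sigma> e then b else 1) =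
      (\<Sum>A\<in>Pow ?E. if \<forall>e\<in>A. edge_mono G \<sigma> e then (b - 1) ^ card A else 0)" for \<sigma>
  proof -
    have "(\<Prod>e\<in>?E. if edge_mono G \<sigma> e then b else 1) =
        (\<Prod>e\<in>?E. (if edge_mono G \<sigma> e then b - 1 else 0) + 1)" by (rule prod.cong) auto
    also have "\<dots> = (\<Sum>A\<in>Pow ?E. \<Prod>e\<in>A. if edge_mono G \<sigma> e then b - 1 else 0)"
      by (subst prod_add) auto
    also have "\<dots> = (\<Sum>A\<in>Pow ?E. if \<forall>e\<in>A. edge_mono G \<sigma> e then (b - 1) ^ card A else 0)"
    proof (rule sum.cong[OF refl])
      fix A assume "A \<in> Pow ?E"
      then have "finite A" using finite_subset[OF _ finite_edge_ids] by blast
      then show "(\<Prod>e\<in>A. if edge_mono G \<sigma> e then b - 1 else 0) =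
          (if \<forall>e\<in>A. edge_mono G \<sigma> e then (b - 1) ^ card A else 0)"
        by (induction A) auto
    qed
    finally show ?thesis .
  qed
  then have "potts G q b =
      (\<Sum>\<sigma>\<in>?C. \<Sum>A\<in>Pow ?E. if \<forall>e\<in>A. edge_mono G \<sigma> e then (b - 1) ^ card A else 0)"
    by (simp add: potts_def)
  also have "\<dots> = (\<Sum>A\<in>Pow ?E. \<Sum>\<sigma>\<in>?C. if \<forall>e\<in>A. edge_mono G \<sigma> e then (b - 1) ^ card A else 0)"
    by (rule sum.swap)
  also have "\<dots> = (\<Sum>A\<in>Pow ?E. of_nat q ^ num_components G A * (b - 1) ^ card A)"
  proof (rule sum.cong[OF refl])
    fix A assume "A \<in> Pow ?E"
    then have A: "A \<subseteq> ?E" by simp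
    have "(\<Sum>\<sigma>\<in>?C. if \<forall>e\<in>A. edge_mono G \<sigma> e then (b - 1) ^ card A else 0) =
        of_nat (card {\<sigma> \<in> ?C. \<forall>e\<in>A. edge_mono G \<sigma> e}) * (b - 1) ^ card A"
      using fin by (simp add: sum.If_cases Int_def)
    then show "(\<Sum>\<sigma>\<in>?C. if \<forall>e\<in>A. edge_mono G \<sigma> e then (b - 1) ^ card A else 0) =
        of_nat q ^ num_components G A * (b - 1) ^ card A"
      by (simp add: card_mono_colourings[OF wf A])
  qed
  finally show ?thesis .
qed

lemma tutte_eq_potts:
  fixes a b :: "'a::field_char_0"
  assumes wf: "wf_graph G" and q: "(a - 1) * (b - 1) = of_nat q" "q > 0"
  shows "tutte G a b =
    (a - 1) ^ (card (verts G) - num_components G (edge_ids G)) / of_nat q ^ card (verts G) * potts G q b"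
proof -
  let ?n = "card (verts G)" and ?k = "num_components G" and ?E = "edge_ids G"
  have nz: "a - 1 \<noteq> 0" "b - 1 \<noteq> 0" using q by auto
  have kn: "?k A \<le> ?n" if "A \<subseteq> ?E" for A
    using component_labelling_exists[OF wf that] num_components_eq_card_labels
    by (metis card_image_le finite_verts)
  have "(a - 1) ^ (?k A - ?k ?E) * (b - 1) ^ (?k A + card A - ?n) =
      (a - 1) ^ (?n - ?k ?E) / of_nat q ^ ?n * (of_nat q ^ ?k A * (b - 1) ^ card A)" if A: "A \<subseteq> ?E" for A
  proof -
    have "?n \<le> ?k A + card A"
      using component_labelling_exists[OF wf A] num_components_eq_card_labels by metis
    then have le: "?k ?E \<le> ?k A" "?n \<le> ?k A + card A" "?k ?E \<le> ?n"
      using num_components_antimono[OF A] kn[OF subset_refl] by auto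
    \<comment> \<open>Multiplying by \<open>q ^ n = (a - 1) ^ n * (b - 1) ^ n\<close> raises both
      exponents by \<open>n\<close>, after which the natural-number differences can be rearranged
      without truncation.\<close>
    have "(a - 1) ^ (?k A - ?k ?E) * (b - 1) ^ (?k A + card A - ?n) * of_nat q ^ ?n =
        (a - 1) ^ (?k A - ?k ?E + ?n) * (b - 1) ^ (?k A + card A - ?n + ?n)"
      by (simp add: q(1)[symmetric] power_mult_distrib power_add mult_ac)
    also have "\<dots> = (a - 1) ^ (?n - ?k ?E + ?k A) * (b - 1) ^ (?k A + card A)"
      using le by (intro arg_cong2[where f = "(*)"] arg_cong[where f = "power _"]) auto
    also have "\<dots> = (a - 1) ^ (?n - ?k ?E) * (of_nat q ^ ?k A * (b - 1) ^ card A)"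
      by (simp add: q(1)[symmetric] power_mult_distrib power_add mult_ac)
    finally have *: "(a - 1) ^ (?k A - ?k ?E) * (b - 1) ^ (?k A + card A - ?n) * of_nat q ^ ?n =
      (a - 1) ^ (?n - ?k ?E) * (of_nat q ^ ?k A * (b - 1) ^ card A)" .
    have "(of_nat q :: 'a) ^ ?n \<noteq> 0" using q(2) by simp
    from nonzero_eq_divide_eq[OF this] * show ?thesis by simp
  qed
  then show ?thesis
    unfolding tutte_def potts_eq_subset_sum[OF wf] sum_distrib_left
    by (intro sum.cong) auto
qed

section \<open>Variable elimination\<close>

text \<open>The parent in the elimination forest; the value \<open>n\<close> marks a root.\<close>

definition next_nbr :: "nat \<Rightarrow> (nat \<Rightarrow> nat set) \<Rightarrow> nat \<Rightarrow> nat" where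
  "next_nbr n S i = Min (insert n (S i))"

text \<open>Each pair of positions is charged to its earlier member. The term \<open>j = i\<close>
  is always active; it is where loops are counted.\<close>

definition local_weight :: "(nat \<Rightarrow> nat set) \<Rightarrow> (nat \<Rightarrow> nat \<Rightarrow> 'a::comm_ring_1) \<Rightarrow> nat \<Rightarrow> (nat \<Rightarrow> nat) \<Rightarrow> 'a" where
  "local_weight S W i \<sigma> = (\<Prod>j\<in>insert i (S i). if \<sigma> i = \<sigma> j then W i j else 1)"

text \<open>The partition function of the subtree of the elimination forest rooted at
  \<open>i\<close>, as a function of the colours outside it; \<open>j < i\<close> makes the
  recursion terminate for arbitrary \<open>S\<close>.\<close>

fun message :: "nat \<Rightarrow> nat \<Rightarrow> (nat \<Rightarrow> nat set) \<Rightarrow> (nat \<Rightarrow> nat \<Rightarrow> 'a::comm_ring_1) \<Rightarrow>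
    nat \<Rightarrow> (nat \<Rightarrow> nat) \<Rightarrow> 'a" where
  "message n q S W i \<sigma> = (\<Sum>c<q. local_weight S W i (\<sigma>(i := c)) *
     (\<Prod>j\<in>{j. j < i \<and> next_nbr n S j = i}. message n q S W j (\<sigma>(i := c))))"

declare message.simps [simp del]

lemma sum_PiE_insert:
  assumes "x \<notin> A"
  shows "(\<Sum>f\<in>Pi\<^sub>E (insert x A) T. h f) = (\<Sum>f\<in>Pi\<^sub>E A T. \<Sum>y\<in>T x. h (f(x := y)))"
proof -
  have "(\<Sum>f\<in>Pi\<^sub>E (insert x A) T. h f) = (\<Sum>p\<in>T x \<times> Pi\<^sub>E A T. h (case p of (y, g) \<Rightarrow> g(x := y)))"
    unfolding PiE_insert_eq using inj_combinator[OF assms, of T] by (subst sum.reindex) auto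
  also have "\<dots> = (\<Sum>y\<in>T x. \<Sum>f\<in>Pi\<^sub>E A T. h (f(x := y)))"
    by (subst sum.cartesian_product) (auto intro!: sum.cong)
  finally show ?thesis by (simp only: sum.swap[of _ "T x"])
qed

text \<open>\<open>fill_in\<close> is the perfect elimination property, demanded at the least later
  neighbour: it confines the messages arriving at \<open>i\<close> to the positions \<open>i\<close>
  and \<open>S i\<close>.\<close>

locale elimination =
  fixes n q :: nat and S :: "nat \<Rightarrow> nat set" and W :: "nat \<Rightarrow> nat \<Rightarrow> 'a::comm_ring_1"
  assumes later: "i < n \<Longrightarrow> S i \<subseteq> {i<..<n}"
    and fill_in: "i < n \<Longrightarrow> p \<in> S i \<Longrightarrow> \<forall>l\<in>S i. p \<le> l \<Longrightarrow> S i \<subseteq> insert p (S p)"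
begin

abbreviation "par \<equiv> next_nbr n S"
abbreviation "lw \<equiv> local_weight S W"
abbreviation "msg \<equiv> message n q S W"

lemma finite_S: "i < n \<Longrightarrow> finite (S i)"
  by (rule finite_subset[OF later]) auto

lemma par_gt: "i < n \<Longrightarrow> i < par i"
  using later[of i] finite_S[of i] by (simp add: next_nbr_def subset_iff)

lemma par_le: "i < n \<Longrightarrow> l \<in> S i \<Longrightarrow> par i \<le> l"
  using finite_S[of i] by (simp add: next_nbr_def)

lemma par_mem: "i < n \<Longrightarrow> par i \<noteq> n \<Longrightarrow> par i \<in> S i"
  using finite_S[of i] Min_in[of "insert n (S i)"] unfolding next_nbr_def by simp

lemma child_S:
  assumes "j < n" "par j = i" "i < n"
  shows "S j \<subseteq> insert i (S i)"
proof -
  have "i \<in> S j" using par_mem[OF assms(1)] assms(2,3) by simp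
  moreover have "\<forall>l\<in>S j. i \<le> l" using par_le[OF assms(1)] assms(2) by blast
  ultimately show ?thesis by (rule fill_in[OF assms(1)])
qed

lemma local_weight_cong: "\<forall>l\<in>insert i (S i). \<sigma> l = \<tau> l \<Longrightarrow> lw i \<sigma> = lw i \<tau>"
  unfolding local_weight_def by (intro prod.cong) auto

lemma message_cong:
  "i < n \<Longrightarrow> \<forall>l\<in>S i. \<sigma> l = \<tau> l \<Longrightarrow> msg i \<sigma> = msg i \<tau>"
proof (induction i arbitrary: \<sigma> \<tau> rule: less_induct)
  case (less i)
  have "lw i (\<sigma>(i := c)) = lw i (\<tau>(i := c))" for c
    using less.prems by (intro local_weight_cong) auto
  moreover have "msg j (\<sigma>(i := c)) = msg j (\<tau>(i := c))" if "j < i" "par j = i" for j c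
    using less.prems child_S[of j i] that by (intro less.IH) auto
  ultimately show ?case
    by (subst (1 2) message.simps) (intro sum.cong arg_cong2[where f = "(*)"] prod.cong; simp)
qed

text \<open>The form of the recursion that the program realises: overwriting a digit yields a
  colouring \<open>\<tau> c\<close> that may differ from \<open>\<sigma>(i := c)\<close> at
  positions sharing the slot of \<open>i\<close>, but agrees with it wherever the summand
  looks.\<close>

lemma message_rec:
  assumes i: "i < n"
    and agree: "\<And>c l. c < q \<Longrightarrow> l \<in> insert i (S i) \<Longrightarrow> \<tau> c l = (\<sigma>(i := c)) l"
  shows "msg i \<sigma> = (\<Sum>c<q. lw i (\<tau> c) * (\<Prod>j\<in>{j. j < i \<and> par j = i}. msg j (\<tau> c)))"
proof -
  have "lw i (\<sigma>(i := c)) = lw i (\<tau> c)" if "c < q" for c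
    using agree[OF that] by (intro local_weight_cong) auto
  moreover have "msg j (\<sigma>(i := c)) = msg j (\<tau> c)" if "c < q" "j < i" "par j = i" for j c
    using agree[OF that(1)] i that child_S[of j i] by (intro message_cong) (auto simp del: fun_upd_apply)
  ultimately show ?thesis
    by (subst message.simps) (intro sum.cong arg_cong2[where f = "(*)"] prod.cong; simp)
qed

text \<open>After \<open>i\<close> eliminations the positions from \<open>i\<close> on are still
  summed over, and a message survives as long as its parent is not eliminated. Only
  \<open>lw i\<close> and the messages of the children of \<open>i\<close> depend on the colour of
  \<open>i\<close>; summing over it turns them into \<open>msg i\<close>.\<close>

lemma elimination_step:
  assumes i: "i < n"
  shows "(\<Sum>\<sigma>\<in>{i..<n} \<rightarrow>\<^sub>E {..<q}. (\<Prod>l\<in>{i..<n}. lw l \<sigma>) * (\<Prod>j\<in>{j. j < i \<and> i \<le> par j}. msg j \<sigma>)) =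
    (\<Sum>\<sigma>\<in>{Suc i..<n} \<rightarrow>\<^sub>E {..<q}.
       (\<Prod>l\<in>{Suc i..<n}. lw l \<sigma>) * (\<Prod>j\<in>{j. j < Suc i \<and> Suc i \<le> par j}. msg j \<sigma>))"
    (is "(\<Sum>\<sigma>\<in>_. ?f \<sigma>) = (\<Sum>\<sigma>\<in>_. ?g \<sigma>)")
proof -
  have ins: "{i..<n} = insert i {Suc i..<n}" using i by auto
  have "(\<Sum>\<sigma>\<in>{i..<n} \<rightarrow>\<^sub>E {..<q}. ?f \<sigma>) =
      (\<Sum>\<sigma>\<in>{Suc i..<n} \<rightarrow>\<^sub>E {..<q}. \<Sum>c<q. ?f (\<sigma>(i := c)))"
    using sum_PiE_insert[of i "{Suc i..<n}" ?f "\<lambda>_. {..<q}"] by (simp only: ins[symmetric]) simp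
  also have "\<dots> = (\<Sum>\<sigma>\<in>{Suc i..<n} \<rightarrow>\<^sub>E {..<q}. ?g \<sigma>)"
  proof (rule sum.cong[OF refl])
    fix \<sigma> :: "nat \<Rightarrow> nat"
    let ?A = "{j. j < i \<and> Suc i \<le> par j}" and ?B = "{j. j < i \<and> par j = i}"
    have lw: "(\<Prod>l\<in>{i..<n}. lw l (\<sigma>(i := c))) = lw i (\<sigma>(i := c)) * (\<Prod>l\<in>{Suc i..<n}. lw l \<sigma>)" for c
    proof -
      have "lw l (\<sigma>(i := c)) = lw l \<sigma>" if "l \<in> {Suc i..<n}" for l
        using later[of l] that by (intro local_weight_cong) auto
      then show ?thesis unfolding ins by simp
    qed
    have un: "{j. j < i \<and> i \<le> par j} = ?B \<union> ?A" "?B \<inter> ?A = {}" by auto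
    have A: "msg j (\<sigma>(i := c)) = msg j \<sigma>" if "j \<in> ?A" for j c
      using par_le[of j i] that i by (intro message_cong) auto
    have "(\<Prod>j\<in>{j. j < i \<and> i \<le> par j}. msg j (\<sigma>(i := c))) =
        (\<Prod>j\<in>?B. msg j (\<sigma>(i := c))) * (\<Prod>j\<in>?A. msg j (\<sigma>(i := c)))" for c
      unfolding un(1) by (rule prod.union_disjoint) (use un(2) in auto)
    also have "\<dots> c = (\<Prod>j\<in>?B. msg j (\<sigma>(i := c))) * (\<Prod>j\<in>?A. msg j \<sigma>)" for c
      by (intro arg_cong2[where f = "(*)"] refl prod.cong A)
    finally have f: "?f (\<sigma>(i := c)) = (\<Prod>l\<in>{Suc i..<n}. lw l \<sigma>) * (\<Prod>j\<in>?A. msg j \<sigma>) *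
        (lw i (\<sigma>(i := c)) * (\<Prod>j\<in>?B. msg j (\<sigma>(i := c))))" for c
      unfolding lw by (simp add: mult_ac)
    have "{j. j < Suc i \<and> Suc i \<le> par j} = insert i ?A" using par_gt[OF i] by (auto simp: less_Suc_eq)
    then have g: "?g \<sigma> = (\<Prod>l\<in>{Suc i..<n}. lw l \<sigma>) * (\<Prod>j\<in>?A. msg j \<sigma>) * msg i \<sigma>"
      by (simp add: mult_ac)
    show "(\<Sum>c<q. ?f (\<sigma>(i := c))) = ?g \<sigma>"
      unfolding f g by (subst message.simps) (simp add: sum_distrib_left)
  qed
  finally show ?thesis .
qed

text \<open>Before the first step there are no messages. After the last one only those of the roots
  remain; roots have no later neighbours, so their messages ignore the arbitrary
  \<open>\<sigma>0\<close>.\<close>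

lemma elimination_total:
  "(\<Sum>\<sigma>\<in>{..<n} \<rightarrow>\<^sub>E {..<q}. \<Prod>i<n. lw i \<sigma>) = (\<Prod>j\<in>{j. j < n \<and> par j = n}. msg j \<sigma>0)"
proof -
  let ?X = "\<lambda>i. \<Sum>\<sigma>\<in>{i..<n} \<rightarrow>\<^sub>E {..<q}.
    (\<Prod>l\<in>{i..<n}. lw l \<sigma>) * (\<Prod>j\<in>{j. j < i \<and> i \<le> par j}. msg j \<sigma>)"
  have "?X 0 = ?X i" if "i \<le> n" for i
    using that by (induction i) (use elimination_step in \<open>auto simp: Suc_le_eq\<close>)
  from this[OF order_refl] have "?X 0 = ?X n" .
  also have "\<dots> = (\<Prod>j\<in>{j. j < n \<and> par j = n}. msg j \<sigma>0)"
  proof -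
    have "par j \<le> n" if "j < n" for j using finite_S[OF that] by (simp add: next_nbr_def)
    then have set: "{j. j < n \<and> n \<le> par j} = {j. j < n \<and> par j = n}" by (auto intro: antisym)
    have const: "msg j \<sigma> = msg j \<sigma>0" if "j < n" "par j = n" for j \<sigma>
    proof -
      have "l \<notin> S j" for l
      proof
        assume "l \<in> S j"
        then have "n \<le> l" "l < n" using par_le[OF that(1)] later[OF that(1)] that(2) by auto
        then show False by simp
      qed
      then show ?thesis using that(1) by (intro message_cong) auto
    qed
    \<comment> \<open>The sum has a single summand, for the extensional function on the empty
      domain.\<close>
    have "?X n = (\<Prod>j\<in>{j. j < n \<and> par j = n}. msg j (\<lambda>_. undefined))"
      unfolding set by simp
    then show ?thesis using const[of _ "\<lambda>_. undefined"] by (simp cong: prod.cong_simp)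
  qed
  finally show ?thesis by (simp add: atLeast0LessThan)
qed

end

section \<open>Elimination orders of a graph\<close>

text \<open>\<open>ord i\<close> is the vertex eliminated in step \<open>i\<close>, and \<open>node i\<close> is a node of \<open>T\<close> whose bag contains
  everything that \<open>ord i\<close> shares a bag with at that time.\<close>

locale elimination_order =
  fixes G T :: graph and bag :: "nat \<Rightarrow> nat set" and ord node :: "nat \<Rightarrow> nat"
  assumes wf: "wf_graph G"
    and td: "tree_decomposition G T bag"
    and ord: "bij_betw ord {..<nverts G} (verts G)"
    and node: "i < nverts G \<Longrightarrow> node i \<in> verts T"
    and elig: "i < nverts G \<Longrightarrow> eligible T bag (verts G - ord ` {..<i}) (ord i) (node i)"
begin

abbreviation "n \<equiv> nverts G"

definition later_nbrs :: "nat \<Rightarrow> nat set" where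
  "later_nbrs i = {j. i < j \<and> j < n \<and> ord j \<in> bag (node i)}"

lemma finite_later_nbrs [simp]: "finite (later_nbrs i)"
  by (simp add: later_nbrs_def)

text \<open>Parallel edges are folded into one power, so the exponential part of the computation
  loops over positions and never over edges.\<close>

definition pair_weight :: "'a::comm_ring_1 \<Rightarrow> nat \<Rightarrow> nat \<Rightarrow> 'a" where
  "pair_weight b i j = b ^ card {e \<in> edge_ids G. joins G e (ord i) (ord j)}"

lemma ord_verts: "i < n \<Longrightarrow> ord i \<in> verts G"
  using ord by (auto simp: bij_betw_def)

lemma ord_eq_iff: "i < n \<Longrightarrow> j < n \<Longrightarrow> ord i = ord j \<longleftrightarrow> i = j"
  using ord by (auto simp: bij_betw_def inj_on_def)

lemma ord_remaining:
  assumes "i \<le> j" "j < n"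
  shows "ord j \<in> verts G - ord ` {..<i}"
proof -
  have "ord j \<noteq> ord k" if "k < i" for k using that assms ord_eq_iff[of j k] by simp
  then show ?thesis using ord_verts[OF assms(2)] by blast
qed

lemma bag_remaining:
  assumes "i < n" "i \<le> j" "j < n" "t \<in> verts T" "ord i \<in> bag t" "ord j \<in> bag t"
  shows "ord j \<in> bag (node i)"
  using elig[OF assms(1)] ord_remaining[OF assms(2,3)] assms unfolding eligible_def by blast

lemma ord_in_bag: "i < n \<Longrightarrow> ord i \<in> bag (node i)"
proof -
  assume i: "i < n"
  obtain t where "t \<in> verts T" "ord i \<in> bag t"
    using td ord_verts[OF i] unfolding tree_decomposition_def by blast
  then show ?thesis using bag_remaining[OF i order_refl i] by blast
qed

sublocale elimination n q later_nbrs "pair_weight b" for q b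
proof
  show "later_nbrs i \<subseteq> {i<..<n}" for i by (auto simp: later_nbrs_def)
  fix i p assume i: "i < n" "p \<in> later_nbrs i" "\<forall>l\<in>later_nbrs i. p \<le> l"
  show "later_nbrs i \<subseteq> insert p (later_nbrs p)"
  proof
    fix l assume l: "l \<in> later_nbrs i"
    show "l \<in> insert p (later_nbrs p)"
    proof (cases "l = p")
      case False
      then have "p < l" using i(3) l by fastforce
      \<comment> \<open>Both \<open>ord p\<close> and \<open>ord l\<close> lie in the bag of
        \<open>node i\<close>, and eligibility of \<open>ord p\<close> at its own turn carries
        \<open>ord l\<close> over to the bag of \<open>node p\<close>.\<close>
      moreover have "ord l \<in> bag (node p)"
        using i(2) l \<open>p < l\<close>
        by (intro bag_remaining[of p l "node i"] node[OF i(1)]) (simp_all add: later_nbrs_def)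
      ultimately show ?thesis using l by (simp add: later_nbrs_def)
    qed simp
  qed
qed

lemma finite_bag: "t \<in> verts T \<Longrightarrow> finite (bag t)"
proof -
  assume "t \<in> verts T"
  then have "bag t \<subseteq> verts G" using td unfolding tree_decomposition_def by blast
  then show ?thesis by (rule finite_subset) simp
qed

text \<open>The bag of \<open>node i\<close> contains \<open>ord i\<close> besides the later
  neighbours, which pays for the \<open>- 1\<close> in \<open>width\<close>.\<close>

lemma card_later_nbrs: "i < n \<Longrightarrow> card (later_nbrs i) \<le> width T bag"
proof -
  assume i: "i < n"
  have inj: "inj_on ord (insert i (later_nbrs i))"
    using i by (intro inj_onI) (auto simp: ord_eq_iff later_nbrs_def)
  have "ord ` insert i (later_nbrs i) \<subseteq> bag (node i)"
    using ord_in_bag[OF i] by (auto simp: later_nbrs_def)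
  then have "card (insert i (later_nbrs i)) \<le> card (bag (node i))"
    using card_mono[OF finite_bag[OF node[OF i]]] card_image[OF inj] by metis
  also have "\<dots> \<le> Max ((\<lambda>i. card (bag i)) ` verts T)"
    using node[OF i] by (intro Max_ge) auto
  finally have "card (insert i (later_nbrs i)) \<le> width T bag + 1"
    by (simp add: width_def)
  moreover have "i \<notin> later_nbrs i" by (simp add: later_nbrs_def)
  ultimately show ?thesis by simp
qed

text \<open>Edges are grouped by the positions of their ends, the earlier one first. Every edge lies
  in some bag, so its later end is a later neighbour of the earlier one, or equals it for a loop;
  the fibres of \<open>g\<close> are the edge sets counted by \<open>pair_weight\<close>.\<close>

lemma edge_product:
  assumes \<sigma>: "\<And>i. i < n \<Longrightarrow> \<sigma> i = \<tau> (ord i)"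
  shows "(\<Prod>e\<in>edge_ids G. if edge_mono G \<tau> e then b else 1) =
    (\<Prod>i<n. local_weight later_nbrs (pair_weight b) i \<sigma>)"
proof -
  let ?E = "edge_ids G" and ?P = "Sigma {..<n} (\<lambda>i. insert i (later_nbrs i))"
  define pos where "pos = inv_into {..<n} ord"
  have pos: "pos v < n" "ord (pos v) = v" if "v \<in> verts G" for v
    using that ord inv_into_into[of v ord "{..<n}"] f_inv_into_f[of v ord "{..<n}"]
    by (auto simp: bij_betw_def pos_def)
  have pos_ord: "pos (ord i) = i" if "i < n" for i
    using pos[OF ord_verts[OF that]] ord_eq_iff[OF _ that] by blast
  define g where "g = (\<lambda>e. let i = pos (fst (edges G ! e)); j = pos (snd (edges G ! e)) in (min i j, max i j))"
  have ends: "fst (edges G ! e) \<in> verts G" "snd (edges G ! e) \<in> verts G" if "e \<in> ?E" for e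
    using joins_verts[OF wf that joins_fst_snd] by auto
  have g: "g e \<in> ?P" if e: "e \<in> ?E" for e
  proof -
    let ?i = "fst (g e)" and ?j = "snd (g e)"
    have "edges G ! e \<in> set (edges G)" using e by (simp add: edge_ids_def)
    moreover have "\<forall>p\<in>set (edges G). \<exists>i\<in>verts T. fst p \<in> bag i \<and> snd p \<in> bag i"
      using td unfolding tree_decomposition_def case_prod_beta' by blast
    ultimately obtain t where t: "t \<in> verts T" "fst (edges G ! e) \<in> bag t" "snd (edges G ! e) \<in> bag t"
      by blast
    have ij: "?i < n" "?j < n" "?i \<le> ?j" using pos[OF ends(1)[OF e]] pos[OF ends(2)[OF e]]
      by (auto simp: g_def Let_def)
    have "ord ?i \<in> bag t" "ord ?j \<in> bag t"
      using t pos(2)[OF ends(1)[OF e]] pos(2)[OF ends(2)[OF e]] by (auto simp: g_def Let_def min_def max_def)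
    then have "ord ?j \<in> bag (node ?i)" by (intro bag_remaining[OF ij(1,3,2) t(1)])
    then have "?j \<in> insert ?i (later_nbrs ?i)" using ij by (auto simp: later_nbrs_def)
    then show ?thesis using ij(1) by (metis SigmaI lessThan_iff prod.collapse)
  qed
  have fibre: "{e \<in> ?E. g e = (i, j)} = {e \<in> ?E. joins G e (ord i) (ord j)}" if "(i, j) \<in> ?P" for i j
  proof -
    have ij: "i < n" "j < n" "i \<le> j" using that by (auto simp: later_nbrs_def)
    have "g e = (i, j) \<longleftrightarrow> joins G e (ord i) (ord j)" if e: "e \<in> ?E" for e
    proof
      assume "g e = (i, j)"
      then show "joins G e (ord i) (ord j)"
        using pos(2)[OF ends(1)[OF e]] pos(2)[OF ends(2)[OF e]] joins_fst_snd[of G e] joins_sym[of G e]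
        by (auto simp: g_def Let_def min_def max_def split: if_splits)
    next
      assume "joins G e (ord i) (ord j)"
      then show "g e = (i, j)"
        using ij pos_ord by (auto simp: joins_def g_def Let_def)
    qed
    then show ?thesis by blast
  qed
  have "(\<Prod>e\<in>?E. if edge_mono G \<tau> e then b else 1) =
      (\<Prod>p\<in>?P. \<Prod>e\<in>{e \<in> ?E. g e = p}. if edge_mono G \<tau> e then b else 1)"
    using g by (intro prod.group[symmetric]) (simp_all add: image_subset_iff)
  also have "\<dots> = (\<Prod>p\<in>?P. if \<sigma> (fst p) = \<sigma> (snd p) then pair_weight b (fst p) (snd p) else 1)"
  proof (rule prod.cong[OF refl])
    fix p assume p: "p \<in> ?P"
    obtain i j where ij: "p = (i, j)" by fastforce
    have n: "i < n" "j < n" using p ij by (auto simp: later_nbrs_def)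
    have "(\<Prod>e\<in>{e \<in> ?E. g e = p}. if edge_mono G \<tau> e then b else 1) =
        (\<Prod>e\<in>{e \<in> ?E. joins G e (ord i) (ord j)}. if \<sigma> i = \<sigma> j then b else 1)"
      unfolding ij fibre[OF p[unfolded ij]]
      by (rule prod.cong) (auto simp: edge_mono_joins \<sigma> n)
    then show "(\<Prod>e\<in>{e \<in> ?E. g e = p}. if edge_mono G \<tau> e then b else 1) =
        (if \<sigma> (fst p) = \<sigma> (snd p) then pair_weight b (fst p) (snd p) else 1)"
      by (simp add: ij pair_weight_def)
  qed
  also have "\<dots> = (\<Prod>i<n. local_weight later_nbrs (pair_weight b) i \<sigma>)"
    unfolding local_weight_def by (subst prod.Sigma) (auto simp: case_prod_beta')
  finally show ?thesis .
qed

lemma potts_eq_local_weights: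
  "potts G q b = (\<Sum>\<sigma>\<in>{..<n} \<rightarrow>\<^sub>E {..<q}. \<Prod>i<n. local_weight later_nbrs (pair_weight b) i \<sigma>)"
proof -
  define pos where "pos = inv_into {..<n} ord"
  have pos: "pos v < n" "ord (pos v) = v" if "v \<in> verts G" for v
    using that ord inv_into_into[of v ord "{..<n}"] f_inv_into_f[of v ord "{..<n}"]
    by (auto simp: bij_betw_def pos_def)
  have pos_ord: "pos (ord i) = i" if "i < n" for i
    using pos[OF ord_verts[OF that]] ord_eq_iff[OF _ that] by blast
  show ?thesis
    unfolding potts_def
  proof (rule sum.reindex_bij_witness[where j = "\<lambda>\<tau>. restrict (\<tau> \<circ> ord) {..<n}"
        and i = "\<lambda>\<sigma>. restrict (\<sigma> \<circ> pos) (verts G)"])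
    fix \<tau> assume t: "\<tau> \<in> verts G \<rightarrow>\<^sub>E {..<q}"
    show "restrict (restrict (\<tau> \<circ> ord) {..<n} \<circ> pos) (verts G) = \<tau>"
      using t pos by (auto simp: fun_eq_iff restrict_def PiE_arb[OF t])
    show "restrict (\<tau> \<circ> ord) {..<n} \<in> {..<n} \<rightarrow>\<^sub>E {..<q}"
      using t ord_verts by (auto simp: PiE_iff)
    show "(\<Prod>i<n. local_weight later_nbrs (pair_weight b) i (restrict (\<tau> \<circ> ord) {..<n})) =
        (\<Prod>e\<in>edge_ids G. if edge_mono G \<tau> e then b else 1)"
      by (rule edge_product[symmetric]) simp
  next
    fix \<sigma> assume s: "\<sigma> \<in> {..<n} \<rightarrow>\<^sub>E {..<q}"
    show "restrict (restrict (\<sigma> \<circ> pos) (verts G) \<circ> ord) {..<n} = \<sigma>"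
    proof
      fix i show "restrict (restrict (\<sigma> \<circ> pos) (verts G) \<circ> ord) {..<n} i = \<sigma> i"
        using ord_verts[of i] pos_ord[of i] PiE_arb[OF s, of i] by (cases "i < n") auto
    qed
    show "restrict (\<sigma> \<circ> pos) (verts G) \<in> verts G \<rightarrow>\<^sub>E {..<q}"
      using s pos by (auto simp: PiE_iff)
  qed
qed

end

section \<open>Colourings packed as numbers in base q\<close>

definition digit :: "nat \<Rightarrow> nat \<Rightarrow> nat \<Rightarrow> nat" where
  "digit q s x = x div q ^ s mod q"

text \<open>Subtracting before adding keeps the subtraction on naturals exact, and matches the
  expression evaluated in \<open>colour_step\<close>.\<close>

definition set_digit :: "nat \<Rightarrow> nat \<Rightarrow> nat \<Rightarrow> nat \<Rightarrow> nat" where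
  "set_digit q s c x = x - digit q s x * q ^ s + c * q ^ s"

lemma digit_decomp: "x = x div q ^ Suc s * q ^ Suc s + digit q s x * q ^ s + x mod q ^ s"
proof -
  have "x div q ^ s div q = x div q ^ Suc s" by (simp only: div_mult2_eq[symmetric] power_Suc2)
  then have "x div q ^ s = x div q ^ Suc s * q + digit q s x"
    using div_mult_mod_eq[of "x div q ^ s" q] by (simp only: digit_def)
  then have "x div q ^ s * q ^ s = x div q ^ Suc s * q ^ Suc s + digit q s x * q ^ s"
    by (simp only: distrib_right mult.assoc power_Suc)
  then show ?thesis using div_mult_mod_eq[of x "q ^ s"] by (simp only:)
qed

lemma set_digit_eq: "set_digit q s c x = x div q ^ Suc s * q ^ Suc s + c * q ^ s + x mod q ^ s"
  using digit_decomp[of x q s] unfolding set_digit_def by linarith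

lemma low_digits_less: "q > 0 \<Longrightarrow> c < q \<Longrightarrow> c * q ^ s + y mod q ^ s < (q::nat) ^ Suc s"
proof -
  assume q: "q > 0" "c < q"
  have "y mod q ^ s < q ^ s" using q by simp
  then have "c * q ^ s + y mod q ^ s < Suc c * q ^ s" by simp
  also have "\<dots> \<le> q * q ^ s" using q by (intro mult_right_mono) auto
  finally show ?thesis by simp
qed

lemma set_digit_div:
  assumes "q > 0" "c < q" "s < t"
  shows "set_digit q s c x div q ^ t = x div q ^ t"
proof -
  have "set_digit q s c x div q ^ Suc s = x div q ^ Suc s"
  proof -
    have "set_digit q s c x = (c * q ^ s + x mod q ^ s) + x div q ^ Suc s * q ^ Suc s"
      by (simp add: set_digit_eq)
    then show ?thesis using low_digits_less[OF assms(1,2), of s x] assms(1) by simp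
  qed
  moreover have "q ^ t = q ^ Suc s * q ^ (t - Suc s)"
    using assms(3) by (metis Suc_leI le_add_diff_inverse power_add)
  ultimately show ?thesis by (simp only: div_mult2_eq)
qed

lemma digit_set_digit:
  assumes q: "q > 0" "c < q"
  shows "digit q t (set_digit q s c x) = (if t = s then c else digit q t x)"
proof -
  consider "t = s" | "s < t" | "t < s" by linarith
  then show ?thesis
  proof cases
    case 1
    have "set_digit q s c x = x mod q ^ s + (x div q ^ Suc s * q + c) * q ^ s"
      by (simp add: set_digit_eq algebra_simps)
    then have "set_digit q s c x div q ^ s = x div q ^ Suc s * q + c" using q by simp
    then show ?thesis using 1 q by (simp add: digit_def)
  next
    case 2
    then show ?thesis using set_digit_div[OF q 2] by (simp add: digit_def)
  next
    case 3
    \<comment> \<open>A digit below position \<open>s\<close> depends only on the residue modulo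
      \<open>q ^ s\<close>, which the update leaves unchanged.\<close>
    have low: "digit q t y = digit q t (y mod q ^ s)" for y
    proof -
      obtain r where r: "q ^ s = q ^ t * (q * r)"
        using 3 by (metis Suc_leI le_add_diff_inverse power_Suc2 power_add mult.assoc)
      have "y = y mod q ^ s + q ^ t * (q * (r * (y div q ^ s)))"
        using mod_mult_div_eq[of y "q ^ s"] r by (simp only: mult.assoc)
      then have "y div q ^ t = (y mod q ^ s + q ^ t * (q * (r * (y div q ^ s)))) div q ^ t"
        by (rule arg_cong)
      also have "\<dots> = q * (r * (y div q ^ s)) + y mod q ^ s div q ^ t" using q by simp
      finally show ?thesis by (simp add: digit_def)
    qed
    have "set_digit q s c x = x mod q ^ s + (x div q ^ Suc s * q + c) * q ^ s"
      by (simp add: set_digit_eq algebra_simps)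
    then have "set_digit q s c x mod q ^ s = x mod q ^ s" by simp
    then show ?thesis using 3 low[of x] low[of "set_digit q s c x"] by simp
  qed
qed

lemma set_digit_less:
  assumes "q > 0" "c < q" "s < t" "x < q ^ t"
  shows "set_digit q s c x < q ^ t"
  using set_digit_div[OF assms(1-3), of x] assms by (simp add: div_eq_0_iff)

section \<open>Reasoning about machine programs\<close>

lemma words_set_word [simp]:
  "words (set_word r i x s) = (words s)(r := (words s r)(i := x))"
  "nums (set_word r i x s) = nums s"
  by (simp_all add: set_word_def)

lemma nums_set_num [simp]:
  "nums (set_num r i x s) = (nums s)(r := (nums s r)(i := x))"
  "words (set_num r i x s) = words s"
  by (simp_all add: set_num_def)

section \<open>Total correctness with time bounds, frames and counted loops\<close>

definition runs :: "nat \<Rightarrow> com \<Rightarrow> 'a::field state \<Rightarrow> nat \<Rightarrow> ('a state \<Rightarrow> bool) \<Rightarrow> bool" where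
  "runs w P s t Q \<longleftrightarrow> (\<exists>t' s'. run w P s t' s' \<and> t' \<le> t \<and> Q s')"

text \<open>Arrays are the unit of framing. Registers are arrays of their own, so this syntactic set
  suffices to carry unaffected values past a program.\<close>

fun word_targets :: "com \<Rightarrow> nat set" where
  "word_targets Skip = {}"
| "word_targets (WSet r i x) = {r}"
| "word_targets (NSet r i x) = {}"
| "word_targets (Seq c d) = word_targets c \<union> word_targets d"
| "word_targets (Cond b c d) = word_targets c \<union> word_targets d"
| "word_targets (While b c) = word_targets c"

fun num_targets :: "com \<Rightarrow> nat set" where
  "num_targets Skip = {}"
| "num_targets (WSet r i x) = {}"
| "num_targets (NSet r i x) = {r}"
| "num_targets (Seq c d) = num_targets c \<union> num_targets d"
| "num_targets (Cond b c d) = num_targets c \<union> num_targets d"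
| "num_targets (While b c) = num_targets c"

definition frame :: "com \<Rightarrow> 'a state \<Rightarrow> 'a state \<Rightarrow> bool" where
  "frame P s s' \<longleftrightarrow> (\<forall>r. r \<notin> word_targets P \<longrightarrow> words s' r = words s r) \<and>
     (\<forall>r. r \<notin> num_targets P \<longrightarrow> nums s' r = nums s r)"

lemma frame_words: "frame P s s' \<Longrightarrow> r \<notin> word_targets P \<Longrightarrow> words s' r = words s r"
  by (simp add: frame_def)

lemma frame_nums: "frame P s s' \<Longrightarrow> r \<notin> num_targets P \<Longrightarrow> nums s' r = nums s r"
  by (simp add: frame_def)

lemma run_frame: "run w P s t s' \<Longrightarrow> frame P s s'"
  by (induction rule: run.induct) (auto simp: frame_def)

lemma runs_mono:
  "runs w P s t Q \<Longrightarrow> t \<le> t' \<Longrightarrow> (\<And>s'. frame P s s' \<Longrightarrow> Q s' \<Longrightarrow> Q' s') \<Longrightarrow> runs w P s t' Q'"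
  unfolding runs_def by (meson order_trans run_frame)

lemma runs_Seq:
  assumes "runs w c s t Q" "\<And>s'. frame c s s' \<Longrightarrow> Q s' \<Longrightarrow> runs w d s' t' R"
  shows "runs w (Seq c d) s (t + t') R"
proof -
  obtain u s1 where 1: "run w c s u s1" "u \<le> t" "Q s1" using assms(1) by (auto simp: runs_def)
  then obtain v s2 where 2: "run w d s1 v s2" "v \<le> t'" "R s2"
    using assms(2)[OF run_frame[OF 1(1)] 1(3)] by (auto simp: runs_def)
  show ?thesis unfolding runs_def
    by (rule exI[of _ "u + v"], rule exI[of _ s2]) (use 1 2 run_Seq in auto)
qed

text \<open>A bound for loop-free code; a conditional is charged for both alternatives. The value
  for loops is a placeholder: \<open>wp\<close> rejects loops, so \<open>runs_wp\<close> claims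
  nothing about them.\<close>

fun max_cost :: "com \<Rightarrow> nat" where
  "max_cost Skip = 1"
| "max_cost (WSet r i x) = wcost i + wcost x + 1"
| "max_cost (NSet r i x) = wcost i + ncost x + 1"
| "max_cost (Seq c d) = max_cost c + max_cost d"
| "max_cost (Cond b c d) = bcost b + 1 + max_cost c + max_cost d"
| "max_cost (While b c) = 0"

fun wp :: "nat \<Rightarrow> com \<Rightarrow> 'a::field state \<Rightarrow> ('a state \<Rightarrow> bool) \<Rightarrow> bool" where
  "wp w Skip s Q \<longleftrightarrow> Q s"
| "wp w (WSet r i x) s Q \<longleftrightarrow> wfits w i s \<and> wfits w x s \<and> Q (set_word r (wval i s) (wval x s) s)"
| "wp w (NSet r i x) s Q \<longleftrightarrow> wfits w i s \<and> nfits w x s \<and> Q (set_num r (wval i s) (nval x s) s)"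
| "wp w (Seq c d) s Q \<longleftrightarrow> wp w c s (\<lambda>s'. wp w d s' Q)"
| "wp w (Cond b c d) s Q \<longleftrightarrow> bfits w b s \<and> (if bval b s then wp w c s Q else wp w d s Q)"
| "wp w (While b c) s Q \<longleftrightarrow> False"

lemma runs_wp: "wp w P s Q \<Longrightarrow> runs w P s (max_cost P) Q"
proof (induction P arbitrary: s Q)
  case Skip
  then show ?case unfolding runs_def using run_Skip by fastforce
next
  case (WSet r i x)
  then have "run w (WSet r i x) s (wcost i + wcost x + 1) (set_word r (wval i s) (wval x s) s)"
    by (intro run_WSet) auto
  with WSet show ?case unfolding runs_def by fastforce
next
  case (NSet r i x)
  then have "run w (NSet r i x) s (wcost i + ncost x + 1) (set_num r (wval i s) (nval x s) s)"
    by (intro run_NSet) auto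
  with NSet show ?case unfolding runs_def by fastforce
next
  case (Seq c d)
  have "wp w c s (\<lambda>s'. wp w d s' Q)" using Seq.prems by simp
  from runs_Seq[OF Seq.IH(1)[OF this] Seq.IH(2)] show ?case by simp
next
  case (Cond b c d)
  show ?case
  proof (cases "bval b s")
    case True
    then obtain t s' where "run w c s t s'" "t \<le> max_cost c" "Q s'" "bfits w b s"
      using Cond.IH(1)[of s Q] Cond.prems by (auto simp: runs_def)
    with True show ?thesis unfolding runs_def
      by (intro exI[of _ "bcost b + 1 + t"] exI[of _ s'] conjI run_CondTrue) auto
  next
    case False
    then obtain t s' where "run w d s t s'" "t \<le> max_cost d" "Q s'" "bfits w b s"
      using Cond.IH(2)[of s Q] Cond.prems by (auto simp: runs_def)
    with False show ?thesis unfolding runs_def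
      by (intro exI[of _ "bcost b + 1 + t"] exI[of _ s'] conjI run_CondFalse) auto
  qed
qed simp

lemma runs_wp': "wp w P s Q \<Longrightarrow> max_cost P \<le> t \<Longrightarrow> runs w P s t Q"
  using runs_wp runs_mono by blast

abbreviation reg :: "nat \<Rightarrow> wexp" where
  "reg r \<equiv> WGet r (WConst 0)"

definition For :: "nat \<Rightarrow> wexp \<Rightarrow> com \<Rightarrow> com" where
  "For r e c = Seq (WSet r (WConst 0) (WConst 0))
     (While (WLess (reg r) e) (Seq c (WSet r (WConst 0) (WOp WAdd (reg r) (WConst 1)))))"

lemma targets_For [simp]:
  "word_targets (For r e c) = insert r (word_targets c)"
  "num_targets (For r e c) = num_targets c"
  by (auto simp: For_def)

text \<open>The bound is re-evaluated before every round, so it must be constant over all states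
  that differ only in what the loop writes; \<open>stable\<close> lets the counter change under the
  invariant. Test and increment together cost at most 20 steps when the bound expression costs at
  most 10, which \<open>40\<close> covers.\<close>

lemma runs_For:
  assumes init: "I 0 s0"
    and step: "\<And>k s. k < N \<Longrightarrow> I k s \<Longrightarrow> words s r 0 = k \<Longrightarrow> frame (For r e c) s0 s \<Longrightarrow>
      runs w c s t (I (Suc k))"
    and lim: "\<And>s. frame (For r e c) s0 s \<Longrightarrow> wval e s = N \<and> wfits w e s"
    and stable: "\<And>k s x. I k s \<Longrightarrow> I k (set_word r 0 x s)"
    and r: "r \<notin> word_targets c" and N: "N < 2 ^ w" and e: "wcost e \<le> 10"
  shows "runs w (For r e c) s0 (N * (t + 40) + 40) (I N)"
proof -
  let ?F = "For r e c" and ?b = "WLess (reg r) e"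
    and ?inc = "WSet r (WConst 0) (WOp WAdd (reg r) (WConst 1))"
  let ?W = "While ?b (Seq c ?inc)"
  have loop: "runs w ?W s (d * (t + 40) + 20) (I N)"
    if "d \<le> N" "I (N - d) s" "words s r 0 = N - d" "frame ?F s0 s" for d s
    using that
  proof (induction d arbitrary: s)
    case 0
    have "run w ?W s (bcost ?b + 1) s"
      using 0 lim N by (intro run_WhileFalse) auto
    then show ?case using 0 e unfolding runs_def by force
  next
    case (Suc d)
    have k: "N - Suc d < N" "Suc (N - Suc d) = N - d" using Suc.prems by auto
    obtain u s1 where u: "run w c s u s1" "u \<le> t" "I (N - d) s1"
      using step[OF k(1) Suc.prems(2-4)] k(2) by (auto simp: runs_def)
    have s1: "words s1 r 0 = N - Suc d" using run_frame[OF u(1)] r Suc.prems by (simp add: frame_def)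
    let ?s2 = "set_word r 0 (N - d) s1"
    have "frame ?F s0 ?s2"
      using Suc.prems(4) run_frame[OF u(1)] by (auto simp: frame_def)
    moreover have "I (N - d) ?s2" using stable u(3) by blast
    ultimately obtain v s3 where v: "run w ?W ?s2 v s3" "v \<le> d * (t + 40) + 20" "I N s3"
      using Suc.IH[of ?s2] Suc.prems by (auto simp: runs_def)
    have "(1::nat) < 2 ^ w" using k N by linarith
    moreover have "N - Suc d < 2 ^ w" "N - d < 2 ^ w" using N by linarith+
    moreover have "6 = wcost (WConst 0) + wcost (WOp WAdd (reg r) (WConst 1)) + 1" by simp
    ultimately have "run w ?inc s1 6 ?s2"
      using run_WSet[of w "WConst 0" s1 "WOp WAdd (reg r) (WConst 1)" r] s1 k(2)
      by (simp del: wcost.simps)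
    then have "run w (Seq c ?inc) s (u + 6) ?s2" using u(1) by (rule run_Seq[rotated])
    moreover have "bfits w ?b s" "bval ?b s" using lim[OF Suc.prems(4)] Suc.prems N k by auto
    ultimately have "run w ?W s (bcost ?b + 1 + (u + 6) + v) s3" using v by (intro run_WhileTrue)
    moreover have "bcost ?b + 1 + (u + 6) + v \<le> Suc d * (t + 40) + 20" using u v e by simp
    ultimately show ?case using v(3) unfolding runs_def by blast
  qed
  let ?s = "set_word r 0 0 s0"
  have "3 = wcost (WConst 0) + wcost (WConst 0) + 1" by simp
  then have "run w (WSet r (WConst 0) (WConst 0)) s0 3 ?s"
    using run_WSet[of w "WConst 0" s0 "WConst 0" r] by (simp del: wcost.simps)
  moreover have "runs w ?W ?s (N * (t + 40) + 20) (I N)"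
    by (rule loop) (use init stable in \<open>auto simp: frame_def\<close>)
  then obtain u s' where "run w ?W ?s u s'" "u \<le> N * (t + 40) + 20" "I N s'" by (auto simp: runs_def)
  ultimately show ?thesis
    unfolding runs_def For_def by (intro exI[of _ "3 + u"] exI[of _ s'] conjI run_Seq) auto
qed

definition weq :: "wexp \<Rightarrow> wexp \<Rightarrow> bexp" where
  "weq x y = BAnd (BNot (WLess x y)) (BNot (WLess y x))"

lemma weq_simps [simp]:
  "bval (weq x y) s \<longleftrightarrow> wval x s = wval y s"
  "bfits w (weq x y) s \<longleftrightarrow> wfits w x s \<and> wfits w y s"
  "bcost (weq x y) = 2 * wcost x + 2 * wcost y + 5"
  by (auto simp: weq_def)

abbreviation (input) wadd :: "wexp \<Rightarrow> wexp \<Rightarrow> wexp" (infixl "[+]" 65) where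
  "x [+] y \<equiv> WOp WAdd x y"
abbreviation (input) wsub :: "wexp \<Rightarrow> wexp \<Rightarrow> wexp" (infixl "[-]" 65) where
  "x [-] y \<equiv> WOp WSub x y"
abbreviation (input) wmul :: "wexp \<Rightarrow> wexp \<Rightarrow> wexp" (infixl "[*]" 70) where
  "x [*] y \<equiv> WOp WMul x y"
abbreviation (input) wdiv :: "wexp \<Rightarrow> wexp \<Rightarrow> wexp" (infixl "[div]" 70) where
  "x [div] y \<equiv> WOp WDiv x y"
abbreviation (input) wmod :: "wexp \<Rightarrow> wexp \<Rightarrow> wexp" (infixl "[mod]" 70) where
  "x [mod] y \<equiv> WOp WMod x y"
abbreviation (input) wless :: "wexp \<Rightarrow> wexp \<Rightarrow> bexp" (infix "[<]" 50) where
  "x [<] y \<equiv> WLess x y"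
abbreviation (input) band :: "bexp \<Rightarrow> bexp \<Rightarrow> bexp" (infixr "[and]" 35) where
  "x [and] y \<equiv> BAnd x y"
abbreviation (input) nmul :: "nexp \<Rightarrow> nexp \<Rightarrow> nexp" (infixl "[.]" 70) where
  "x [.] y \<equiv> NOp NMul x y"
abbreviation (input) seq :: "com \<Rightarrow> com \<Rightarrow> com" (infixr ";;" 60) where
  "c ;; d \<equiv> Seq c d"
abbreviation (input) assign :: "nat \<Rightarrow> wexp \<Rightarrow> com" where
  "assign r x \<equiv> WSet r (WConst 0) x"
abbreviation (input) guarded :: "bexp \<Rightarrow> com \<Rightarrow> com" where
  "guarded b c \<equiv> Cond b c Skip"

section \<open>Computing an elimination order\<close>

abbreviation (input) nV :: wexp where "nV \<equiv> WGet 0 (WConst 0)"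
abbreviation (input) nE :: wexp where "nE \<equiv> WGet 0 (WConst 1)"
abbreviation (input) nT :: wexp where "nT \<equiv> WGet 0 (WConst 2)"

lemma less_mult_div_mod:
  fixes n :: nat
  assumes "p < k * n"
  shows "p div n < k" "p mod n < n" "p div n * n + p mod n = p"
proof -
  have "0 < n" using assms by (cases n) auto
  then show "p div n < k" "p mod n < n" "p div n * n + p mod n = p"
    using assms by (auto simp: less_mult_imp_div_less)
qed

lemma row_major_less:
  fixes n :: nat
  assumes "i < k" "j < n"
  shows "i * n + j < k * n"
proof -
  have "i * n + j < Suc i * n" using assms(2) by simp
  also have "\<dots> \<le> k * n" using assms(1) by (intro mult_right_mono) auto
  finally show ?thesis .
qed

lemma row_major_eq_iff:
  fixes i j x y Q :: nat
  assumes "x < Q" "y < Q"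
  shows "i * Q + x = j * Q + y \<longleftrightarrow> i = j \<and> x = y"
proof
  assume e: "i * Q + x = j * Q + y"
  have "(i * Q + x) div Q = i" "(j * Q + y) div Q = j" using assms by simp_all
  then show "i = j \<and> x = y" using e by simp
qed simp

text \<open>
  Word arrays beyond the input: \<open>10\<close> the scan position \<open>t * n + v\<close> chosen in each elimination step
  (vertex \<open>v\<close>, node \<open>t\<close>), \<open>11\<close> marks of eliminated vertices, \<open>12\<close> incidence matrix of elimination
  steps and later neighbours, \<open>13\<close> powers \<open>q^slot\<close>, \<open>14\<close> component labels, \<open>15\<close> the next neighbour
  (or \<open>n\<close> if there is none).  Number arrays: \<open>1\<close> the result, \<open>2\<close> weights of pairs of elimination
  steps, \<open>3\<close> messages, \<open>4\<close> and \<open>5\<close> accumulators.  The word arrays from \<open>20\<close> on are registers;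
  \<open>26\<close> holds the common size of the message tables.  From array \<open>12\<close> on, vertices are named by their
  elimination step, except in \<open>14\<close>.
\<close>

definition scan_test :: com where
  "scan_test = guarded
     (WConst 0 [<] WGet 5 (reg 22 [div] nV [*] nV [+] reg 21 [mod] nV) [and]
      WGet 11 (reg 22 [mod] nV) [<] WConst 1 [and] WConst 0 [<] WGet 5 (reg 22) [and]
      WGet 5 (reg 21 [div] nV [*] nV [+] reg 22 [mod] nV) [<] WConst 1)
     (assign 23 (WConst 1))"

text \<open>Register \<open>23\<close> flags a counterexample to the candidate. A candidate that
  passes overwrites the earlier choice for the same elimination step, so the last eligible position
  is kept and no loop has to be left early.\<close>

definition scan :: com where
  "scan = assign 23 (WConst 0) ;; For 22 (nT [*] nV) scan_test ;;
     guarded (WGet 11 (reg 21 [mod] nV) [<] WConst 1 [and] reg 23 [<] WConst 1)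
       (WSet 10 (reg 20) (reg 21))"

definition order_prog :: com where
  "order_prog = For 20 nV (For 21 (nT [*] nV) scan ;; WSet 11 (WGet 10 (reg 20) [mod] nV) (WConst 1))"

lemma scan_test_targets [simp]:
  "word_targets scan_test = {23}" "num_targets scan_test = {}"
  by (simp_all add: scan_test_def)

lemma scan_targets [simp]:
  "word_targets scan = {10, 22, 23}" "num_targets scan = {}"
  by (auto simp: scan_def)

lemma order_targets [simp]:
  "word_targets order_prog = {10, 11, 20, 21, 22, 23}" "num_targets order_prog = {}"
  by (auto simp: order_prog_def)

text \<open>The capacities bound the indices and intermediate words: pairs of vertices, pairs of a
  node and a vertex, edge numbers, constants, and message table indices. In \<open>cap_table\<close>
  the \<open>+ 1\<close> beside \<open>nverts G\<close> keeps the bare power of \<open>q\<close>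
  bounded even without vertices.\<close>

locale tutte_machine =
  fixes G T :: graph and bag :: "nat \<Rightarrow> nat set" and q w :: nat and a b :: "'a::field_char_0"
  assumes wf: "wf_graph G"
    and td: "tree_decomposition G T bag"
    and q_ge: "q \<ge> 3"
    and ab: "(a - 1) * (b - 1) = of_nat q"
    and cap_V: "nverts G * nverts G + nverts G < 2 ^ w"
    and cap_T: "nverts T * nverts G + nverts G + nverts T < 2 ^ w"
    and cap_E: "length (edges G) < 2 ^ w"
    and cap_q: "q + 10 < 2 ^ w"
    and cap_table: "(nverts G + 1) * q ^ (width T bag + 1) < 2 ^ w"
begin

abbreviation "n \<equiv> nverts G"
abbreviation "N \<equiv> nverts T"
abbreviation "m \<equiv> length (edges G)"

definition input :: "'a state \<Rightarrow> bool" where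
  "input s \<longleftrightarrow> words s 0 0 = n \<and> words s 0 1 = m \<and> words s 0 2 = N \<and>
     (\<forall>i<N. \<forall>u<n. words s 5 (i * n + u) = (if u \<in> bag i then 1 else 0)) \<and>
     (\<forall>e<m. words s 1 e = fst (edges G ! e) \<and> words s 2 e = snd (edges G ! e)) \<and>
     nums s 0 0 = a \<and> nums s 0 1 = b"

lemma input_frame:
  assumes "frame P s s'" "input s"
    and "0 \<notin> word_targets P" "1 \<notin> word_targets P" "2 \<notin> word_targets P" "5 \<notin> word_targets P"
    and "0 \<notin> num_targets P"
  shows "input s'"
  using assms unfolding input_def by (simp add: frame_words[OF assms(1)] frame_nums[OF assms(1)])

lemma input_set_word [simp]: "r \<notin> {0, 1, 2, 5} \<Longrightarrow> input (set_word r i x s) = input s"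
  by (simp add: input_def)

lemma input_set_num [simp]: "r \<noteq> 0 \<Longrightarrow> input (set_num r i x s) = input s"
  by (simp add: input_def)

lemma input_simps:
  assumes "input s"
  shows "words s 0 0 = n" "words s 0 (Suc 0) = m" "words s 0 2 = N" "nums s 0 0 = a" "nums s 0 (Suc 0) = b"
    "i < N \<Longrightarrow> u < n \<Longrightarrow> words s 5 (i * n + u) = (if u \<in> bag i then 1 else 0)"
    "e < m \<Longrightarrow> words s (Suc 0) e = fst (edges G ! e)" "e < m \<Longrightarrow> words s 2 e = snd (edges G ! e)"
  using assms by (auto simp: input_def)

lemma const_fits [simp]: "(1::nat) < 2 ^ w" "Suc 0 < 2 ^ w" "(2::nat) < 2 ^ w" "q < 2 ^ w" "(0::nat) < 2 ^ w"
  using cap_q by auto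

lemma n_fits [simp]: "n < 2 ^ w" "m < 2 ^ w" "N < 2 ^ w" "n * n < 2 ^ w" "N * n < 2 ^ w"
  using cap_V cap_E cap_T by auto

lemma node_fits: "i < N * n \<Longrightarrow> i < 2 ^ w"
  using cap_T by linarith

lemma node_index_fits: "i < N \<Longrightarrow> u < n \<Longrightarrow> i * n + u < 2 ^ w \<and> i * n < 2 ^ w"
  using row_major_less[of i N u n] cap_T by linarith

lemma vert_index_fits: "i < n \<Longrightarrow> u < n \<Longrightarrow> i * n + u < 2 ^ w \<and> i * n < 2 ^ w"
  using row_major_less[of i n u n] cap_V by linarith

lemma vert_fits: "i < n \<Longrightarrow> i < 2 ^ w"
  using cap_V by linarith

lemma verts_eq: "verts G = {..<n}" "verts T = {..<N}"
  by (simp_all add: verts_def)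

text \<open>A scan position packs a node and a vertex, so the two quantifiers hidden in
  \<open>eligible\<close> collapse into one loop over \<open>p\<close>; a conflict is a
  counterexample to the inclusion of bags.\<close>

definition conflict :: "nat set \<Rightarrow> nat \<Rightarrow> nat \<Rightarrow> bool" where
  "conflict D r p \<longleftrightarrow> r mod n \<in> bag (p div n) \<and> p mod n \<notin> D \<and> p mod n \<in> bag (p div n) \<and>
     p mod n \<notin> bag (r div n)"

lemma no_conflict_iff_eligible:
  assumes r: "r < N * n"
  shows "r mod n \<notin> D \<and> \<not> (\<exists>p<N * n. conflict D r p) \<longleftrightarrow>
    eligible T bag (verts G - D) (r mod n) (r div n)"
proof -
  note rr = less_mult_div_mod[OF r]
  have "(\<exists>p<N * n. conflict D r p) \<longleftrightarrow>
      (\<exists>j<N. \<exists>u<n. r mod n \<in> bag j \<and> u \<notin> D \<and> u \<in> bag j \<and> u \<notin> bag (r div n))"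
  proof
    assume "\<exists>p<N * n. conflict D r p"
    then show "\<exists>j<N. \<exists>u<n. r mod n \<in> bag j \<and> u \<notin> D \<and> u \<in> bag j \<and> u \<notin> bag (r div n)"
      using less_mult_div_mod(1,2) unfolding conflict_def by blast
  next
    assume "\<exists>j<N. \<exists>u<n. r mod n \<in> bag j \<and> u \<notin> D \<and> u \<in> bag j \<and> u \<notin> bag (r div n)"
    then obtain j u where ju: "j < N" "u < n"
      "r mod n \<in> bag j \<and> u \<notin> D \<and> u \<in> bag j \<and> u \<notin> bag (r div n)" by blast
    then have "conflict D r (j * n + u)" by (simp add: conflict_def)
    then show "\<exists>p<N * n. conflict D r p" using row_major_less[OF ju(1,2)] by blast
  qed
  then show ?thesis using rr(2) unfolding eligible_def verts_eq by auto
qed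

lemma scan_test_runs:
  assumes s: "input s" "words s 22 0 = p" "words s 21 0 = r" "p < N * n" "r < N * n"
    and D: "\<forall>v<n. words s 11 v = (if v \<in> D then 1 else 0)"
  shows "runs w scan_test s 60 (\<lambda>s'. words s' 23 0 = (if conflict D r p then 1 else words s 23 0))"
proof -
  note pp = less_mult_div_mod[OF s(4)] and rr = less_mult_div_mod[OF s(5)]
  have p5: "words s 5 p = (if p mod n \<in> bag (p div n) then 1 else 0)"
    using input_simps(6)[OF s(1) pp(1,2)] pp(3) by simp
  note fits = node_fits[OF s(4)] node_fits[OF s(5)] node_index_fits[OF pp(1) rr(2)]
    node_index_fits[OF rr(1) pp(2)] order_less_trans[OF pp(1) n_fits(3)] order_less_trans[OF rr(1) n_fits(3)]
    order_less_trans[OF pp(2) n_fits(1)] order_less_trans[OF rr(2) n_fits(1)]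
  show ?thesis
    by (rule runs_wp')
      (use fits in \<open>auto simp: scan_test_def input_simps[OF s(1)] s(2,3) p5 pp(1,2) rr(1,2) D conflict_def\<close>)
qed

lemma scan_runs:
  assumes s: "input s" "words s 20 0 = i" "words s 21 0 = r" "r < N * n" "i < n"
    and D: "\<forall>v<n. words s 11 v = (if v \<in> D then 1 else 0)"
  shows "runs w scan s (N * n * 100 + 100) (\<lambda>s'. words s' 10 =
    (if eligible T bag (verts G - D) (r mod n) (r div n) then (words s 10)(i := r) else words s 10))"
proof -
  note rr = less_mult_div_mod[OF s(4)]
  let ?s = "set_word 23 0 0 s"
  have 1: "runs w (assign 23 (WConst 0)) s 3 (\<lambda>s'. s' = ?s)"
    by (rule runs_wp') auto
  have 2: "runs w (For 22 (nT [*] nV) scan_test) ?s (N * n * (60 + 40) + 40)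
     (\<lambda>s'. words s' 23 0 = (if \<exists>p<N * n. conflict D r p then 1 else 0))"
  proof (rule runs_For)
    fix p s' assume p: "p < N * n" "words s' 23 0 = (if \<exists>p'<p. conflict D r p' then 1 else 0)"
      "words s' 22 0 = p" and fr: "frame (For 22 (nT [*] nV) scan_test) ?s s'"
    have "input s'" by (rule input_frame[OF fr]) (use s in auto)
    from scan_test_runs[OF this p(3) _ p(1) s(4), of D] s(3) D frame_words[OF fr]
    have "runs w scan_test s' 60 (\<lambda>s''. words s'' 23 0 = (if conflict D r p then 1 else words s' 23 0))"
      by simp
    then show "runs w scan_test s' 60 (\<lambda>s''. words s'' 23 0 = (if \<exists>p'<Suc p. conflict D r p' then 1 else 0))"
      by (rule runs_mono) (use p(2) in \<open>auto simp: less_Suc_eq\<close>)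
  next
    fix s' assume fr: "frame (For 22 (nT [*] nV) scan_test) ?s s'"
    have "input s'" by (rule input_frame[OF fr]) (use s in auto)
    then show "wval (nT [*] nV) s' = N * n \<and> wfits w (nT [*] nV) s'" by (simp add: input_simps)
  qed auto
  have 3: "runs w (guarded (WGet 11 (reg 21 [mod] nV) [<] WConst 1 [and] reg 23 [<] WConst 1)
       (WSet 10 (reg 20) (reg 21))) s' 30 (\<lambda>s'. words s' 10 =
        (if eligible T bag (verts G - D) (r mod n) (r div n) then (words s 10)(i := r) else words s 10))"
    if fr: "frame (For 22 (nT [*] nV) scan_test) ?s s'"
      and c: "words s' 23 0 = (if \<exists>p<N * n. conflict D r p then 1 else 0)" for s'
  proof -
    have in': "input s'" by (rule input_frame[OF fr]) (use s in auto)
    have e: "words s' 10 = words s 10" "words s' 11 = words s 11" "words s' 20 0 = i" "words s' 21 0 = r"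
      using frame_words[OF fr] s by auto
    show ?thesis
      unfolding no_conflict_iff_eligible[OF s(4), symmetric]
      by (rule runs_wp')
        (use node_fits[OF s(4)] vert_fits[OF s(5)] order_less_trans[OF rr(2) n_fits(1)] in
          \<open>auto simp: input_simps[OF in'] e c D rr(2)\<close>)
  qed
  have "runs w scan s (3 + (N * n * (60 + 40) + 40 + 30)) (\<lambda>s'. words s' 10 =
    (if eligible T bag (verts G - D) (r mod n) (r div n) then (words s 10)(i := r) else words s 10))"
    unfolding scan_def by (rule runs_Seq[OF 1], hypsubst, rule runs_Seq[OF 2 3])
  then show ?thesis by (rule runs_mono) auto
qed

definition valid_choices :: "(nat \<Rightarrow> nat) \<Rightarrow> nat \<Rightarrow> bool" where
  "valid_choices f k \<longleftrightarrow> (\<forall>i<k. f i < N * n \<and>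
     eligible T bag (verts G - (\<lambda>i. f i mod n) ` {..<i}) (f i mod n) (f i div n))"

lemma order_prog_runs:
  assumes s: "input s" "\<forall>v<n. words s 11 v = 0"
  shows "runs w order_prog s (n * (N * n * (N * n * 100 + 140) + 100) + 40)
    (\<lambda>s'. valid_choices (words s' 10) n)"
proof -
  let ?body = "For 21 (nT [*] nV) scan ;; WSet 11 (WGet 10 (reg 20) [mod] nV) (WConst 1)"
  let ?D = "\<lambda>s i. (\<lambda>i. words s 10 i mod n) ` {..<i}"
  define I where "I = (\<lambda>i (s :: 'a state). valid_choices (words s 10) i \<and>
    (\<forall>v<n. words s 11 v = (if v \<in> ?D s i then 1 else 0)))"
  have "runs w order_prog s (n * (N * n * (N * n * 100 + 100 + 40) + 40 + 20 + 40) + 40) (I n)"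
    unfolding order_prog_def
  proof (rule runs_For)
    show "I 0 s" using s by (simp add: I_def valid_choices_def)
  next
    fix i s1 assume i: "i < n" and I: "I i s1" and i20: "words s1 20 0 = i"
      and fr: "frame (For 20 nV ?body) s s1"
    have in1: "input s1" by (rule input_frame[OF fr]) (use s in auto)
    define D where "D = ?D s1 i"
    define E where "E = (\<lambda>r. eligible T bag (verts G - D) (r mod n) (r div n))"
    \<comment> \<open>Cell \<open>i\<close> holds an eligible position as soon as one has been
      passed; before that its content is arbitrary.\<close>
    define J where "J = (\<lambda>r (s' :: 'a state). (\<forall>l<i. words s' 10 l = words s1 10 l) \<and>
      ((\<exists>r'<r. E r') \<longrightarrow> words s' 10 i < N * n \<and> E (words s' 10 i)))"
    have D: "\<forall>v<n. words s1 11 v = (if v \<in> D then 1 else 0)" using I by (simp add: I_def D_def)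
    have 1: "runs w (For 21 (nT [*] nV) scan) s1 (N * n * (N * n * 100 + 100 + 40) + 40) (J (N * n))"
    proof (rule runs_For)
      fix r s2 assume r: "r < N * n" and J: "J r s2" and r21: "words s2 21 0 = r"
        and fr2: "frame (For 21 (nT [*] nV) scan) s1 s2"
      have in2: "input s2" by (rule input_frame[OF fr2]) (use in1 in auto)
      have "runs w scan s2 (N * n * 100 + 100) (\<lambda>s'. words s' 10 =
         (if E r then (words s2 10)(i := r) else words s2 10))"
        unfolding E_def
        by (rule scan_runs[OF in2 _ r21 r i]) (use frame_words[OF fr2] i20 D in auto)
      then show "runs w scan s2 (N * n * 100 + 100) (J (Suc r))"
        by (rule runs_mono) (use J r in \<open>auto simp: J_def less_Suc_eq\<close>)
    next
      fix s' assume fr': "frame (For 21 (nT [*] nV) scan) s1 s'"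
      have "input s'" by (rule input_frame[OF fr']) (use in1 in auto)
      then show "wval (nT [*] nV) s' = N * n \<and> wfits w (nT [*] nV) s'" by (simp add: input_simps)
    qed (auto simp: J_def)
    have 2: "runs w (WSet 11 (WGet 10 (reg 20) [mod] nV) (WConst 1)) s2 20 (I (Suc i))"
      if fr2: "frame (For 21 (nT [*] nV) scan) s1 s2" and J: "J (N * n) s2" for s2
    proof -
      have in2: "input s2" by (rule input_frame[OF fr2]) (use in1 in auto)
      \<comment> \<open>At most \<open>i < n\<close> vertices are marked, so some vertex remains and
        \<open>eligible_exists\<close> applies.\<close>
      have "D \<subset> verts G"
      proof -
        have sub: "D \<subseteq> verts G" unfolding D_def verts_eq using i by auto
        have "card D \<le> i" unfolding D_def using card_image_le[of "{..<i}"] by fastforce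
        then have "D \<noteq> verts G" using i by (auto simp: verts_eq)
        then show ?thesis using sub by blast
      qed
      then have R: "verts G - D \<subseteq> verts G" "verts G - D \<noteq> {}" by auto
      obtain v t where vt: "v < n" "t < N" "eligible T bag (verts G - D) v t"
        using eligible_exists[OF td R] by (auto simp: verts_eq)
      have "E (t * n + v)" using vt by (simp add: E_def)
      then have sel: "words s2 10 i < N * n" "E (words s2 10 i)" "\<forall>l<i. words s2 10 l = words s1 10 l"
        using J row_major_less[OF vt(2,1)] unfolding J_def by blast+
      have 20: "words s2 20 0 = i" "words s2 11 = words s1 11" using frame_words[OF fr2] i20 by auto
      have D2: "?D s2 i = D" unfolding D_def using sel(3) by auto
      let ?s = "set_word 11 (words s2 10 i mod n) 1 s2"
      have "I (Suc i) ?s"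
        unfolding I_def
      proof
        show "valid_choices (words ?s 10) (Suc i)"
          unfolding valid_choices_def
        proof (intro allI impI)
          fix l assume "l < Suc i"
          then consider "l = i" | "l < i" by linarith
          then show "words ?s 10 l < N * n \<and> eligible T bag
              (verts G - (\<lambda>i. words ?s 10 i mod n) ` {..<l}) (words ?s 10 l mod n) (words ?s 10 l div n)"
          proof cases
            case 1
            then show ?thesis using sel(1,2) D2 by (simp add: E_def)
          next
            case 2
            then have "(\<lambda>i. words s2 10 i mod n) ` {..<l} = (\<lambda>i. words s1 10 i mod n) ` {..<l}"
              using sel(3) by (intro image_cong) auto
            then show ?thesis using 2 I sel(3) by (simp add: I_def valid_choices_def)
          qed
        qed
        have "?D ?s (Suc i) = insert (words s2 10 i mod n) D"
          unfolding D2[symmetric] lessThan_Suc by simp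
        then show "\<forall>v<n. words ?s 11 v = (if v \<in> ?D ?s (Suc i) then 1 else 0)"
          using D 20 by simp
      qed
      then show ?thesis
        by (intro runs_wp')
          (use node_fits[OF sel(1)] vert_fits[OF i] less_mult_div_mod(2)[OF sel(1)] in
            \<open>auto simp: input_simps[OF in2] 20 intro: vert_fits\<close>)
    qed
    show "runs w ?body s1 (N * n * (N * n * 100 + 100 + 40) + 40 + 20) (I (Suc i))"
      by (rule runs_Seq[OF 1 2])
  next
    fix s' assume fr: "frame (For 20 nV ?body) s s'"
    have "input s'" by (rule input_frame[OF fr]) (use s in auto)
    then show "wval nV s' = n \<and> wfits w nV s'" by (simp add: input_simps)
  qed (auto simp: I_def)
  then show ?thesis by (rule runs_mono) (auto simp: I_def)
qed

text \<open>Each chosen vertex avoids its predecessors, so the \<open>n\<close> choices are distinct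
  and exhaust the vertices.\<close>

lemma valid_choices_order:
  assumes v: "valid_choices f n"
  shows "elimination_order G T bag (\<lambda>i. f i mod n) (\<lambda>i. f i div n)"
proof
  let ?o = "\<lambda>i. f i mod n"
  have el: "?o i \<in> verts G - ?o ` {..<i}" if "i < n" for i
    using v that by (simp add: valid_choices_def eligible_def)
  have inj: "inj_on ?o {..<n}"
  proof (rule linorder_inj_onI')
    fix i j assume ij: "i \<in> {..<n}" "j \<in> {..<n}" "i < j"
    then have "?o i \<in> ?o ` {..<j}" by blast
    then show "?o i \<noteq> ?o j" using el[of j] ij(2) by auto
  qed
  moreover have "?o ` {..<n} \<subseteq> verts G" using el by auto
  ultimately have "?o ` {..<n} = verts G"
    by (intro card_subset_eq) (auto simp: card_image verts_eq)
  with inj show "bij_betw ?o {..<n} (verts G)" by (simp add: bij_betw_def)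
  show "f i div n \<in> verts T" if "i < n" for i
    using v that less_mult_div_mod(1) by (auto simp: valid_choices_def verts_eq)
  show "eligible T bag (verts G - ?o ` {..<i}) (?o i) (f i div n)" if "i < n" for i
    using v that by (simp add: valid_choices_def)
qed (rule wf td)+

end

section \<open>Weights, colour slots and parents\<close>

definition edge_test :: com where
  "edge_test =
     (let A = WGet 10 (reg 24 [div] nV) [mod] nV; B = WGet 10 (reg 24 [mod] nV) [mod] nV;
          U = WGet 1 (reg 22); V = WGet 2 (reg 22)
      in Cond (BNot (weq U A [and] weq V B) [and] BNot (weq U B [and] weq V A)) Skip
           (NSet 2 (reg 24) (NGet 2 (reg 24) [.] NGet 0 (WConst 1))))"

definition table_entry :: com where
  "table_entry = Cond (reg 24 [mod] nV [<] reg 24 [div] nV) (WSet 12 (reg 24) (WConst 0))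
     (WSet 12 (reg 24)
       (WGet 5 (WGet 10 (reg 24 [div] nV) [div] nV [*] nV [+] WGet 10 (reg 24 [mod] nV) [mod] nV)));;
     NSet 2 (reg 24) (NConst 1)"

definition table_prog :: com where
  "table_prog = For 24 (nV [*] nV) (table_entry;; For 22 nE edge_test)"

lemma table_targets [simp]:
  "word_targets edge_test = {}" "num_targets edge_test = {2}"
  "word_targets table_entry = {12}" "num_targets table_entry = {2}"
  "word_targets table_prog = {12, 22, 24}" "num_targets table_prog = {2}"
  by (auto simp: table_prog_def edge_test_def table_entry_def Let_def)

definition slot_used :: com where
  "slot_used = guarded (reg 20 [<] reg 22 [and] WConst 0 [<] WGet 12 (reg 20 [*] nV [+] reg 22) [and]
     weq (WGet 13 (reg 22)) (reg 25)) (assign 23 (WConst 1))"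

text \<open>Register \<open>25\<close> holds \<open>q ^ x\<close> for the slot \<open>x\<close>
  under trial, and a slot taken by a later neighbour raises \<open>x\<close> by one. The power is
  stored in place of the slot because reading a digit divides by it.\<close>

definition slot_search :: "nat \<Rightarrow> com" where
  "slot_search q = assign 23 (WConst 0);; For 22 nV slot_used;;
     guarded (WConst 0 [<] reg 23) (assign 25 (reg 25 [*] WConst q))"

text \<open>Positions are handled from \<open>n - 1\<close> downwards, so all later neighbours
  already own slots. The search takes \<open>n\<close> rounds since fewer than \<open>n\<close>
  slots can be blocked. Register \<open>26\<close> follows \<open>q\<close> to the power of the
  largest slot plus one.\<close>

definition slot_step :: "nat \<Rightarrow> com" where
  "slot_step q = (assign 20 (nV [-] WConst 1 [-] reg 27);; assign 25 (WConst 1));;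
     For 21 nV (slot_search q);;
     (WSet 13 (reg 20) (reg 25);;
      guarded (reg 26 [<] reg 25 [*] WConst q) (assign 26 (reg 25 [*] WConst q)))"

definition slot_prog :: "nat \<Rightarrow> com" where
  "slot_prog q = assign 26 (WConst 1);; For 27 nV (slot_step q)"

lemma slot_targets [simp]:
  "word_targets slot_used = {23}" "num_targets slot_used = {}"
  "word_targets (slot_search q) = {22, 23, 25}" "num_targets (slot_search q) = {}"
  "word_targets (slot_step q) = {13, 20, 21, 22, 23, 25, 26}" "num_targets (slot_step q) = {}"
  "word_targets (slot_prog q) = {13, 20, 21, 22, 23, 25, 26, 27}" "num_targets (slot_prog q) = {}"
  by (auto simp: slot_used_def slot_search_def slot_step_def slot_prog_def)

definition next_test :: com where
  "next_test = guarded (reg 20 [<] reg 22 [and] WConst 0 [<] WGet 12 (reg 20 [*] nV [+] reg 22) [and]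
     reg 22 [<] WGet 15 (reg 20)) (WSet 15 (reg 20) (reg 22))"

definition next_prog :: com where
  "next_prog = For 20 nV (WSet 15 (reg 20) nV;; For 22 nV next_test)"

lemma next_targets [simp]:
  "word_targets next_test = {15}" "num_targets next_test = {}"
  "word_targets next_prog = {15, 20, 22}" "num_targets next_prog = {}"
  by (auto simp: next_test_def next_prog_def)

locale ordered_machine = tutte_machine G T bag q w a b +
  order?: elimination_order G T bag "\<lambda>i. sel i mod nverts G" "\<lambda>i. sel i div nverts G"
  for G T bag q w and a b :: "'a::field_char_0" and sel
begin

abbreviation "ord \<equiv> \<lambda>i. sel i mod n"
abbreviation "node \<equiv> \<lambda>i. sel i div n"

definition choices :: "'a state \<Rightarrow> bool" where
  "choices s \<longleftrightarrow> (\<forall>i<n. words s 10 i = sel i \<and> sel i < N * n)"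

definition table_word :: "nat \<Rightarrow> nat" where
  "table_word z = (if z mod n = z div n \<or> z mod n \<in> later_nbrs (z div n) then 1 else 0)"

definition tables :: "'a state \<Rightarrow> bool" where
  "tables s \<longleftrightarrow> (\<forall>i<n. \<forall>j<n.
     words s 12 (i * n + j) = (if j = i \<or> j \<in> later_nbrs i then 1 else 0) \<and>
     nums s 2 (i * n + j) = pair_weight b i j)"

lemma edge_test_runs:
  assumes s: "input s" "choices s" "words s 24 0 = z" "words s 22 0 = e" "z < n * n" "e < m"
  shows "runs w edge_test s 200 (\<lambda>s'. nums s' 2 = (if joins G e (ord (z div n)) (ord (z mod n))
    then (nums s 2)(z := nums s 2 z * b) else nums s 2))"
proof -
  note zz = less_mult_div_mod[OF s(5)]
  have "edges G ! e \<in> set (edges G)" using s(6) by simp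
  then have ev: "fst (edges G ! e) < n" "snd (edges G ! e) < n"
    using wf unfolding wf_graph_def verts_eq by (auto simp: case_prod_beta')
  have sel: "words s 10 (z div n) = sel (z div n)" "words s 10 (z mod n) = sel (z mod n)"
    "sel (z div n) < N * n" "sel (z mod n) < N * n" using s(2) zz by (auto simp: choices_def)
  have j: "joins G e x y \<longleftrightarrow> (fst (edges G ! e) = x \<and> snd (edges G ! e) = y) \<or>
      (fst (edges G ! e) = y \<and> snd (edges G ! e) = x)" for x y
    by (auto simp: joins_def prod_eq_iff)
  have zf: "z < 2 ^ w" using s(5) cap_V by linarith
  have ef: "e < 2 ^ w" using s(6) cap_E by linarith
  note fits = node_fits[OF sel(3)] node_fits[OF sel(4)] zf ef vert_fits[OF zz(1)] vert_fits[OF zz(2)]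
    vert_fits[OF ev(1)] vert_fits[OF ev(2)] vert_fits[OF less_mult_div_mod(2)[OF sel(3)]]
    vert_fits[OF less_mult_div_mod(2)[OF sel(4)]]
  show ?thesis
    by (rule runs_wp')
      (use fits in \<open>auto simp: edge_test_def Let_def input_simps[OF s(1)] s(3,4,6) sel j\<close>)
qed

lemma table_entry_runs:
  assumes s: "input s" "choices s" "words s 24 0 = z" "z < n * n"
  shows "runs w table_entry s 60 (\<lambda>s'. words s' 12 = (words s 12)(z := table_word z) \<and>
    nums s' 2 = (nums s 2)(z := 1))"
proof -
  note zz = less_mult_div_mod[OF s(4)]
  have sel: "words s 10 (z div n) = sel (z div n)" "words s 10 (z mod n) = sel (z mod n)"
    "sel (z div n) < N * n" "sel (z mod n) < N * n" using s(2) zz by (auto simp: choices_def)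
  note u = less_mult_div_mod(2)[OF sel(4)] and t = less_mult_div_mod(1)[OF sel(3)]
  have zf: "z < 2 ^ w" using s(4) cap_V by linarith
  \<comment> \<open>The diagonal entry is 1 because \<open>ord i\<close> lies in its own bag.
    Entries with \<open>j < i\<close> are cleared since that bag may also contain eliminated
    vertices.\<close>
  have tw: "table_word z = (if z mod n < z div n then 0 else
      words s 5 (node (z div n) * n + ord (z mod n)))"
    using input_simps(6)[OF s(1) t u] zz ord_in_bag[OF zz(1)]
    by (auto simp: table_word_def later_nbrs_def)
  note fits = node_fits[OF sel(3)] node_fits[OF sel(4)] zf vert_fits[OF zz(1)] vert_fits[OF zz(2)]
    vert_fits[OF u] node_index_fits[OF t u] order_less_trans[OF t n_fits(3)]
  show ?thesis
    unfolding tw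
    by (rule runs_wp')
      (use fits t u in \<open>auto simp: table_entry_def input_simps[OF s(1)] s(3) sel not_less\<close>)
qed

lemma table_prog_runs:
  assumes s: "input s" "choices s"
  shows "runs w table_prog s (n * n * (m * 240 + 140) + 40) tables"
proof -
  let ?body = "table_entry;; For 22 nE edge_test"
  let ?pw = "\<lambda>z. pair_weight b (z div n) (z mod n)"
  define I where "I = (\<lambda>k (s :: 'a state). \<forall>z<k. words s 12 z = table_word z \<and> nums s 2 z = ?pw z)"
  have "runs w table_prog s (n * n * (60 + (m * (200 + 40) + 40) + 40) + 40) (I (n * n))"
    unfolding table_prog_def
  proof (rule runs_For)
    fix z s1 assume z: "z < n * n" and I: "I z s1" and z24: "words s1 24 0 = z"
      and fr: "frame (For 24 (nV [*] nV) ?body) s s1"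
    have in1: "input s1" by (rule input_frame[OF fr]) (use s in auto)
    have ch1: "choices s1" using s(2) frame_words[OF fr] by (simp add: choices_def)
    note 1 = table_entry_runs[OF in1 ch1 z24 z]
    have 2: "runs w (For 22 nE edge_test) s2 (m * (200 + 40) + 40) (I (Suc z))"
      if fr2: "frame table_entry s1 s2" and
        e: "words s2 12 = (words s1 12)(z := table_word z) \<and> nums s2 2 = (nums s1 2)(z := 1)" for s2
    proof -
      have in2: "input s2" by (rule input_frame[OF fr2]) (use in1 in auto)
      have ch2: "choices s2" using ch1 frame_words[OF fr2] by (simp add: choices_def)
      define P where "P = (\<lambda>e. joins G e (ord (z div n)) (ord (z mod n)))"
      define J where "J = (\<lambda>k (s :: 'a state). nums s 2 = (nums s1 2)(z := b ^ card {e. e < k \<and> P e}))"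
      have "runs w (For 22 nE edge_test) s2 (m * (200 + 40) + 40) (J m)"
      proof (rule runs_For)
        show "J 0 s2" using e by (simp add: J_def)
      next
        fix k s3 assume k: "k < m" and J: "J k s3" and k22: "words s3 22 0 = k"
          and fr3: "frame (For 22 nE edge_test) s2 s3"
        have in3: "input s3" by (rule input_frame[OF fr3]) (use in2 in auto)
        have ch3: "choices s3" using ch2 frame_words[OF fr3] by (simp add: choices_def)
        have z3: "words s3 24 0 = z" using z24 frame_words[OF fr2] frame_words[OF fr3] by simp
        have "{e. e < Suc k \<and> P e} = (if P k then insert k {e. e < k \<and> P e} else {e. e < k \<and> P e})"
          by (auto simp: less_Suc_eq)
        then have c: "card {e. e < Suc k \<and> P e} = (if P k then Suc (card {e. e < k \<and> P e})
            else card {e. e < k \<and> P e})" by simp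
        show "runs w edge_test s3 200 (J (Suc k))"
          by (rule runs_mono[OF edge_test_runs[OF in3 ch3 z3 k22 z k]])
            (use J c in \<open>auto simp: J_def P_def mult.commute\<close>)
      next
        fix s3 assume fr3: "frame (For 22 nE edge_test) s2 s3"
        have "input s3" by (rule input_frame[OF fr3]) (use in2 in auto)
        then show "wval nE s3 = m \<and> wfits w nE s3" by (simp add: input_simps)
      qed (auto simp: J_def)
      then show ?thesis
      proof (rule runs_mono)
        fix s3 assume fr3: "frame (For 22 nE edge_test) s2 s3" and J: "J m s3"
        have "{e. e < m \<and> P e} = {e \<in> edge_ids G. joins G e (ord (z div n)) (ord (z mod n))}"
          by (auto simp: P_def edge_ids_def)
        then have "nums s3 2 = (nums s1 2)(z := ?pw z)" using J by (simp add: J_def pair_weight_def)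
        moreover have "words s3 12 = (words s1 12)(z := table_word z)"
          using frame_words[OF fr3] e by simp
        ultimately show "I (Suc z) s3" using I by (auto simp: I_def less_Suc_eq)
      qed simp
    qed
    show "runs w ?body s1 (60 + (m * (200 + 40) + 40)) (I (Suc z))"
      by (rule runs_Seq[OF 1 2])
  next
    fix s' assume fr: "frame (For 24 (nV [*] nV) ?body) s s'"
    have "input s'" by (rule input_frame[OF fr]) (use s in auto)
    then show "wval (nV [*] nV) s' = n * n \<and> wfits w (nV [*] nV) s'" by (simp add: input_simps)
  qed (auto simp: I_def)
  then show ?thesis
  proof (rule runs_mono)
    fix s' assume I: "I (n * n) s'"
    show "tables s'"
      unfolding tables_def
    proof (intro allI impI)
      fix i j assume ij: "i < n" "j < n"
      have "i * n + j < n * n" by (rule row_major_less[OF ij])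
      then show "words s' 12 (i * n + j) = (if j = i \<or> j \<in> later_nbrs i then 1 else 0) \<and>
          nums s' 2 (i * n + j) = pair_weight b i j"
        using I ij by (simp add: I_def table_word_def)
    qed
  qed auto
qed

lemma tables_simps:
  assumes "tables s" "i < n" "j < n"
  shows "words s 12 (i * n + j) = (if j = i \<or> j \<in> later_nbrs i then 1 else 0)"
    "nums s 2 (i * n + j) = pair_weight b i j"
  using assms by (simp_all add: tables_def)

lemma tables_frame:
  "frame P s s' \<Longrightarrow> tables s \<Longrightarrow> 12 \<notin> word_targets P \<Longrightarrow> 2 \<notin> num_targets P \<Longrightarrow> tables s'"
  by (simp add: tables_def frame_words frame_nums)

text \<open>Stronger than \<open>fill_in\<close>: any two later neighbours of \<open>i\<close> are
  related, not just the least one to the others. Distinctness of slots needs every pair.\<close>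

lemma later_nbrs_clique:
  assumes i: "i < n" "j \<in> later_nbrs i" "l \<in> later_nbrs i" "j < l"
  shows "l \<in> later_nbrs j"
  using bag_remaining[of j l "node i"] node[OF i(1)] i by (auto simp: later_nbrs_def)

text \<open>A proper colouring, with \<open>t\<close> colours, of the chordal graph whose cliques
  are the sets \<open>insert i (later_nbrs i)\<close>. A Potts colouring of such a clique can then
  be encoded by a number below \<open>q ^ t\<close>.\<close>

definition proper_slots :: "(nat \<Rightarrow> nat) \<Rightarrow> nat \<Rightarrow> bool" where
  "proper_slots sl t \<longleftrightarrow> t \<le> width T bag + 1 \<and>
     (\<forall>i<n. sl i < t \<and> inj_on sl (insert i (later_nbrs i)))"

definition slots :: "(nat \<Rightarrow> nat) \<Rightarrow> nat \<Rightarrow> 'a state \<Rightarrow> bool" where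
  "slots sl t s \<longleftrightarrow> (\<forall>i<n. words s 13 i = q ^ sl i) \<and> words s 26 0 = q ^ t"

lemma slots_frame:
  "frame P s s' \<Longrightarrow> slots sl t s \<Longrightarrow> 13 \<notin> word_targets P \<Longrightarrow> 26 \<notin> word_targets P \<Longrightarrow> slots sl t s'"
  by (simp add: slots_def frame_words)

lemma power_fits: "t \<le> width T bag + 1 \<Longrightarrow> q ^ t < 2 ^ w"
proof -
  assume "t \<le> width T bag + 1"
  then have "q ^ t \<le> q ^ (width T bag + 1)" using q_ge by (intro power_increasing) auto
  then show ?thesis using cap_table by (simp add: add_mult_distrib)
qed

lemma q_power_eq_iff [simp]: "q ^ x = q ^ y \<longleftrightarrow> x = y"
  using q_ge by (simp add: power_inject_exp)

text \<open>A conjunction is evaluated in full on this machine, so array \<open>13\<close> must fit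
  into words at every position, not only at the later neighbours.\<close>

lemma slot_search_runs:
  assumes s: "input s" "tables s" "words s 20 0 = i" "words s 25 0 = q ^ x" "i < n"
    and x: "x \<le> width T bag"
    and sl: "\<forall>p\<in>later_nbrs i. words s 13 p = q ^ sl p" "\<forall>p<n. words s 13 p < 2 ^ w"
  shows "runs w (slot_search q) s (n * 100 + 100)
    (\<lambda>s'. words s' 25 0 = q ^ (if x \<in> sl ` later_nbrs i then Suc x else x))"
proof -
  let ?s = "set_word 23 0 0 s"
  have xf: "q ^ x < 2 ^ w" "q ^ x * q < 2 ^ w"
    using power_fits[of x] power_fits[of "Suc x"] x by (simp_all add: mult.commute)
  have 1: "runs w (assign 23 (WConst 0)) s 3 (\<lambda>s'. s' = ?s)"
    by (rule runs_wp') auto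
  have 2: "runs w (For 22 nV slot_used) ?s (n * (60 + 40) + 40)
     (\<lambda>s'. words s' 23 0 = (if \<exists>p<n. p \<in> later_nbrs i \<and> sl p = x then 1 else 0))"
  proof (rule runs_For[where N = n and
        I = "\<lambda>k s. words s 23 0 = (if \<exists>p<k. p \<in> later_nbrs i \<and> sl p = x then 1 else 0)"])
    fix p s1 assume p: "p < n" and 23: "words s1 23 0 = (if \<exists>p'<p. p' \<in> later_nbrs i \<and> sl p' = x then 1 else 0)"
      and 22: "words s1 22 0 = p" and fr: "frame (For 22 nV slot_used) ?s s1"
    have in1: "input s1" by (rule input_frame[OF fr]) (use s in auto)
    have t1: "tables s1" by (rule tables_frame[OF fr]) (use s in \<open>auto simp: tables_def\<close>)
    have e: "words s1 20 0 = i" "words s1 25 0 = q ^ x" "words s1 13 = words s 13"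
      using frame_words[OF fr] s by simp_all
    have c: "i < p \<and> 0 < words s1 12 (i * n + p) \<and> words s1 13 p = q ^ x \<longleftrightarrow>
        p \<in> later_nbrs i \<and> sl p = x"
      using tables_simps(1)[OF t1 s(5) p] e(3) sl by (auto simp: later_nbrs_def)
    have lf: "words s1 12 (i * n + p) < 2 ^ w" using tables_simps(1)[OF t1 s(5) p] by simp
    have "runs w slot_used s1 60 (\<lambda>s'. words s' 23 0 =
        (if p \<in> later_nbrs i \<and> sl p = x then 1 else words s1 23 0))"
      unfolding c[symmetric]
      by (rule runs_wp')
        (use vert_index_fits[OF s(5) p] vert_fits[OF s(5)] vert_fits[OF p] xf sl(2) p lf in
          \<open>auto simp: slot_used_def input_simps[OF in1] e 22\<close>)
    then show "runs w slot_used s1 60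
        (\<lambda>s'. words s' 23 0 = (if \<exists>p'<Suc p. p' \<in> later_nbrs i \<and> sl p' = x then 1 else 0))"
      by (rule runs_mono) (use 23 in \<open>auto simp: less_Suc_eq\<close>)
  next
    fix s1 assume fr: "frame (For 22 nV slot_used) ?s s1"
    have "input s1" by (rule input_frame[OF fr]) (use s in auto)
    then show "wval nV s1 = n \<and> wfits w nV s1" by (simp add: input_simps)
  qed auto
  have 3: "runs w (guarded (WConst 0 [<] reg 23) (assign 25 (reg 25 [*] WConst q))) s1 30
     (\<lambda>s'. words s' 25 0 = q ^ (if x \<in> sl ` later_nbrs i then Suc x else x))"
    if fr: "frame (For 22 nV slot_used) ?s s1"
      and 23: "words s1 23 0 = (if \<exists>p<n. p \<in> later_nbrs i \<and> sl p = x then 1 else 0)" for s1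
  proof -
    have 25: "words s1 25 0 = q ^ x" using frame_words[OF fr] s by simp
    have c: "(\<exists>p<n. p \<in> later_nbrs i \<and> sl p = x) \<longleftrightarrow> x \<in> sl ` later_nbrs i"
      by (auto simp: later_nbrs_def)
    show ?thesis
      by (rule runs_wp') (use xf 23 25 in \<open>auto simp: c mult.commute\<close>)
  qed
  have "runs w (slot_search q) s (3 + (n * (60 + 40) + 40 + 30))
     (\<lambda>s'. words s' 25 0 = q ^ (if x \<in> sl ` later_nbrs i then Suc x else x))"
    unfolding slot_search_def by (rule runs_Seq[OF 1], hypsubst, rule runs_Seq[OF 2 3])
  then show ?thesis by (rule runs_mono) (auto simp: algebra_simps)
qed

lemma slot_step_runs:
  assumes s: "input s" "tables s" "words s 27 0 = k" "k < n" "i = n - 1 - k"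
    and sl: "\<forall>p\<in>later_nbrs i. words s 13 p = q ^ sl p" "\<forall>p<n. words s 13 p < 2 ^ w"
    and t: "words s 26 0 = q ^ t" "t \<le> width T bag + 1"
  shows "runs w (slot_step q) s (n * (n * 100 + 140) + 140)
    (\<lambda>s'. \<exists>x. x \<le> width T bag \<and> x \<notin> sl ` later_nbrs i \<and> words s' 13 = (words s 13)(i := q ^ x) \<and>
      words s' 26 0 = q ^ max t (Suc x))"
proof -
  have i: "i < n" using s(4,5) by simp
  let ?S = "later_nbrs i"
  \<comment> \<open>All slots below \<open>x\<close> are blocked by later neighbours, so
    \<open>x\<close> is at most their number, hence at most the width and below
    \<open>n\<close>.\<close>
  have small: "x \<le> card ?S" if "{..<x} \<subseteq> sl ` ?S" for x
    using card_mono[OF _ that] card_image_le[of ?S sl] by simp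
  have ltn: "card ?S < n"
  proof -
    have "?S \<subseteq> {i<..<n}" by (auto simp: later_nbrs_def)
    then have "card ?S \<le> n - Suc i" using card_mono[of "{i<..<n}" ?S] by simp
    then show ?thesis using i by simp
  qed
  \<comment> \<open>Either \<open>x\<close> is already free, or every round so far has raised it;
    after \<open>n\<close> rounds the second alternative contradicts
    \<open>card ?S < n\<close>.\<close>
  define I where "I = (\<lambda>r (s :: 'a state). \<exists>x. words s 25 0 = q ^ x \<and> {..<x} \<subseteq> sl ` ?S \<and>
    (x \<notin> sl ` ?S \<or> r \<le> x))"
  let ?s = "set_word 25 0 1 (set_word 20 0 i s)"
  have 1: "runs w (assign 20 (nV [-] WConst 1 [-] reg 27);; assign 25 (WConst 1)) s 20 (\<lambda>s'. s' = ?s)"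
    by (rule runs_wp') (use i vert_fits[OF i] vert_fits[OF s(4)] s(4,5) in
      \<open>auto simp: input_simps[OF s(1)] s(3) intro: order_le_less_trans[OF diff_le_self]\<close>)
  have 2: "runs w (For 21 nV (slot_search q)) ?s (n * (n * 100 + 100 + 40) + 40) (I n)"
  proof (rule runs_For)
    show "I 0 ?s" by (auto simp: I_def intro!: exI[of _ 0])
  next
    fix r s1 assume r: "r < n" and I: "I r s1" and fr: "frame (For 21 nV (slot_search q)) ?s s1"
    obtain x where x: "words s1 25 0 = q ^ x" "{..<x} \<subseteq> sl ` ?S" "x \<notin> sl ` ?S \<or> r \<le> x"
      using I by (auto simp: I_def)
    have in1: "input s1" by (rule input_frame[OF fr]) (use s in auto)
    have t1: "tables s1" by (rule tables_frame[OF fr]) (use s in \<open>auto simp: tables_def\<close>)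
    have e: "words s1 20 0 = i" "words s1 13 = words s 13" using frame_words[OF fr] by simp_all
    have "x \<le> width T bag" using small[OF x(2)] card_later_nbrs[OF i] by linarith
    from slot_search_runs[OF in1 t1 e(1) x(1) i this, of sl] sl e(2)
    have "runs w (slot_search q) s1 (n * 100 + 100)
        (\<lambda>s'. words s' 25 0 = q ^ (if x \<in> sl ` ?S then Suc x else x))" by simp
    then show "runs w (slot_search q) s1 (n * 100 + 100) (I (Suc r))"
    proof (rule runs_mono)
      fix s' :: "'a state" assume s': "words s' 25 0 = q ^ (if x \<in> sl ` ?S then Suc x else x)"
      show "I (Suc r) s'"
        unfolding I_def
        by (rule exI[of _ "if x \<in> sl ` ?S then Suc x else x"])
          (use x s' in \<open>auto simp: lessThan_Suc\<close>)
    qed simp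
  next
    fix s1 assume fr: "frame (For 21 nV (slot_search q)) ?s s1"
    have "input s1" by (rule input_frame[OF fr]) (use s in auto)
    then show "wval nV s1 = n \<and> wfits w nV s1" by (simp add: input_simps)
  qed (auto simp: I_def)
  have 3: "runs w (WSet 13 (reg 20) (reg 25);;
      guarded (reg 26 [<] reg 25 [*] WConst q) (assign 26 (reg 25 [*] WConst q))) s1 60
     (\<lambda>s'. \<exists>x. x \<le> width T bag \<and> x \<notin> sl ` ?S \<and> words s' 13 = (words s 13)(i := q ^ x) \<and>
      words s' 26 0 = q ^ max t (Suc x))"
    if fr: "frame (For 21 nV (slot_search q)) ?s s1" and I: "I n s1" for s1
  proof -
    obtain x where x: "words s1 25 0 = q ^ x" "{..<x} \<subseteq> sl ` ?S" "x \<notin> sl ` ?S \<or> n \<le> x"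
      using I by (auto simp: I_def)
    have xk: "x \<le> width T bag" using small[OF x(2)] card_later_nbrs[OF i] by linarith
    have xn: "x \<notin> sl ` ?S" using small[OF x(2)] ltn x(3) by linarith
    have e: "words s1 20 0 = i" "words s1 13 = words s 13" "words s1 26 0 = q ^ t"
      using frame_words[OF fr] t by simp_all
    have xf: "q ^ x < 2 ^ w" "q ^ x * q < 2 ^ w" "q ^ t < 2 ^ w"
      using power_fits[of x] power_fits[of "Suc x"] power_fits[of t] xk t by (simp_all add: mult.commute)
    have lt: "q ^ t < q ^ x * q \<longleftrightarrow> t < Suc x"
      using q_ge power_strict_increasing_iff[of q t "Suc x"] by (simp add: mult.commute)
    show ?thesis
      by (rule runs_wp', simp add: e x(1) xf vert_fits[OF i] lt)
        (use xk xn in \<open>auto simp: max_def mult.commute intro!: exI[of _ x]\<close>)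
  qed
  have "runs w (slot_step q) s (20 + (n * (n * 100 + 100 + 40) + 40 + 60))
    (\<lambda>s'. \<exists>x. x \<le> width T bag \<and> x \<notin> sl ` ?S \<and> words s' 13 = (words s 13)(i := q ^ x) \<and>
      words s' 26 0 = q ^ max t (Suc x))"
    unfolding slot_step_def by (rule runs_Seq[OF 1], hypsubst, rule runs_Seq[OF 2 3])
  then show ?thesis by (rule runs_mono) (auto simp: algebra_simps)
qed

lemma slot_prog_runs:
  assumes s: "input s" "tables s" "\<forall>i<n. words s 13 i = 0"
  shows "runs w (slot_prog q) s (n * (n * (n * 100 + 140) + 180) + 60)
    (\<lambda>s'. \<exists>sl t. proper_slots sl t \<and> slots sl t s')"
proof -
  let ?s = "set_word 26 0 1 s"
  have 1: "runs w (assign 26 (WConst 1)) s 3 (\<lambda>s'. s' = ?s)"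
    by (rule runs_wp') auto
  \<comment> \<open>Positions below \<open>n - k\<close> have no slot yet; their zero entries are
    recorded so that these cells, too, are known to fit into a word.\<close>
  define I where "I = (\<lambda>k (s :: 'a state). \<exists>sl t. t \<le> width T bag + 1 \<and> words s 26 0 = q ^ t \<and>
    (\<forall>i<n. if i < n - k then words s 13 i = 0
      else words s 13 i = q ^ sl i \<and> sl i < t \<and> sl i \<notin> sl ` later_nbrs i))"
  have 2: "runs w (For 27 nV (slot_step q)) ?s (n * (n * (n * 100 + 140) + 140 + 40) + 40) (I n)"
  proof (rule runs_For)
    show "I 0 ?s" using s by (auto simp: I_def intro!: exI[of _ 0])
  next
    fix k s1 assume k: "k < n" and I: "I k s1" and 27: "words s1 27 0 = k"
      and fr: "frame (For 27 nV (slot_step q)) ?s s1"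
    define i where "i = n - 1 - k"
    obtain sl t where t: "t \<le> width T bag + 1" "words s1 26 0 = q ^ t"
      and sl: "\<And>j. j < n \<Longrightarrow> if j < n - k then words s1 13 j = 0
        else words s1 13 j = q ^ sl j \<and> sl j < t \<and> sl j \<notin> sl ` later_nbrs j"
      using I unfolding I_def by blast
    have i: "i < n" "n - k = Suc i" "n - Suc k = i" using k by (auto simp: i_def)
    have in1: "input s1" by (rule input_frame[OF fr]) (use s in auto)
    have t1: "tables s1" by (rule tables_frame[OF fr]) (use s in \<open>auto simp: tables_def\<close>)
    have a1: "\<forall>p\<in>later_nbrs i. words s1 13 p = q ^ sl p"
      using sl i(2) by (auto simp: later_nbrs_def split: if_splits)
    have a2: "\<forall>p<n. words s1 13 p < 2 ^ w"
    proof (intro allI impI)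
      fix p assume "p < n"
      then show "words s1 13 p < 2 ^ w"
        using sl[of p] t(1) power_fits[of "sl p"] by (auto split: if_splits)
    qed
    show "runs w (slot_step q) s1 (n * (n * 100 + 140) + 140) (I (Suc k))"
    proof (rule runs_mono[OF slot_step_runs[OF in1 t1 27 k i_def a1 a2 t(2,1)] order_refl])
      fix s2 :: "'a state" assume "\<exists>x. x \<le> width T bag \<and> x \<notin> sl ` later_nbrs i \<and>
        words s2 13 = (words s1 13)(i := q ^ x) \<and> words s2 26 0 = q ^ max t (Suc x)"
      then obtain x where x: "x \<le> width T bag" "x \<notin> sl ` later_nbrs i"
        "words s2 13 = (words s1 13)(i := q ^ x)" "words s2 26 0 = q ^ max t (Suc x)" by blast
      \<comment> \<open>Giving \<open>i\<close> its slot does not disturb positions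
        \<open>j \<ge> i\<close>, because \<open>i\<close> is a later neighbour of none of
        them.\<close>
      have im: "(sl(i := x)) ` later_nbrs j = sl ` later_nbrs j" if "i \<le> j" for j
        using that by (intro image_cong) (auto simp: later_nbrs_def)
      have *: "if j < n - Suc k then words s2 13 j = 0
        else words s2 13 j = q ^ (sl(i := x)) j \<and> (sl(i := x)) j < max t (Suc x) \<and>
          (sl(i := x)) j \<notin> (sl(i := x)) ` later_nbrs j" if j: "j < n" for j
      proof (cases "i \<le> j")
        case True
        then show ?thesis using sl[OF j] x im[OF True] i(2,3) by auto
      next
        case False
        then show ?thesis using sl[OF j] x i by auto
      qed
      then show "I (Suc k) s2"
        unfolding I_def
      proof (intro exI[of _ "sl(i := x)"] exI[of _ "max t (Suc x)"] conjI allI impI)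
        show "max t (Suc x) \<le> width T bag + 1" using x(1) t(1) by simp
      qed (rule x(4), rule *)
    qed
  next
    fix s1 assume fr: "frame (For 27 nV (slot_step q)) ?s s1"
    have "input s1" by (rule input_frame[OF fr]) (use s in auto)
    then show "wval nV s1 = n \<and> wfits w nV s1" by (simp add: input_simps)
  next
    show "I k (set_word 27 0 x s1)" if "I k s1" for k s1 x
    proof -
      have "words (set_word 27 0 x s1) 13 = words s1 13" "words (set_word 27 0 x s1) 26 = words s1 26"
        by simp_all
      then show ?thesis using that unfolding I_def by (simp only:)
    qed
  qed simp_all
  have fin: "\<exists>sl t. proper_slots sl t \<and> slots sl t s'" if I: "I n s'" for s'
  proof -
    obtain sl t where t: "t \<le> width T bag + 1" "words s' 26 0 = q ^ t"
      and sl: "\<And>j. j < n \<Longrightarrow> words s' 13 j = q ^ sl j \<and> sl j < t \<and> sl j \<notin> sl ` later_nbrs j"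
      using I unfolding I_def by auto
    \<comment> \<open>By the clique property, of two members of this set the larger is a later
      neighbour of the smaller, and the greedy choice separated exactly such pairs.\<close>
    have "inj_on sl (insert i (later_nbrs i))" if i: "i < n" for i
    proof (rule linorder_inj_onI')
      fix j l assume jl: "j \<in> insert i (later_nbrs i)" "l \<in> insert i (later_nbrs i)" "j < l"
      have j: "j < n" using jl i by (auto simp: later_nbrs_def)
      have "l \<in> later_nbrs j"
      proof (cases "j = i")
        case True
        then show ?thesis using jl by simp
      next
        case False
        then have "j \<in> later_nbrs i" using jl(1) by simp
        moreover have "l \<in> later_nbrs i" using jl(2,3) \<open>j \<in> later_nbrs i\<close> by (auto simp: later_nbrs_def)
        ultimately show ?thesis using later_nbrs_clique[OF i] jl(3) by blast
      qed
      with j show "sl j \<noteq> sl l" using sl[of j] by auto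
    qed
    then show ?thesis using t sl unfolding proper_slots_def slots_def by blast
  qed
  have "runs w (slot_prog q) s (3 + (n * (n * (n * 100 + 140) + 140 + 40) + 40)) (I n)"
    unfolding slot_prog_def by (rule runs_Seq[OF 1], hypsubst, rule 2)
  then show ?thesis by (rule runs_mono) (use fin in \<open>auto simp: algebra_simps\<close>)
qed

lemma next_nbr_eq_Min:
  assumes "i < n"
  shows "next_nbr n later_nbrs i = Min (insert n {j \<in> later_nbrs i. j < n})"
proof -
  have "{j \<in> later_nbrs i. j < n} = later_nbrs i" by (auto simp: later_nbrs_def)
  then show ?thesis by (simp add: next_nbr_def)
qed

lemma next_prog_runs:
  assumes s: "input s" "tables s"
  shows "runs w next_prog s (n * (n * 100 + 100) + 40)
    (\<lambda>s'. \<forall>i<n. words s' 15 i = next_nbr n later_nbrs i)"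
proof -
  let ?body = "WSet 15 (reg 20) nV;; For 22 nV next_test"
  define I where "I = (\<lambda>k (s :: 'a state). \<forall>i<k. words s 15 i = next_nbr n later_nbrs i)"
  have "runs w next_prog s (n * (10 + (n * (60 + 40) + 40) + 40) + 40) (I n)"
    unfolding next_prog_def
  proof (rule runs_For)
    fix i s1 assume i: "i < n" and I: "I i s1" and 20: "words s1 20 0 = i"
      and fr: "frame (For 20 nV ?body) s s1"
    have in1: "input s1" by (rule input_frame[OF fr]) (use s in auto)
    have t1: "tables s1" by (rule tables_frame[OF fr]) (use s in auto)
    let ?s = "set_word 15 i n s1"
    have 1: "runs w (WSet 15 (reg 20) nV) s1 10 (\<lambda>s'. s' = ?s)"
      by (rule runs_wp') (use vert_fits[OF i] in \<open>auto simp: input_simps[OF in1] 20\<close>)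
    define M where "M = (\<lambda>k. Min (insert n {j \<in> later_nbrs i. j < k}))"
    have "runs w (For 22 nV next_test) ?s (n * (60 + 40) + 40) (\<lambda>s'. words s' 15 = (words s1 15)(i := M n))"
    proof (rule runs_For[where N = n and I = "\<lambda>k s. words s 15 = (words s1 15)(i := M k)"])
      fix k s2 assume k: "k < n" and 15: "words s2 15 = (words s1 15)(i := M k)"
        and 22: "words s2 22 0 = k" and fr2: "frame (For 22 nV next_test) ?s s2"
      have in2: "input s2" by (rule input_frame[OF fr2]) (use in1 in auto)
      have t2: "tables s2" by (rule tables_frame[OF fr2]) (use t1 in \<open>auto simp: tables_def\<close>)
      have 202: "words s2 20 0 = i" using frame_words[OF fr2] 20 by simp
      have fin: "finite {j \<in> later_nbrs i. j < k}" by simp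
      have set: "{j \<in> later_nbrs i. j < Suc k} =
          (if k \<in> later_nbrs i then insert k {j \<in> later_nbrs i. j < k} else {j \<in> later_nbrs i. j < k})"
        by (auto simp: less_Suc_eq)
      have M: "M (Suc k) = (if k \<in> later_nbrs i then min k (M k) else M k)"
        unfolding M_def set using fin by (simp add: insert_commute[of n k])
      have Mn: "M k \<le> n" unfolding M_def using fin by (intro Min_le) auto
      have c: "i < k \<and> 0 < words s2 12 (i * n + k) \<longleftrightarrow> k \<in> later_nbrs i"
        using tables_simps(1)[OF t2 i k] by (auto simp: later_nbrs_def)
      have lf: "words s2 12 (i * n + k) < 2 ^ w" using tables_simps(1)[OF t2 i k] by simp
      have "runs w next_test s2 60 (\<lambda>s'. words s' 15 = (if (i < k \<and> 0 < words s2 12 (i * n + k)) \<and> k < M k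
          then (words s2 15)(i := k) else words s2 15))"
        by (rule runs_wp')
          (use vert_index_fits[OF i k] vert_fits[OF i] vert_fits[OF k] lf order_le_less_trans[OF Mn n_fits(1)] in
            \<open>auto simp: next_test_def input_simps[OF in2] 22 202 15\<close>)
      then show "runs w next_test s2 60 (\<lambda>s'. words s' 15 = (words s1 15)(i := M (Suc k)))"
        unfolding c by (rule runs_mono) (auto simp: 15 M min_def)
    next
      fix s2 assume fr2: "frame (For 22 nV next_test) ?s s2"
      have "input s2" by (rule input_frame[OF fr2]) (use in1 in auto)
      then show "wval nV s2 = n \<and> wfits w nV s2" by (simp add: input_simps)
    qed (auto simp: M_def)
    then have 2: "runs w (For 22 nV next_test) ?s (n * (60 + 40) + 40) (I (Suc i))"
      by (rule runs_mono) (use I i next_nbr_eq_Min in \<open>auto simp: I_def M_def less_Suc_eq\<close>)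
    show "runs w ?body s1 (10 + (n * (60 + 40) + 40)) (I (Suc i))"
      by (rule runs_Seq[OF 1], hypsubst, rule 2)
  next
    fix s1 assume fr: "frame (For 20 nV ?body) s s1"
    have "input s1" by (rule input_frame[OF fr]) (use s in auto)
    then show "wval nV s1 = n \<and> wfits w nV s1" by (simp add: input_simps)
  qed (auto simp: I_def)
  then show ?thesis by (rule runs_mono) (auto simp: I_def algebra_simps)
qed

end

section \<open>The dynamic program\<close>

text \<open>The message of a child \<open>p\<close> is read at the index in register
  \<open>30\<close> that encodes the current colouring, without translation between tables.\<close>

definition term_step :: "nat \<Rightarrow> com" where
  "term_step q = guarded (WConst 0 [<] WGet 12 (reg 20 [*] nV [+] reg 22) [and]
       weq (reg 30 [div] WGet 13 (reg 20) [mod] WConst q) (reg 30 [div] WGet 13 (reg 22) [mod] WConst q))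
     (NSet 4 (WConst 0) (NGet 4 (WConst 0) [.] NGet 2 (reg 20 [*] nV [+] reg 22)));;
   guarded (weq (WGet 15 (reg 22)) (reg 20))
     (NSet 4 (WConst 0) (NGet 4 (WConst 0) [.] NGet 3 (reg 22 [*] reg 26 [+] reg 30)))"

definition colour_step :: "nat \<Rightarrow> com" where
  "colour_step q =
     (assign 30 (reg 28 [-] (reg 28 [div] WGet 13 (reg 20) [mod] WConst q) [*] WGet 13 (reg 20)
        [+] reg 29 [*] WGet 13 (reg 20));;
      NSet 4 (WConst 0) (NConst 1));;
     For 22 nV (term_step q);;
     NSet 5 (WConst 0) (NOp NAdd (NGet 5 (WConst 0)) (NGet 4 (WConst 0)))"

definition entry_step :: "nat \<Rightarrow> com" where
  "entry_step q = NSet 5 (WConst 0) (NConst 0);; For 29 (WConst q) (colour_step q);;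
     NSet 3 (reg 20 [*] reg 26 [+] reg 28) (NGet 5 (WConst 0))"

definition message_prog :: "nat \<Rightarrow> com" where
  "message_prog q = For 20 nV (For 28 (reg 26) (entry_step q))"

definition root_test :: com where
  "root_test = guarded (weq (WGet 15 (reg 22)) nV)
     (NSet 1 (WConst 0) (NGet 1 (WConst 0) [.] NGet 3 (reg 22 [*] reg 26)))"

definition root_prog :: com where
  "root_prog = For 22 nV root_test"

lemma message_targets [simp]:
  "word_targets (term_step q) = {}" "num_targets (term_step q) = {4}"
  "word_targets (colour_step q) = {22, 30}" "num_targets (colour_step q) = {4, 5}"
  "word_targets (entry_step q) = {22, 29, 30}" "num_targets (entry_step q) = {3, 4, 5}"
  "word_targets (message_prog q) = {20, 22, 28, 29, 30}" "num_targets (message_prog q) = {3, 4, 5}"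
  "word_targets root_test = {}" "num_targets root_test = {1}"
  "word_targets root_prog = {22}" "num_targets root_prog = {1}"
  by (auto simp: term_step_def colour_step_def entry_step_def message_prog_def root_test_def root_prog_def)

locale slotted_machine = ordered_machine G T bag q w a b sel
  for G T bag q w and a b :: "'a::field_char_0" and sel +
  fixes sl :: "nat \<Rightarrow> nat" and t :: nat
  assumes proper: "proper_slots sl t"
begin

definition ready :: "'a state \<Rightarrow> bool" where
  "ready s \<longleftrightarrow> input s \<and> tables s \<and> slots sl t s \<and> (\<forall>i<n. words s 15 i = next_nbr n later_nbrs i)"

lemma ready_frame:
  assumes fr: "frame P s s'" and s: "ready s"
    and P: "word_targets P \<inter> {0, 1, 2, 5, 12, 13, 15, 26} = {}" "num_targets P \<inter> {0, 2} = {}"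
  shows "ready s'"
proof -
  have w: "words s' r = words s r" if "r \<in> {0, 1, 2, 5, 12, 13, 15, 26}" for r
    using frame_words[OF fr] P(1) that by blast
  have n: "nums s' r = nums s r" if "r \<in> {0, 2}" for r
    using frame_nums[OF fr] P(2) that by blast
  show ?thesis
    using s by (simp add: ready_def input_def tables_def slots_def w n)
qed

lemma ready_set_word [simp]:
  "r \<notin> {0, 1, 2, 5, 12, 13, 15, 26} \<Longrightarrow> ready (set_word r i x s) = ready s"
  by (simp add: ready_def input_def tables_def slots_def)

lemma ready_set_num [simp]: "r \<notin> {0, 2} \<Longrightarrow> ready (set_num r i x s) = ready s"
  by (simp add: ready_def input_def tables_def slots_def)

lemma ready_simps:
  assumes "ready s"
  shows "input s" "tables s" "i < n \<Longrightarrow> words s 13 i = q ^ sl i" "words s 26 0 = q ^ t"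
    "i < n \<Longrightarrow> words s 15 i = next_nbr n later_nbrs i"
  using assms by (auto simp: ready_def slots_def)

lemma slot_less: "i < n \<Longrightarrow> sl i < t"
  using proper by (simp add: proper_slots_def)

lemma slot_power: "i < n \<Longrightarrow> q ^ sl i * q \<le> q ^ t"
proof -
  assume "i < n"
  then have "q ^ Suc (sl i) \<le> q ^ t" using slot_less q_ge by (intro power_increasing) (auto simp: Suc_le_eq)
  then show ?thesis by (simp add: mult.commute)
qed

lemma slot_eq_iff: "i < n \<Longrightarrow> l \<in> insert i (later_nbrs i) \<Longrightarrow> sl l = sl i \<longleftrightarrow> l = i"
  using proper by (auto simp: proper_slots_def inj_on_def)

lemma table_size_fits: "q ^ t < 2 ^ w"
  using proper by (intro power_fits) (simp add: proper_slots_def)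

lemma table_index_fits:
  assumes "i < n" "x < q ^ t"
  shows "i * q ^ t + x < 2 ^ w \<and> i * q ^ t < 2 ^ w"
proof -
  have "i * q ^ t + x < n * q ^ t" by (rule row_major_less[OF assms])
  also have "\<dots> \<le> (n + 1) * q ^ (width T bag + 1)"
    using proper q_ge by (intro mult_mono power_increasing) (auto simp: proper_slots_def)
  finally show ?thesis using cap_table by linarith
qed

abbreviation "colours x \<equiv> (\<lambda>l. digit q (sl l) x)"
abbreviation "slot_message \<equiv> message n q later_nbrs (pair_weight b)"

text \<open>The contribution of one round of \<open>term_step\<close>. Neutral factors 1 let a
  single loop over all \<open>j < n\<close> serve both the local weight and the messages of the
  children.\<close>

definition message_factor :: "nat \<Rightarrow> nat \<Rightarrow> nat \<Rightarrow> 'a" where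
  "message_factor i y j =
     (if j \<in> insert i (later_nbrs i) \<and> colours y i = colours y j then pair_weight b i j else 1) *
     (if next_nbr n later_nbrs j = i then slot_message j (colours y) else 1)"

text \<open>Each table repeats its values over the digits that its message ignores; this redundancy
  makes every \<open>y\<close> below \<open>q ^ t\<close> a legal index.\<close>

definition messages :: "nat \<Rightarrow> 'a state \<Rightarrow> bool" where
  "messages i s \<longleftrightarrow> (\<forall>j<i. \<forall>y<q ^ t. nums s 3 (j * q ^ t + y) = slot_message j (colours y))"

lemma messages_frame: "frame P s s' \<Longrightarrow> messages i s \<Longrightarrow> 3 \<notin> num_targets P \<Longrightarrow> messages i s'"
  by (simp add: messages_def frame_nums)

lemma prod_message_factor:
  assumes i: "i < n"
  shows "(\<Prod>j<n. message_factor i y j) = local_weight later_nbrs (pair_weight b) i (colours y) *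
    (\<Prod>j\<in>{j. j < i \<and> next_nbr n later_nbrs j = i}. slot_message j (colours y))"
proof -
  have "(\<Prod>j<n. if j \<in> insert i (later_nbrs i) \<and> colours y i = colours y j then pair_weight b i j else 1) =
      local_weight later_nbrs (pair_weight b) i (colours y)"
    unfolding local_weight_def
    by (rule prod.mono_neutral_cong_right) (use i in \<open>auto simp: later_nbrs_def\<close>)
  moreover have "(\<Prod>j<n. if next_nbr n later_nbrs j = i then slot_message j (colours y) else 1) =
      (\<Prod>j\<in>{j. j < i \<and> next_nbr n later_nbrs j = i}. slot_message j (colours y))"
  proof (rule prod.mono_neutral_cong_right)
    have "j < i" if "j < n" "next_nbr n later_nbrs j = i" for j
      using order.par_gt[OF that(1)] that(2) by simp
    then show "\<forall>j\<in>{..<n} - {j. j < i \<and> next_nbr n later_nbrs j = i}.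
        (if next_nbr n later_nbrs j = i then slot_message j (colours y) else 1) = 1" by auto
  qed (use i in auto)
  ultimately show ?thesis by (simp add: message_factor_def prod.distrib)
qed

text \<open>On \<open>insert i (later_nbrs i)\<close> slots are distinct, so there
  \<open>set_digit\<close> changes the colour of \<open>i\<close> alone. Elsewhere positions may
  share the slot and change too, which \<open>message_rec\<close> tolerates.\<close>

lemma message_eq_sum:
  assumes i: "i < n"
  shows "slot_message i (colours x) = (\<Sum>c<q. \<Prod>j<n. message_factor i (set_digit q (sl i) c x) j)"
proof -
  have "colours (set_digit q (sl i) c x) l = ((colours x)(i := c)) l"
    if "c < q" "l \<in> insert i (later_nbrs i)" for c l
    using slot_eq_iff[OF i that(2)] that(1) by (simp add: digit_set_digit)
  from order.message_rec[OF i this] show ?thesis by (simp add: prod_message_factor[OF i])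
qed

lemma term_step_runs:
  assumes s: "ready s" "messages i s" "words s 20 0 = i" "words s 22 0 = p" "words s 30 0 = y"
    and b: "i < n" "p < n" "y < q ^ t"
  shows "runs w (term_step q) s 150 (\<lambda>s'. nums s' 4 0 = nums s 4 0 * message_factor i y p)"
proof -
  note r = ready_simps[OF s(1)]
  \<comment> \<open>A child precedes its parent in the order, so its table is already complete when
    it is read.\<close>
  have par: "next_nbr n later_nbrs p = i \<Longrightarrow> p < i" using order.par_gt[OF b(2)] by simp
  have parf: "next_nbr n later_nbrs p < 2 ^ w"
  proof -
    have "next_nbr n later_nbrs p \<le> n" by (simp add: next_nbr_def)
    then show ?thesis using n_fits(1) by (rule order_le_less_trans)
  qed
  have sp: "q ^ sl l < 2 ^ w" if "l < n" for l
    using slot_less[OF that] proper by (intro power_fits) (simp add: proper_slots_def)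
  have yf: "y < 2 ^ w" using b(3) table_size_fits by linarith
  have "z' mod q < q" for z' using q_ge by simp
  then have yd: "y div z < 2 ^ w" "z' mod q < 2 ^ w" for z z'
    using le_less_trans[OF div_le_dividend yf] order_less_trans const_fits(4) by blast+
  have m: "next_nbr n later_nbrs p = i \<Longrightarrow> nums s 3 (p * q ^ t + y) = slot_message p (colours y)"
    using s(2) par b by (simp add: messages_def)
  show ?thesis
    by (rule runs_wp', simp add: term_step_def input_simps[OF r(1)] r(3,4,5) s(3,4,5) b
        tables_simps[OF r(2) b(1,2)] vert_index_fits[OF b(1,2)] vert_fits b yf yd sp parf
        table_size_fits table_index_fits[OF b(2,3)] m message_factor_def digit_def mult.assoc)
      (simp add: term_step_def)
qed

lemma colour_step_runs:
  assumes s: "ready s" "messages i s" "words s 20 0 = i" "words s 28 0 = x" "words s 29 0 = c"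
    and b: "i < n" "x < q ^ t" "c < q"
  shows "runs w (colour_step q) s (n * 190 + 150)
    (\<lambda>s'. nums s' 5 0 = nums s 5 0 + (\<Prod>j<n. message_factor i (set_digit q (sl i) c x) j))"
proof -
  note r = ready_simps[OF s(1)]
  define y where "y = set_digit q (sl i) c x"
  have y: "y < q ^ t" unfolding y_def using q_ge b slot_less by (intro set_digit_less) auto
  let ?s = "set_num 4 0 1 (set_word 30 0 y s)"
  have sp: "q ^ sl i < 2 ^ w"
    using slot_less[OF b(1)] proper by (intro power_fits) (simp add: proper_slots_def)
  have xf: "x < 2 ^ w" "c < 2 ^ w" "y < 2 ^ w"
    using b y table_size_fits const_fits(4) by linarith+
  have small: "d * q ^ sl i < 2 ^ w" if "d < q" for d
  proof -
    have "d * q ^ sl i \<le> q * q ^ sl i" using that by (intro mult_right_mono) auto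
    also have "\<dots> \<le> q ^ t" using slot_power[OF b(1)] by (simp add: mult.commute)
    finally show ?thesis using table_size_fits by linarith
  qed
  have d: "x div q ^ sl i mod q < q" using q_ge by simp
  have df: "x div q ^ sl i < 2 ^ w" "x div q ^ sl i mod q < 2 ^ w" "x - z < 2 ^ w" for z
    using xf(1) div_le_dividend[of x "q ^ sl i"] d const_fits(4) by linarith+
  have 1: "runs w (assign 30 (reg 28 [-] (reg 28 [div] WGet 13 (reg 20) [mod] WConst q) [*] WGet 13 (reg 20)
        [+] reg 29 [*] WGet 13 (reg 20));; NSet 4 (WConst 0) (NConst 1)) s 60 (\<lambda>s'. s' = ?s)"
    by (rule runs_wp', simp add: r(3)[OF b(1)] s(3,4,5) sp xf df small[OF b(3)] small[OF d] vert_fits[OF b(1)])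
      (use xf(3) in \<open>simp_all add: y_def set_digit_def digit_def\<close>)
  have 2: "runs w (For 22 nV (term_step q)) ?s (n * (150 + 40) + 40)
     (\<lambda>s'. nums s' 4 0 = (\<Prod>j<n. message_factor i y j))"
  proof (rule runs_For[where N = n and I = "\<lambda>k s. nums s 4 0 = (\<Prod>j<k. message_factor i y j)"])
    fix p s1 assume p: "p < n" and 4: "nums s1 4 0 = (\<Prod>j<p. message_factor i y j)"
      and 22: "words s1 22 0 = p" and fr: "frame (For 22 nV (term_step q)) ?s s1"
    have r1: "ready s1" by (rule ready_frame[OF fr]) (use s in auto)
    have m1: "messages i s1" by (rule messages_frame[OF fr]) (use s in \<open>auto simp: messages_def\<close>)
    have e: "words s1 20 0 = i" "words s1 30 0 = y" using frame_words[OF fr] s by simp_all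
    show "runs w (term_step q) s1 150 (\<lambda>s'. nums s' 4 0 = (\<Prod>j<Suc p. message_factor i y j))"
      by (rule runs_mono[OF term_step_runs[OF r1 m1 e(1) 22 e(2) b(1) p y]]) (simp_all add: 4)
  next
    fix s1 assume fr: "frame (For 22 nV (term_step q)) ?s s1"
    have "ready s1" by (rule ready_frame[OF fr]) (use s in auto)
    then show "wval nV s1 = n \<and> wfits w nV s1" using input_simps ready_simps(1) by simp
  qed auto
  have 3: "runs w (NSet 5 (WConst 0) (NOp NAdd (NGet 5 (WConst 0)) (NGet 4 (WConst 0)))) s1 20
     (\<lambda>s'. nums s' 5 0 = nums s 5 0 + (\<Prod>j<n. message_factor i y j))"
    if fr: "frame (For 22 nV (term_step q)) ?s s1" and 4: "nums s1 4 0 = (\<Prod>j<n. message_factor i y j)" for s1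
    by (rule runs_wp') (use frame_nums[OF fr, of 5] 4 in auto)
  have "runs w (colour_step q) s (60 + (n * (150 + 40) + 40 + 20))
    (\<lambda>s'. nums s' 5 0 = nums s 5 0 + (\<Prod>j<n. message_factor i y j))"
    unfolding colour_step_def by (rule runs_Seq[OF 1], hypsubst, rule runs_Seq[OF 2 3])
  then show ?thesis unfolding y_def by (rule runs_mono) (auto simp: algebra_simps)
qed

lemma entry_step_runs:
  assumes s: "ready s" "messages i s" "words s 20 0 = i" "words s 28 0 = x"
    and b: "i < n" "x < q ^ t"
  shows "runs w (entry_step q) s (q * (n * 190 + 190) + 100)
    (\<lambda>s'. nums s' 3 = (nums s 3)(i * q ^ t + x := slot_message i (colours x)))"
proof -
  let ?f = "\<lambda>c. \<Prod>j<n. message_factor i (set_digit q (sl i) c x) j"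
  let ?s = "set_num 5 0 0 s"
  have 1: "runs w (NSet 5 (WConst 0) (NConst 0)) s 10 (\<lambda>s'. s' = ?s)"
    by (rule runs_wp') auto
  have 2: "runs w (For 29 (WConst q) (colour_step q)) ?s (q * (n * 190 + 150 + 40) + 40)
     (\<lambda>s'. nums s' 5 0 = (\<Sum>c<q. ?f c))"
  proof (rule runs_For[where N = q and I = "\<lambda>k s. nums s 5 0 = (\<Sum>c<k. ?f c)"])
    fix c s1 assume c: "c < q" and 5: "nums s1 5 0 = (\<Sum>c<c. ?f c)"
      and 29: "words s1 29 0 = c" and fr: "frame (For 29 (WConst q) (colour_step q)) ?s s1"
    have r1: "ready s1" by (rule ready_frame[OF fr]) (use s in auto)
    have m1: "messages i s1" by (rule messages_frame[OF fr]) (use s in \<open>auto simp: messages_def\<close>)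
    have e: "words s1 20 0 = i" "words s1 28 0 = x" using frame_words[OF fr] s by simp_all
    show "runs w (colour_step q) s1 (n * 190 + 150) (\<lambda>s'. nums s' 5 0 = (\<Sum>c<Suc c. ?f c))"
      by (rule runs_mono[OF colour_step_runs[OF r1 m1 e 29 b c]]) (simp_all add: 5)
  qed auto
  have 3: "runs w (NSet 3 (reg 20 [*] reg 26 [+] reg 28) (NGet 5 (WConst 0))) s1 20
     (\<lambda>s'. nums s' 3 = (nums s 3)(i * q ^ t + x := slot_message i (colours x)))"
    if fr: "frame (For 29 (WConst q) (colour_step q)) ?s s1" and 5: "nums s1 5 0 = (\<Sum>c<q. ?f c)" for s1
  proof -
    have r1: "ready s1" by (rule ready_frame[OF fr]) (use s in auto)
    have e: "words s1 20 0 = i" "words s1 28 0 = x" "nums s1 3 = nums s 3"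
      using frame_words[OF fr] frame_nums[OF fr] s by simp_all
    have "x < 2 ^ w" using b table_size_fits by linarith
    then show ?thesis
      by (intro runs_wp') (use table_index_fits[OF b] table_size_fits vert_fits[OF b(1)] in
        \<open>auto simp: e 5 ready_simps(4)[OF r1] message_eq_sum[OF b(1)]\<close>)
  qed
  have "runs w (entry_step q) s (10 + (q * (n * 190 + 150 + 40) + 40 + 20))
    (\<lambda>s'. nums s' 3 = (nums s 3)(i * q ^ t + x := slot_message i (colours x)))"
    unfolding entry_step_def by (rule runs_Seq[OF 1], hypsubst, rule runs_Seq[OF 2 3])
  then show ?thesis by (rule runs_mono) (auto simp: algebra_simps)
qed

lemma message_prog_runs:
  assumes s: "ready s"
  shows "runs w (message_prog q) s (n * (q ^ t * (q * (n * 190 + 190) + 140) + 80) + 40) (messages n)"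
proof -
  let ?row = "For 28 (reg 26) (entry_step q)"
  have "runs w (message_prog q) s (n * (q ^ t * (q * (n * 190 + 190) + 100 + 40) + 40 + 40) + 40) (messages n)"
    unfolding message_prog_def
  proof (rule runs_For[where N = n and I = messages])
    fix i s1 assume i: "i < n" and m: "messages i s1" and 20: "words s1 20 0 = i"
      and fr: "frame (For 20 nV ?row) s s1"
    have r1: "ready s1" by (rule ready_frame[OF fr]) (use s in auto)
    define J where "J = (\<lambda>k s. messages i s \<and> (\<forall>x<k. nums s 3 (i * q ^ t + x) = slot_message i (colours x)))"
    have "runs w ?row s1 (q ^ t * (q * (n * 190 + 190) + 100 + 40) + 40) (J (q ^ t))"
    proof (rule runs_For)
      show "J 0 s1" using m by (simp add: J_def)
    next
      fix x s2 assume x: "x < q ^ t" and J: "J x s2" and 28: "words s2 28 0 = x"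
        and fr2: "frame ?row s1 s2"
      have r2: "ready s2" by (rule ready_frame[OF fr2]) (use r1 in auto)
      have m2: "messages i s2" using J by (simp add: J_def)
      have 202: "words s2 20 0 = i" using frame_words[OF fr2] 20 by simp
      \<comment> \<open>Row-major indices from different rows never coincide, so writing in row
        \<open>i\<close> leaves the finished rows intact.\<close>
      show "runs w (entry_step q) s2 (q * (n * 190 + 190) + 100) (J (Suc x))"
        by (rule runs_mono[OF entry_step_runs[OF r2 m2 202 28 i x]])
          (use J x in \<open>auto simp: J_def messages_def row_major_eq_iff less_Suc_eq\<close>)
    next
      fix s2 assume fr2: "frame ?row s1 s2"
      have "ready s2" by (rule ready_frame[OF fr2]) (use r1 in auto)
      then show "wval (reg 26) s2 = q ^ t \<and> wfits w (reg 26) s2"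
        using ready_simps(4) table_size_fits by simp
    qed (use table_size_fits in \<open>auto simp: J_def messages_def\<close>)
    then show "runs w ?row s1 (q ^ t * (q * (n * 190 + 190) + 100 + 40) + 40) (messages (Suc i))"
      by (rule runs_mono) (auto simp: J_def messages_def less_Suc_eq)
  next
    fix s1 assume fr: "frame (For 20 nV ?row) s s1"
    have "ready s1" by (rule ready_frame[OF fr]) (use s in auto)
    then show "wval nV s1 = n \<and> wfits w nV s1" using input_simps ready_simps(1) by simp
  qed (auto simp: messages_def)
  then show ?thesis by (rule runs_mono) (auto simp: algebra_simps)
qed

text \<open>The message of a root is constant, so entry \<open>0\<close> of its table serves; by
  \<open>elimination_total\<close> the product over the roots is the whole partition
  function.\<close>

lemma root_prog_runs:
  assumes s: "ready s" "messages n s"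
  shows "runs w root_prog s (n * 100 + 40) (\<lambda>s'. nums s' 1 0 = nums s 1 0 * potts G q b)"
proof -
  let ?f = "\<lambda>p. if next_nbr n later_nbrs p = n then slot_message p (colours 0) else 1"
  have "runs w root_prog s (n * (60 + 40) + 40) (\<lambda>s'. nums s' 1 0 = nums s 1 0 * (\<Prod>p<n. ?f p))"
    unfolding root_prog_def
  proof (rule runs_For[where N = n and I = "\<lambda>k s'. nums s' 1 0 = nums s 1 0 * (\<Prod>p<k. ?f p)"])
    fix p s1 assume p: "p < n" and 1: "nums s1 1 0 = nums s 1 0 * (\<Prod>p<p. ?f p)"
      and 22: "words s1 22 0 = p" and fr: "frame (For 22 nV root_test) s s1"
    have r1: "ready s1" by (rule ready_frame[OF fr]) (use s in auto)
    have m1: "messages n s1" by (rule messages_frame[OF fr]) (use s in auto)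
    have "0 < q ^ t" using q_ge by simp
    then have F: "nums s1 3 (p * q ^ t) = slot_message p (colours 0)"
      using m1 p unfolding messages_def by (metis add.right_neutral)
    have "next_nbr n later_nbrs p \<le> n" by (simp add: next_nbr_def)
    then have parf: "next_nbr n later_nbrs p < 2 ^ w" using n_fits(1) by (rule order_le_less_trans)
    note r = ready_simps[OF r1]
    show "runs w root_test s1 60 (\<lambda>s'. nums s' 1 0 = nums s 1 0 * (\<Prod>p<Suc p. ?f p))"
      by (rule runs_wp', simp add: root_test_def 22 r(4) r(5)[OF p] input_simps[OF r(1)] F 1[unfolded One_nat_def] vert_fits[OF p]
          parf table_size_fits table_index_fits[OF p \<open>0 < q ^ t\<close>, THEN conjunct2] mult.assoc)
        (simp add: root_test_def)
  next
    fix s1 assume fr: "frame (For 22 nV root_test) s s1"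
    have "ready s1" by (rule ready_frame[OF fr]) (use s in auto)
    then show "wval nV s1 = n \<and> wfits w nV s1" using input_simps ready_simps(1) by simp
  qed auto
  moreover have "(\<Prod>p<n. ?f p) = (\<Prod>p\<in>{p. p < n \<and> next_nbr n later_nbrs p = n}. slot_message p (colours 0))"
    by (rule prod.mono_neutral_cong_right) auto
  then have "(\<Prod>p<n. ?f p) = potts G q b"
    by (simp only: order.potts_eq_local_weights) (rule order.elimination_total[symmetric])
  ultimately show ?thesis by simp
qed

end

section \<open>Components and the running time\<close>

definition relabel :: com where
  "relabel = guarded (weq (WGet 14 (reg 22)) (reg 31)) (WSet 14 (reg 22) (reg 32))"

text \<open>Every edge that joins two different labels contributes a factor \<open>a - 1\<close>.
  There are \<open>n - k(E)\<close> such edges, so the power arises without the number of components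
  being known in advance. The labels are copied to registers because the relabelling loop overwrites
  them.\<close>

definition merge_step :: com where
  "merge_step =
     (assign 31 (WGet 14 (WGet 1 (reg 21)));; assign 32 (WGet 14 (WGet 2 (reg 21)));;
      Cond (weq (reg 31) (reg 32)) Skip
        (NSet 1 (WConst 0) (NGet 1 (WConst 0) [.] NOp NSub (NGet 0 (WConst 0)) (NConst 1))));;
     For 22 nV relabel"

definition init_label :: "nat \<Rightarrow> com" where
  "init_label q = WSet 14 (reg 22) (reg 22);;
     NSet 1 (WConst 0) (NOp NDiv (NGet 1 (WConst 0)) (NConst (int q)))"

definition component_prog :: "nat \<Rightarrow> com" where
  "component_prog q = NSet 1 (WConst 0) (NConst 1);; For 22 nV (init_label q);; For 21 nE merge_step"

text \<open>\<open>component_prog\<close> leaves the prefactor in the result cell, and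
  \<open>root_prog\<close> multiplies the partition function onto it.\<close>

definition tutte_prog :: "nat \<Rightarrow> com" where
  "tutte_prog q = order_prog;; table_prog;; slot_prog q;; next_prog;; message_prog q;;
     component_prog q;; root_prog"

lemma component_targets [simp]:
  "word_targets relabel = {14}" "num_targets relabel = {}"
  "word_targets merge_step = {14, 22, 31, 32}" "num_targets merge_step = {1}"
  "word_targets (init_label q) = {14}" "num_targets (init_label q) = {1}"
  "word_targets (component_prog q) = {14, 21, 22, 31, 32}" "num_targets (component_prog q) = {1}"
  by (auto simp: relabel_def merge_step_def init_label_def component_prog_def)

lemma component_labelling_cong:
  "component_labelling G A L \<Longrightarrow> \<forall>v\<in>verts G. L' v = L v \<Longrightarrow> component_labelling G A L'"
  by (simp add: component_labelling_def)

context tutte_machine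
begin

definition labelled :: "nat \<Rightarrow> 'a state \<Rightarrow> bool" where
  "labelled k s \<longleftrightarrow> component_labelling G {..<k} (words s 14) \<and> (\<forall>v<n. words s 14 v < n) \<and>
     nums s 1 0 = (a - 1) ^ (n - card (words s 14 ` verts G)) / of_nat q ^ n"

lemma merge_step_runs:
  assumes s: "input s" "labelled e s" "words s 21 0 = e" "e < m"
  shows "runs w merge_step s (n * 100 + 100) (labelled (Suc e))"
proof -
  define u where "u = fst (edges G ! e)"
  define v where "v = snd (edges G ! e)"
  let ?L = "words s 14"
  have e: "e \<in> edge_ids G" "joins G e u v" "{..<e} \<subseteq> edge_ids G" "{..<Suc e} = insert e {..<e}"
    using s(4) by (auto simp: edge_ids_def u_def v_def joins_def)
  have uv: "u < n" "v < n" using joins_verts[OF wf e(1,2)] by (auto simp: verts_eq)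
  have L: "component_labelling G {..<e} ?L" "\<And>x. x < n \<Longrightarrow> ?L x < n"
    and acc: "nums s 1 0 = (a - 1) ^ (n - card (?L ` verts G)) / of_nat q ^ n"
    using s(2) by (auto simp: labelled_def)
  let ?c = "nums s 1 0 * (if ?L u = ?L v then 1 else a - 1)"
  let ?s = "set_word 32 0 (?L v) (set_word 31 0 (?L u) s)"
  let ?s' = "if ?L u = ?L v then ?s else set_num 1 0 ?c ?s"
  have ef: "e < 2 ^ w" using s(4) cap_E by linarith
  have 1: "runs w (assign 31 (WGet 14 (WGet 1 (reg 21)));; assign 32 (WGet 14 (WGet 2 (reg 21)));;
      Cond (weq (reg 31) (reg 32)) Skip
        (NSet 1 (WConst 0) (NGet 1 (WConst 0) [.] NOp NSub (NGet 0 (WConst 0)) (NConst 1)))) s 60 (\<lambda>s'. s' = ?s')"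
    by (rule runs_wp', simp add: input_simps[OF s(1)] s(3,4) ef u_def[symmetric] v_def[symmetric]
        vert_fits uv vert_fits[OF L(2)]) simp
  define M where "M = merge_labels ?L u v"
  have 2: "runs w (For 22 nV relabel) ?s' (n * (40 + 40) + 40)
    (\<lambda>s1. \<forall>x<n. words s1 14 x = (if x < n then M x else ?L x))"
  proof (rule runs_For[where N = n and I = "\<lambda>k s1. \<forall>x<n. words s1 14 x = (if x < k then M x else ?L x)"])
    fix k s1 assume k: "k < n" and I: "\<forall>x<n. words s1 14 x = (if x < k then M x else ?L x)"
      and 22: "words s1 22 0 = k" and fr: "frame (For 22 nV relabel) ?s' s1"
    have e: "words s1 31 0 = ?L u" "words s1 32 0 = ?L v" using frame_words[OF fr] by simp_all
    have "words s1 14 k = ?L k" using I k by simp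
    then show "runs w relabel s1 40 (\<lambda>s1. \<forall>x<n. words s1 14 x = (if x < Suc k then M x else ?L x))"
      by (intro runs_wp') (use I in \<open>auto simp: relabel_def 22 e vert_fits[OF k] vert_fits[OF L(2)] k uv
        M_def merge_labels_def less_Suc_eq\<close>)
  next
    fix s1 assume fr: "frame (For 22 nV relabel) ?s' s1"
    have "input s1" by (rule input_frame[OF fr]) (use s in auto)
    then show "wval nV s1 = n \<and> wfits w nV s1" by (simp add: input_simps)
  qed auto
  have fin: "labelled (Suc e) s1"
    if fr: "frame (For 22 nV relabel) ?s' s1" and M: "\<forall>x<n. words s1 14 x = (if x < n then M x else ?L x)"
    for s1
  proof -
    have M': "\<forall>x\<in>verts G. words s1 14 x = M x" using M by (simp add: verts_eq)
    have im: "words s1 14 ` verts G = M ` verts G" using M' by (intro image_cong) auto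
    have "component_labelling G {..<Suc e} M"
      unfolding M_def e(4) by (rule component_labelling_insert[OF wf L(1) e(3,1,2)])
    then have lab: "component_labelling G {..<Suc e} (words s1 14)"
      using M' by (rule component_labelling_cong)
    have less: "\<forall>x<n. words s1 14 x < n"
      using M L(2) uv by (auto simp: M_def merge_labels_def)
    have "nums s1 1 0 = ?c" using frame_nums[OF fr, of 1] by auto
    \<comment> \<open>Merging two labels lowers their number by one and so raises the exponent of
      \<open>a - 1\<close> by one; the bound by \<open>n\<close> below keeps the difference
      exact.\<close>
    moreover have "card (?L ` verts G) = card (M ` verts G) + (if ?L u = ?L v then 0 else 1)"
      unfolding M_def using uv by (intro card_merge_labels) (auto simp: verts_eq)
    moreover have "card (?L ` verts G) \<le> n"
      using card_image_le[of "verts G" ?L] by (simp add: verts_eq)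
    ultimately have "nums s1 1 0 = (a - 1) ^ (n - card (M ` verts G)) / of_nat q ^ n"
      unfolding acc by (cases "?L u = ?L v") (simp_all add: Suc_diff_Suc[symmetric] Suc_diff_le)
    with lab less im show ?thesis by (simp add: labelled_def)
  qed
  have "runs w merge_step s (60 + (n * (40 + 40) + 40)) (\<lambda>s1. labelled (Suc e) s1)"
    unfolding merge_step_def
    by (rule runs_Seq[OF 1], hypsubst, rule runs_mono[OF 2 order_refl fin])
  then show ?thesis by (rule runs_mono) auto
qed

lemma component_prog_runs:
  assumes s: "input s"
  shows "runs w (component_prog q) s (n * 100 + m * (n * 100 + 140) + 100)
    (\<lambda>s'. nums s' 1 0 = (a - 1) ^ (n - num_components G (edge_ids G)) / of_nat q ^ n)"
proof -
  let ?s = "set_num 1 0 1 s"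
  have 1: "runs w (NSet 1 (WConst 0) (NConst 1)) s 10 (\<lambda>s'. s' = ?s)"
    by (rule runs_wp') auto
  have 2: "runs w (For 22 nV (init_label q)) ?s (n * (40 + 40) + 40)
    (\<lambda>s1. (\<forall>v<n. words s1 14 v = v) \<and> nums s1 1 0 = 1 / of_nat q ^ n)"
  proof (rule runs_For[where N = n and
        I = "\<lambda>k s1. (\<forall>v<k. words s1 14 v = v) \<and> nums s1 1 0 = 1 / of_nat q ^ k"])
    fix k s1 assume k: "k < n" and I: "(\<forall>v<k. words s1 14 v = v) \<and> nums s1 1 0 = 1 / of_nat q ^ k"
      and 22: "words s1 22 0 = k" and fr: "frame (For 22 nV (init_label q)) ?s s1"
    show "runs w (init_label q) s1 40 (\<lambda>s1. (\<forall>v<Suc k. words s1 14 v = v) \<and> nums s1 1 0 = 1 / of_nat q ^ Suc k)"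
      by (rule runs_wp') (use I in \<open>auto simp: init_label_def 22 vert_fits[OF k] less_Suc_eq mult.commute\<close>)
  next
    fix s1 assume fr: "frame (For 22 nV (init_label q)) ?s s1"
    have "input s1" by (rule input_frame[OF fr]) (use s in auto)
    then show "wval nV s1 = n \<and> wfits w nV s1" by (simp add: input_simps)
  qed auto
  have 3: "runs w (For 21 nE merge_step) s1 (m * (n * 100 + 100 + 40) + 40) (labelled m)"
    if fr: "frame (For 22 nV (init_label q)) ?s s1"
      and I: "(\<forall>v<n. words s1 14 v = v) \<and> nums s1 1 0 = 1 / of_nat q ^ n" for s1
  proof -
    have in1: "input s1" by (rule input_frame[OF fr]) (use s in auto)
    show ?thesis
    proof (rule runs_For[where N = m and I = labelled])
      have "component_labelling G {} (words s1 14)"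
        by (rule component_labelling_cong[OF component_labelling_empty]) (use I in \<open>simp add: verts_eq\<close>)
      moreover have "words s1 14 ` verts G = verts G"
        using I image_cong[of "verts G" "verts G" "words s1 14" "\<lambda>x. x"] by (simp add: verts_eq)
      ultimately show "labelled 0 s1" using I by (simp add: labelled_def) (simp add: verts_eq)
    next
      fix e s2 assume e: "e < m" and l: "labelled e s2" and 21: "words s2 21 0 = e"
        and fr2: "frame (For 21 nE merge_step) s1 s2"
      have "input s2" by (rule input_frame[OF fr2]) (use in1 in auto)
      then show "runs w merge_step s2 (n * 100 + 100) (labelled (Suc e))"
        by (rule merge_step_runs[OF _ l 21 e])
    next
      fix s2 assume fr2: "frame (For 21 nE merge_step) s1 s2"
      have "input s2" by (rule input_frame[OF fr2]) (use in1 in auto)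
      then show "wval nE s2 = m \<and> wfits w nE s2" by (simp add: input_simps)
    qed (auto simp: labelled_def)
  qed
  have "runs w (component_prog q) s (10 + ((n * (40 + 40) + 40) + (m * (n * 100 + 100 + 40) + 40))) (labelled m)"
    unfolding component_prog_def by (rule runs_Seq[OF 1], hypsubst, rule runs_Seq[OF 2 3])
  then show ?thesis
  proof (rule runs_mono)
    fix s' assume l: "labelled m s'"
    have "{..<m} = edge_ids G" by (simp add: edge_ids_def)
    then have "num_components G (edge_ids G) = card (words s' 14 ` verts G)"
      using l num_components_eq_card_labels unfolding labelled_def by metis
    then show "nums s' 1 0 = (a - 1) ^ (n - num_components G (edge_ids G)) / of_nat q ^ n"
      using l by (simp add: labelled_def)
  qed (simp add: algebra_simps)
qed

section \<open>The total running time and the word size\<close>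

definition total_time :: nat where
  "total_time = n * (N * n * (N * n * 100 + 140) + 100) + 40 +
    (n * n * (m * 240 + 140) + 40 +
    (n * (n * (n * 100 + 140) + 180) + 60 +
    (n * (n * 100 + 100) + 40 +
    (n * (q ^ (width T bag + 1) * (q * (n * 190 + 190) + 140) + 80) + 40 +
    (n * 100 + m * (n * 100 + 140) + 100 +
    (n * 100 + 40))))))"

lemma tutte_prog_runs:
  assumes s: "input s" "\<forall>v<n. words s 11 v = 0" "\<forall>i<n. words s 13 i = 0"
  shows "runs w (tutte_prog q) s total_time (\<lambda>s'. nums s' 1 0 = tutte G a b)"
  unfolding tutte_prog_def total_time_def
proof (rule runs_Seq[OF order_prog_runs[OF s(1,2)]])
  fix s1 assume fr1: "frame order_prog s s1" and vc: "valid_choices (words s1 10) n"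
  define sel where "sel = words s1 10"
  interpret om: ordered_machine G T bag q w a b sel
    using valid_choices_order[OF vc] tutte_machine_axioms
    by (simp add: ordered_machine_def sel_def)
  have s1: "input s1" "om.choices s1"
    unfolding om.choices_def using vc input_frame[OF fr1 s(1)] by (auto simp: sel_def valid_choices_def)
  show "runs w (table_prog;; slot_prog q;; next_prog;; message_prog q;; component_prog q;; root_prog) s1
    (n * n * (m * 240 + 140) + 40 +
    (n * (n * (n * 100 + 140) + 180) + 60 +
    (n * (n * 100 + 100) + 40 +
    (n * (q ^ (width T bag + 1) * (q * (n * 190 + 190) + 140) + 80) + 40 +
    (n * 100 + m * (n * 100 + 140) + 100 +
    (n * 100 + 40)))))) (\<lambda>s'. nums s' 1 0 = tutte G a b)"
  proof (rule runs_Seq[OF om.table_prog_runs[OF s1]])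
    fix s2 assume fr2: "frame table_prog s1 s2" and t2: "om.tables s2"
    have s2: "input s2" "\<forall>i<n. words s2 13 i = 0"
      using input_frame[OF fr2 s1(1)] frame_words[OF fr2] frame_words[OF fr1] s(3) by auto
    show "runs w (slot_prog q;; next_prog;; message_prog q;; component_prog q;; root_prog) s2
      (n * (n * (n * 100 + 140) + 180) + 60 +
      (n * (n * 100 + 100) + 40 +
      (n * (q ^ (width T bag + 1) * (q * (n * 190 + 190) + 140) + 80) + 40 +
      (n * 100 + m * (n * 100 + 140) + 100 +
      (n * 100 + 40))))) (\<lambda>s'. nums s' 1 0 = tutte G a b)"
    proof (rule runs_Seq[OF om.slot_prog_runs[OF s2(1) t2 s2(2)]])
      fix s3 assume fr3: "frame (slot_prog q) s2 s3" and ex: "\<exists>sl t. om.proper_slots sl t \<and> om.slots sl t s3"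
      then obtain sl t where sl: "om.proper_slots sl t" "om.slots sl t s3" by blast
      interpret sm: slotted_machine G T bag q w a b sel sl t
        by unfold_locales (rule sl(1))
      have s3: "input s3" "om.tables s3"
        using input_frame[OF fr3 s2(1)] om.tables_frame[OF fr3 t2] by auto
      \<comment> \<open>Only here is \<open>t\<close> replaced by its bound; the program itself
        works with tables of size \<open>q ^ t\<close>.\<close>
      have "q ^ t \<le> q ^ (width T bag + 1)"
        using sl(1) q_ge unfolding om.proper_slots_def by (intro power_increasing) auto
      then have "n * (q ^ t * (q * (n * 190 + 190) + 140) + 80) + 40 \<le>
          n * (q ^ (width T bag + 1) * (q * (n * 190 + 190) + 140) + 80) + 40"
        by (intro add_mono mult_mono) auto
      note msg = runs_mono[OF sm.message_prog_runs this]
      show "runs w (next_prog;; message_prog q;; component_prog q;; root_prog) s3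
        (n * (n * 100 + 100) + 40 +
        (n * (q ^ (width T bag + 1) * (q * (n * 190 + 190) + 140) + 80) + 40 +
        (n * 100 + m * (n * 100 + 140) + 100 +
        (n * 100 + 40)))) (\<lambda>s'. nums s' 1 0 = tutte G a b)"
      proof (rule runs_Seq[OF om.next_prog_runs[OF s3]])
        fix s4 assume fr4: "frame next_prog s3 s4" and nx: "\<forall>i<n. words s4 15 i = next_nbr n om.later_nbrs i"
        have s4: "sm.ready s4"
          using input_frame[OF fr4 s3(1)] om.tables_frame[OF fr4 s3(2)] om.slots_frame[OF fr4 sl(2)] nx
          by (simp add: sm.ready_def)
        show "runs w (message_prog q;; component_prog q;; root_prog) s4
          (n * (q ^ (width T bag + 1) * (q * (n * 190 + 190) + 140) + 80) + 40 +
          (n * 100 + m * (n * 100 + 140) + 100 +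
          (n * 100 + 40))) (\<lambda>s'. nums s' 1 0 = tutte G a b)"
        proof (rule runs_Seq[OF msg[OF s4]])
          fix s5 assume fr5: "frame (message_prog q) s4 s5" and m5: "sm.messages n s5"
          have s5: "sm.ready s5" by (rule sm.ready_frame[OF fr5 s4]) auto
          show "runs w (component_prog q;; root_prog) s5
            (n * 100 + m * (n * 100 + 140) + 100 + (n * 100 + 40)) (\<lambda>s'. nums s' 1 0 = tutte G a b)"
          proof (rule runs_Seq[OF component_prog_runs[OF sm.ready_simps(1)[OF s5]]])
            fix s6 assume fr6: "frame (component_prog q) s5 s6"
              and acc: "nums s6 1 0 = (a - 1) ^ (n - num_components G (edge_ids G)) / of_nat q ^ n"
            have s6: "sm.ready s6" by (rule sm.ready_frame[OF fr6 s5]) auto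
            have m6: "sm.messages n s6" by (rule sm.messages_frame[OF fr6 m5]) auto
            have "tutte G a b = nums s6 1 0 * potts G q b"
              using tutte_eq_potts[OF wf ab] q_ge acc by (simp add: verts_eq)
            then show "runs w root_prog s6 (n * 100 + 40) (\<lambda>s'. nums s' 1 0 = tutte G a b)"
              using sm.root_prog_runs[OF s6 m6] by simp
          qed
        qed
      qed
    qed
  qed
qed

end

text \<open>This absorbs the mixed monomials of the running time into two pure powers;
  \<open>1 \<le> y\<close> lets the exponent grow even if \<open>x\<close> is 0.\<close>

lemma mixed_power_le:
  fixes x y :: nat
  assumes "i + j \<le> d" "1 \<le> y"
  shows "x ^ i * y ^ j \<le> x ^ d + y ^ d"
proof -
  have "x ^ i * y ^ j \<le> max x y ^ i * max x y ^ j" by (intro mult_mono power_mono) auto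
  also have "\<dots> \<le> max x y ^ d"
    unfolding power_add[symmetric] using assms by (intro power_increasing) auto
  also have "\<dots> \<le> x ^ d + y ^ d" by (auto simp: max_def)
  finally show ?thesis .
qed

lemma (in tutte_machine) total_time_le:
  assumes B: "B = q ^ width T bag * n ^ 10 + (m + N) ^ 10" and N: "1 \<le> N"
  shows "total_time \<le> 2000 * q ^ 2 * B"
proof -
  define M where "M = m + N"
  have M: "N \<le> M" "m \<le> M" "1 \<le> M" using N by (auto simp: M_def)
  have K: "1 \<le> q ^ width T bag" using q_ge by simp
  then have "n ^ 10 \<le> q ^ width T bag * n ^ 10" by simp
  then have mono: "n ^ i * M ^ j \<le> B" if "i + j \<le> 10" for i j
    using mixed_power_le[OF that M(3), of n] unfolding B M_def by linarith
  have mons: "n ^ 3 * N ^ 2 \<le> B" "n ^ 2 * N \<le> B" "n ^ 2 * m \<le> B" "m * n \<le> B" "m \<le> B"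
    "n \<le> B" "1 \<le> B" "n ^ 2 \<le> B" "n ^ 3 \<le> B"
  proof -
    have "n ^ 3 * N ^ 2 \<le> n ^ 3 * M ^ 2" using M(1) by (intro mult_le_mono2 power_mono) auto
    then show "n ^ 3 * N ^ 2 \<le> B" using mono[of 3 2] by linarith
    have nM: "n ^ 2 * M \<le> B" "n * M \<le> B" "M \<le> B"
      using mono[of 2 1] mono[of 1 1] mono[of 0 1] by simp_all
    show "n ^ 2 * N \<le> B" using nM(1) mult_le_mono2[OF M(1), of "n ^ 2"] by linarith
    show "n ^ 2 * m \<le> B" using nM(1) mult_le_mono2[OF M(2), of "n ^ 2"] by linarith
    show "m * n \<le> B" using nM(2) mult_le_mono2[OF M(2), of n] unfolding mult.commute[of m n] by linarith
    show "m \<le> B" using nM(3) M(2) by linarith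
    show "n \<le> B" "1 \<le> B" "n ^ 2 \<le> B" "n ^ 3 \<le> B"
      using mono[of 1 0] mono[of 0 0] mono[of 2 0] mono[of 3 0] by simp_all
  qed
  \<comment> \<open>A positive power of \<open>n\<close> is essential: for \<open>n = 0\<close> the
    bound \<open>B\<close> keeps no trace of \<open>q ^ width T bag\<close>. The outer loop of the
    message program supplies it.\<close>
  have dp: "q ^ width T bag * n ^ i \<le> B" if "0 < i" "i \<le> 10" for i
  proof -
    have "n ^ i \<le> n ^ 10" using that by (cases "n = 0") (auto intro: power_increasing)
    then have "q ^ width T bag * n ^ i \<le> q ^ width T bag * n ^ 10" by simp
    then show ?thesis unfolding B by linarith
  qed
  have q2: "q \<le> q ^ 2" "9 \<le> q ^ 2" using q_ge power_mono[of 3 q 2] by (auto simp: power2_eq_square)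
  define K where "K = q ^ width T bag"
  have "n * (q ^ (width T bag + 1) * (q * (n * 190 + 190) + 140) + 80) + 40 =
      190 * q ^ 2 * (K * n ^ 2) + 190 * q ^ 2 * (K * n ^ 1) + 140 * (q * (K * n ^ 1)) + 80 * n + 40"
    by (simp add: K_def algebra_simps power2_eq_square)
  also have "\<dots> \<le> 190 * q ^ 2 * B + 190 * q ^ 2 * B + 140 * (q ^ 2 * B) + 80 * B + 40 * B"
    using dp[of 1] dp[of 2] mons(6,7) q2 unfolding K_def
    by (intro add_mono mult_mono) (auto intro!: mult_mono)
  finally have 5: "n * (q ^ (width T bag + 1) * (q * (n * 190 + 190) + 140) + 80) + 40 \<le> 520 * (q ^ 2 * B) + 120 * B"
    by (simp add: algebra_simps)
  have 1: "n * (N * n * (N * n * 100 + 140) + 100) + 40 \<le> 380 * B"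
  proof -
    have "n * (N * n * (N * n * 100 + 140) + 100) + 40 = 100 * (n ^ 3 * N ^ 2) + 140 * (n ^ 2 * N) + 100 * n + 40"
      by (simp add: algebra_simps power2_eq_square power3_eq_cube)
    then show ?thesis using mons by linarith
  qed
  have 2: "n * n * (m * 240 + 140) + 40 \<le> 420 * B"
  proof -
    have "n * n * (m * 240 + 140) + 40 = 240 * (n ^ 2 * m) + 140 * n ^ 2 + 40"
      by (simp add: algebra_simps power2_eq_square)
    then show ?thesis using mons by linarith
  qed
  have 3: "n * (n * (n * 100 + 140) + 180) + 60 \<le> 480 * B"
  proof -
    have "n * (n * (n * 100 + 140) + 180) + 60 = 100 * n ^ 3 + 140 * n ^ 2 + 180 * n + 60"
      by (simp add: algebra_simps power2_eq_square power3_eq_cube)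
    then show ?thesis using mons by linarith
  qed
  have 4: "n * (n * 100 + 100) + 40 \<le> 240 * B"
  proof -
    have "n * (n * 100 + 100) + 40 = 100 * n ^ 2 + 100 * n + 40"
      by (simp add: algebra_simps power2_eq_square)
    then show ?thesis using mons by linarith
  qed
  have 6: "n * 100 + m * (n * 100 + 140) + 100 \<le> 440 * B"
  proof -
    have "n * 100 + m * (n * 100 + 140) + 100 = 100 * n + 100 * (m * n) + 140 * m + 100"
      by (simp add: algebra_simps)
    then show ?thesis using mons by linarith
  qed
  \<comment> \<open>Because \<open>9 \<le> q ^ 2\<close>, the second term is below
    \<open>256 * (q ^ 2 * B)\<close>, so the constant 2000 leaves ample room.\<close>
  have "total_time \<le> 520 * (q ^ 2 * B) + 2300 * B"
    unfolding total_time_def using 1 2 3 4 5 6 mons(6,7) by linarith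
  moreover have "9 * B \<le> q ^ 2 * B" using q2(2) by (rule mult_le_mono1)
  ultimately show ?thesis by linarith
qed

lemma input_state_input:
  assumes "tutte_machine G T bag q w a b"
  shows "tutte_machine.input G T bag a b (input_state G T bag a b)"
proof -
  interpret tutte_machine G T bag q w a b by (rule assms)
  have "bag_matrix G T bag (i * n + u) = (if u \<in> bag i then 1 else 0)" if "i < N" "u < n" for i u
    using row_major_less[OF that] that by (simp add: bag_matrix_def)
  then show ?thesis by (simp add: input_def input_state_def array_of_def)
qed

text \<open>Without vertices \<open>B\<close> does not control \<open>q ^ treewidth G\<close>, and
  the table capacity rests on the width being 0.\<close>

lemma width_no_vertices:
  assumes "tree_decomposition G T bag" "nverts G = 0"
  shows "width T bag = 0"
proof -
  have "bag i = {}" if "i \<in> verts T" for i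
    using assms that by (auto simp: tree_decomposition_def verts_def)
  moreover have "verts T \<noteq> {}" using assms tree_verts by (auto simp: tree_decomposition_def)
  ultimately have "(\<lambda>i. card (bag i)) ` verts T = {0}" by auto
  then show ?thesis by (simp add: width_def)
qed

text \<open>One expression bounds both the time and, through the hypothesis on \<open>2 ^ w\<close>,
  the words. Since \<open>3 * q \<le> q ^ 2\<close>, the witness \<open>2000 * q ^ 2\<close> leaves
  \<open>6000 * (q * B)\<close> below \<open>2 ^ w\<close>, while the capacities of
  \<open>tutte_machine\<close> need only a small multiple of \<open>q * B\<close>. The degree 10
  exceeds the largest one needed, that of \<open>n ^ 3 * N ^ 2\<close> in the search for the
  order.\<close>

theorem theorem40:
  fixes q :: nat
  assumes "q \<ge> 3"
  shows "\<exists>(P :: com) (C :: nat) (d :: nat).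
    \<forall>(G :: graph) (T :: graph) (bag :: nat \<Rightarrow> nat set) (a :: 'a :: field_char_0) (b :: 'a) (w :: nat).
      wf_graph G \<and>
      tree_decomposition G T bag \<and> width T bag = treewidth G \<and>
      (a - 1) * (b - 1) = of_nat q \<and>
      C * (q ^ treewidth G * nverts G ^ d + (length (edges G) + nverts T) ^ d) \<le> 2 ^ w
      \<longrightarrow> (\<exists>t s. run w P (input_state G T bag a b) t s \<and>
                result s = tutte G a b \<and>
                t \<le> C * (q ^ treewidth G * nverts G ^ d + (length (edges G) + nverts T) ^ d))"
proof (rule exI[of _ "tutte_prog q"], rule exI[of _ "2000 * q ^ 2"], rule exI[of _ 10], intro allI impI)
  fix G T :: graph and bag :: "nat \<Rightarrow> nat set" and a b :: 'a and w :: nat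
  let ?n = "nverts G" and ?N = "nverts T" and ?m = "length (edges G)"
  define B where "B = q ^ treewidth G * ?n ^ 10 + (?m + ?N) ^ 10"
  assume "wf_graph G \<and> tree_decomposition G T bag \<and> width T bag = treewidth G \<and>
      (a - 1) * (b - 1) = of_nat q \<and>
      2000 * q ^ 2 * (q ^ treewidth G * ?n ^ 10 + (?m + ?N) ^ 10) \<le> 2 ^ w"
  then have wf: "wf_graph G" and td: "tree_decomposition G T bag" and tw: "width T bag = treewidth G"
    and ab: "(a - 1) * (b - 1) = of_nat q" and cap: "2000 * q ^ 2 * B \<le> 2 ^ w" by (auto simp: B_def)
  have N: "1 \<le> ?N" using td tree_verts[of T] by (auto simp: tree_decomposition_def verts_def)
  have K: "1 \<le> q ^ treewidth G" using assms by simp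
  have mono: "?n ^ i * (?m + ?N) ^ j \<le> B" if "i + j \<le> 10" for i j
  proof -
    have "?n ^ i * (?m + ?N) ^ j \<le> ?n ^ 10 + (?m + ?N) ^ 10" using N by (intro mixed_power_le that) simp
    also have "\<dots> \<le> B" using K by (simp add: B_def)
    finally show ?thesis .
  qed
  have le: "?n * ?n \<le> B" "?n \<le> B" "?N * ?n \<le> B" "?N \<le> B" "?m \<le> B" "1 \<le> B"
    using mono[of 2 0] mono[of 1 0] mono[of 1 1] mono[of 0 1] mono[of 0 0]
    by (simp_all add: power2_eq_square algebra_simps)
  have q2: "3 * q \<le> q ^ 2" using assms by (simp add: power2_eq_square)
  have qB: "6000 * (q * B) \<le> 2 ^ w"
  proof -
    have "6000 * (q * B) = 2000 * (3 * q * B)" by simp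
    also have "\<dots> \<le> 2000 * (q ^ 2 * B)" using q2 by (intro mult_le_mono2 mult_le_mono1)
    also have "\<dots> \<le> 2 ^ w" using cap by (simp add: mult.assoc)
    finally show ?thesis .
  qed
  have B3: "3 * B \<le> q * B" "q \<le> q * B" using assms le(6) by (auto intro: mult_le_mono1)
  have table: "(?n + 1) * q ^ (treewidth G + 1) \<le> 2 * (q * B)"
  proof (cases "?n = 0")
    case True
    then have "treewidth G = 0" using width_no_vertices[OF td] tw by simp
    then show ?thesis using True B3(2) by simp
  next
    case False
    then have "?n + 1 \<le> 2 * ?n ^ 10" using self_le_power[of ?n 10] by linarith
    then have "(?n + 1) * q ^ (treewidth G + 1) \<le> 2 * ?n ^ 10 * q ^ (treewidth G + 1)" by (rule mult_le_mono1)
    also have "\<dots> = 2 * (q * (q ^ treewidth G * ?n ^ 10))" by simp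
    also have "\<dots> \<le> 2 * (q * B)" by (simp add: B_def)
    finally show ?thesis .
  qed
  have tm: "tutte_machine G T bag q w a b"
  proof (rule tutte_machine.intro[OF wf td assms ab])
    show "(?n + 1) * q ^ (width T bag + 1) < 2 ^ w"
      unfolding tw using table B3 qB le(6) by linarith
  qed (use le B3 qB in linarith)+
  interpret tutte_machine G T bag q w a b by (rule tm)
  let ?s = "input_state G T bag a b"
  have "runs w (tutte_prog q) ?s total_time (\<lambda>s'. nums s' 1 0 = tutte G a b)"
    by (rule tutte_prog_runs[OF input_state_input[OF tm]]) (simp_all add: input_state_def array_of_def)
  moreover have "total_time \<le> 2000 * q ^ 2 * B"
    by (rule total_time_le[OF _ N]) (simp add: B_def tw)
  ultimately show "\<exists>t s. run w (tutte_prog q) ?s t s \<and> result s = tutte G a b \<and>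
      t \<le> 2000 * q ^ 2 * (q ^ treewidth G * ?n ^ 10 + (?m + ?N) ^ 10)"
    unfolding runs_def result_def B_def by (meson order_trans)
qed

end
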